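(* Let $X,M$ be manifolds with $X$ compact. Suppose $M=G/K$ is the homogeneous space of left cosets of a connected Lie group $G$ (not necessarily compact) by a closed subgroup $K$, and let $p:G\to G/K$ be the natural projection. Let $f,h:X\to M$ be maps and suppose there exists a map $\widehat f:X\to G$ such that $p\circ\widehat f=f$. If $N(f,h)=0$, where $N(f,h)$ is the geometric Nielsen coincidence number, then there exists a map $h'$ homotopic to $h$ such that $Coin(f,h')=\emptyset$.
   Context: All maps are continuous; $X$ and $M$ may be non-orientable and of different dimensions. $Coin(f,h)=\{x\in X:f(x)=h(x)\}$. Two points $x,y\in Coin(f,h)$ are Nielsen equivalent if there is a path $\gamma$ in $X$ from $x$ to $y$ with $f\circ\gamma\sim h\circ\gamma$ relative to endpoints; the equivalence classes are the coincidence classes. Given homotopies $F,H:X\times I\to M$ with $F_0=f$, $H_0=h$, a coincidence class $C$ of $(f,h)$ is related to a coincidence class $C'$ of $(F_1,H_1)$ if there is a path $\lambda$ in $X$ from a point of $C$ to a point of $C'$ such that the paths $t\mapsto F(\lambda(t),t)$ and $t\mapsto H(\lambda(t),t)$ are homotopic relative to endpoints. A class $C$ is geometrically inessential if there are such homotopies $F,H$ for which $C$ is related to no (nonempty) coincidence class of $(F_1,H_1)$; otherwise it is geometrically essential. The geometric Nielsen number $N(f,h)$ is the number of geometrically essential coincidence classes of $(f,h)$. *)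

theory Defs
  imports
    "HOL-Analysis.Analysis"
    "HOL-Algebra.Coset"
    "HOL-Library.Extended_Nat"
begin

text \<open>Manifolds are without boundary, not necessarily connected, and may have dimension \<open>0\<close>;
  the type-class model \<open>real ^ 'n\<close> would exclude dimension \<open>0\<close>.\<close>

definition topological_manifold :: "nat \<Rightarrow> 'a topology \<Rightarrow> bool" where
  "topological_manifold n X \<longleftrightarrow>
     Hausdorff_space X \<and> second_countable X \<and>
     (\<forall>x\<in>topspace X. \<exists>U V. openin X U \<and> x \<in> U \<and> openin (Euclidean_space n) V \<and>
        subtopology X U homeomorphic_space subtopology (Euclidean_space n) V)"

text \<open>\<open>Ck_on k n W g\<close>: on the open subset \<open>W\<close> of \<open>Euclidean_space n\<close>, all iterated partial
  derivatives of \<open>g\<close> of order at most \<open>k\<close> exist and are continuous. For \<open>x \<in> W\<close> and \<open>i < n\<close>, the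
  points \<open>x(i := t)\<close> lie in \<open>W\<close> for all \<open>t\<close> near \<open>x i\<close>, so values of \<open>g\<close> off \<open>W\<close> are irrelevant.\<close>

primrec Ck_on :: "nat \<Rightarrow> nat \<Rightarrow> (nat \<Rightarrow> real) set \<Rightarrow> ((nat \<Rightarrow> real) \<Rightarrow> real) \<Rightarrow> bool" where
  "Ck_on 0 n W g \<longleftrightarrow> continuous_map (subtopology (Euclidean_space n) W) euclideanreal g"
| "Ck_on (Suc k) n W g \<longleftrightarrow>
     continuous_map (subtopology (Euclidean_space n) W) euclideanreal g \<and>
     (\<forall>i<n. (\<forall>x\<in>W. (\<lambda>t. g (x(i := t))) field_differentiable at (x i)) \<and>
            Ck_on k n W (\<lambda>x. deriv (\<lambda>t. g (x(i := t))) (x i)))"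

definition smooth_on :: "nat \<Rightarrow> nat \<Rightarrow> (nat \<Rightarrow> real) set \<Rightarrow> ((nat \<Rightarrow> real) \<Rightarrow> (nat \<Rightarrow> real)) \<Rightarrow> bool" where
  "smooth_on n m W \<Phi> \<longleftrightarrow> (\<forall>j<m. \<forall>k. Ck_on k n W (\<lambda>x. \<Phi> x j))"

type_synonym 'a chart = "'a set \<times> ('a \<Rightarrow> nat \<Rightarrow> real)"

definition is_chart :: "nat \<Rightarrow> 'a topology \<Rightarrow> 'a chart \<Rightarrow> bool" where
  "is_chart n X = (\<lambda>(U, \<phi>). openin X U \<and> openin (Euclidean_space n) (\<phi> ` U) \<and>
     homeomorphic_map (subtopology X U) (subtopology (Euclidean_space n) (\<phi> ` U)) \<phi>)"

definition smooth_atlas :: "nat \<Rightarrow> 'a topology \<Rightarrow> 'a chart set \<Rightarrow> bool" where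
  "smooth_atlas n X A \<longleftrightarrow>
     (\<forall>c\<in>A. is_chart n X c) \<and> (\<Union>(U, \<phi>)\<in>A. U) = topspace X \<and>
     (\<forall>(U, \<phi>)\<in>A. \<forall>(V, \<psi>)\<in>A. smooth_on n n (\<phi> ` (U \<inter> V)) (\<psi> \<circ> inv_into U \<phi>))"

definition smooth_manifold :: "nat \<Rightarrow> 'a topology \<Rightarrow> 'a chart set \<Rightarrow> bool" where
  "smooth_manifold n X A \<longleftrightarrow> Hausdorff_space X \<and> second_countable X \<and> smooth_atlas n X A"

definition smooth_map ::
    "nat \<Rightarrow> 'a topology \<Rightarrow> 'a chart set \<Rightarrow> nat \<Rightarrow> 'b topology \<Rightarrow> 'b chart set \<Rightarrow> ('a \<Rightarrow> 'b) \<Rightarrow> bool" where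
  "smooth_map n X A m Y B f \<longleftrightarrow> continuous_map X Y f \<and>
     (\<forall>(U, \<phi>)\<in>A. \<forall>(V, \<psi>)\<in>B.
        smooth_on n m (\<phi> ` {x\<in>U. f x \<in> V}) (\<psi> \<circ> f \<circ> inv_into U \<phi>))"

text \<open>\<open>concat_coords n\<close> is the identification of \<open>\<real>\<^sup>n \<times> \<real>\<^sup>m\<close> with \<open>\<real>\<^bsup>n+m\<^esup>\<close>.\<close>

definition concat_coords :: "nat \<Rightarrow> (nat \<Rightarrow> real) \<Rightarrow> (nat \<Rightarrow> real) \<Rightarrow> nat \<Rightarrow> real" where
  "concat_coords n a b = (\<lambda>i. if i < n then a i else b (i - n))"

definition prod_atlas :: "nat \<Rightarrow> 'a chart set \<Rightarrow> 'b chart set \<Rightarrow> ('a \<times> 'b) chart set" where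
  "prod_atlas n A B =
     {(U \<times> V, \<lambda>(x, y). concat_coords n (\<phi> x) (\<psi> y)) | U \<phi> V \<psi>. (U, \<phi>) \<in> A \<and> (V, \<psi>) \<in> B}"

definition lie_group :: "('g, 'r) monoid_scheme \<Rightarrow> nat \<Rightarrow> 'g topology \<Rightarrow> 'g chart set \<Rightarrow> bool" where
  "lie_group G n T A \<longleftrightarrow>
     group G \<and> topspace T = carrier G \<and> smooth_manifold n T A \<and>
     smooth_map (n + n) (prod_topology T T) (prod_atlas n A A) n T A (\<lambda>(x, y). x \<otimes>\<^bsub>G\<^esub> y) \<and>
     smooth_map n T A n T A (\<lambda>x. inv\<^bsub>G\<^esub> x)"

definition Coin :: "'x topology \<Rightarrow> ('x \<Rightarrow> 'm) \<Rightarrow> ('x \<Rightarrow> 'm) \<Rightarrow> 'x set" where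
  "Coin X f h = {x \<in> topspace X. f x = h x}"

definition homotopic_rel_endpoints :: "'m topology \<Rightarrow> (real \<Rightarrow> 'm) \<Rightarrow> (real \<Rightarrow> 'm) \<Rightarrow> bool" where
  "homotopic_rel_endpoints M p q \<longleftrightarrow>
     homotopic_with (\<lambda>r. r 0 = p 0 \<and> r 1 = p 1) (top_of_set {0..1}) M p q"

definition nielsen_rel ::
    "'x topology \<Rightarrow> 'm topology \<Rightarrow> ('x \<Rightarrow> 'm) \<Rightarrow> ('x \<Rightarrow> 'm) \<Rightarrow> ('x \<times> 'x) set" where
  "nielsen_rel X M f h = {(x, y). x \<in> Coin X f h \<and> y \<in> Coin X f h \<and>
     (\<exists>\<gamma>. pathin X \<gamma> \<and> \<gamma> 0 = x \<and> \<gamma> 1 = y \<and> homotopic_rel_endpoints M (f \<circ> \<gamma>) (h \<circ> \<gamma>))}"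

definition coincidence_classes ::
    "'x topology \<Rightarrow> 'm topology \<Rightarrow> ('x \<Rightarrow> 'm) \<Rightarrow> ('x \<Rightarrow> 'm) \<Rightarrow> 'x set set" where
  "coincidence_classes X M f h = Coin X f h // nielsen_rel X M f h"

definition homotopy_from ::
    "'x topology \<Rightarrow> 'm topology \<Rightarrow> ('x \<Rightarrow> 'm) \<Rightarrow> ('x \<times> real \<Rightarrow> 'm) \<Rightarrow> bool" where
  "homotopy_from X M f F \<longleftrightarrow>
     continuous_map (prod_topology X (top_of_set {0..1})) M F \<and> (\<forall>x\<in>topspace X. F (x, 0) = f x)"

definition related_via ::
    "'x topology \<Rightarrow> 'm topology \<Rightarrow> ('x \<times> real \<Rightarrow> 'm) \<Rightarrow> ('x \<times> real \<Rightarrow> 'm) \<Rightarrow> 'x set \<Rightarrow> 'x set \<Rightarrow> bool" where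
  "related_via X M F H C C' \<longleftrightarrow>
     (\<exists>l. pathin X l \<and> l 0 \<in> C \<and> l 1 \<in> C' \<and>
        homotopic_rel_endpoints M (\<lambda>t. F (l t, t)) (\<lambda>t. H (l t, t)))"

definition geometrically_inessential ::
    "'x topology \<Rightarrow> 'm topology \<Rightarrow> ('x \<Rightarrow> 'm) \<Rightarrow> ('x \<Rightarrow> 'm) \<Rightarrow> 'x set \<Rightarrow> bool" where
  "geometrically_inessential X M f h C \<longleftrightarrow>
     (\<exists>F H. homotopy_from X M f F \<and> homotopy_from X M h H \<and>
        (\<forall>C' \<in> coincidence_classes X M (\<lambda>x. F (x, 1)) (\<lambda>x. H (x, 1)). \<not> related_via X M F H C C'))"

definition essential_classes ::
    "'x topology \<Rightarrow> 'm topology \<Rightarrow> ('x \<Rightarrow> 'm) \<Rightarrow> ('x \<Rightarrow> 'm) \<Rightarrow> 'x set set" where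
  "essential_classes X M f h =
     {C \<in> coincidence_classes X M f h. \<not> geometrically_inessential X M f h C}"

text \<open>\<open>enat\<close>-valued, because \<open>card\<close> is \<open>0\<close> on infinite sets.\<close>

definition geometric_nielsen_number ::
    "'x topology \<Rightarrow> 'm topology \<Rightarrow> ('x \<Rightarrow> 'm) \<Rightarrow> ('x \<Rightarrow> 'm) \<Rightarrow> enat" where
  "geometric_nielsen_number X M f h =
     (if finite (essential_classes X M f h) then enat (card (essential_classes X M f h)) else \<infinity>)"

end

theory Submission
  imports Defs
begin

text \<open>Fix a coincidence \<open>x0\<close> and think of a deformation of a pair of maps as a homotopy of the second
  map relative to a moving target. The basic step is local: when no coincidence is related to \<open>x0\<close>
  and the target moves a little inside a coordinate ball, the points of \<open>X\<close> whose label (homotopy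
  class of paths) would make them related to \<open>x0\<close> form an open and relatively closed piece of the
  preimage of the ball, and on this piece the second map avoids the centre, so that it can be pushed
  radially out of a ball that contains the new target.

  Running the target of an inessential class backwards along its own homotopy turns a pair of
  homotopies \<open>F\<close>, \<open>H\<close> into a homotopy of \<open>h\<close> alone. Multiplying by the inverse of the lift of \<open>f\<close>, the
  coincidences become roots of \<open>X \<rightarrow> G/K\<close> at \<open>K\<close>, one class of which is empty. If the target is now moved
  along any loop at \<open>K\<close>, the push can be arranged to create no roots (choose spheres missing \<open>K\<close>), and
  it deletes all roots whose label is that loop. Compactness leaves finitely many labels to
  delete. The components of \<open>X\<close> are treated separately. Neither covering spaces nor local
  sections of \<open>G \<rightarrow> G/K\<close> are needed.\<close>

section \<open>Homotopies of paths relative to endpoints\<close>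

text \<open>The label of a path \<open>l\<close> along a homotopy \<open>\<Phi>\<close> is the path
  \<open>\<lambda>t. \<Phi> (l t, t)\<close>; a path makes its end related to its start when its
  labels along the target and along the second homotopy agree up to homotopy relative to endpoints.

  Why a single empty class suffices: once the lift of \<open>f\<close> has turned the target into
  the constant \<open>K\<close>, every loop at \<open>K\<close> is an admissible motion of the
  target that starts from the constant one. Emptiness of the class with constant label is carried
  along by this motion and becomes emptiness of the class labelled by that loop.

  The obstacle is that removing one class may create coincidences elsewhere. Hence there are two
  invariants of different strength. \<open>unrelated\<close> watches only what is related to
  \<open>x0\<close> and lets other coincidences appear; this is enough to reach a homotopy of
  \<open>h\<close> alone. \<open>refines\<close> forbids new roots and preserves the labels of the
  surviving ones, so that deletions accumulate.\<close>

lemma homotopic_rel_endpoints_iff: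
  "homotopic_rel_endpoints M p q \<longleftrightarrow>
     (\<exists>K. continuous_map (top_of_set ({0..1::real} \<times> {0..1::real})) M K \<and>
        (\<forall>t\<in>{0..1}. K (0, t) = p t \<and> K (1, t) = q t) \<and>
        (\<forall>s\<in>{0..1}. K (s, 0) = p 0 \<and> K (s, 1) = p 1))"
  unfolding homotopic_rel_endpoints_def
  by (subst homotopic_with) (simp_all add: ball_conj_distrib)

lemma homotopic_rel_endpoints_imp:
  assumes "homotopic_rel_endpoints M p q"
  shows "pathin M p" "pathin M q" "p 0 = q 0" "p 1 = q 1"
proof -
  show "pathin M p" "pathin M q"
    using homotopic_with_imp_continuous_maps[OF assms[unfolded homotopic_rel_endpoints_def]]
    by (simp_all add: pathin_def)
  obtain K where K: "\<forall>t\<in>{0..1}. K (0::real, t::real) = p t \<and> K (1, t) = q t"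
      "\<forall>s\<in>{0..1}. K (s, 0) = p 0 \<and> K (s, 1) = p 1"
    using assms by (auto simp: homotopic_rel_endpoints_iff)
  show "p 0 = q 0" using K(1)[rule_format, of 0] K(2)[rule_format, of 1] by auto
  show "p 1 = q 1" using K(1)[rule_format, of 1] K(2)[rule_format, of 1] by auto
qed

text \<open>Straight-line homotopy inside the convex set \<open>S\<close>, followed by
  \<open>\<Theta>\<close>. Comparisons of labels below draw both paths in an interval, a square or a
  cube and reduce to this.\<close>

lemma homotopic_rel_endpoints_factor:
  fixes S :: "'b::real_normed_vector set"
  assumes \<Theta>: "continuous_map (top_of_set S) M \<Theta>" and S: "convex S"
    and u: "continuous_on {0..1} u" "u \<in> {0..1} \<rightarrow> S"
    and v: "continuous_on {0..1} v" "v \<in> {0..1} \<rightarrow> S"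
    and ends: "u 0 = v 0" "u 1 = v 1"
  shows "homotopic_rel_endpoints M (\<lambda>t. \<Theta> (u t)) (\<lambda>t. \<Theta> (v t))"
  unfolding homotopic_rel_endpoints_iff
proof (intro exI conjI ballI)
  let ?L = "\<lambda>(s, t). (1 - s) *\<^sub>R u t + s *\<^sub>R v t"
  have "continuous_on ({0..1} \<times> {0..1}) ?L"
    unfolding case_prod_beta
    by (intro continuous_intros continuous_on_compose2[OF u(1)] continuous_on_compose2[OF v(1)]) auto
  moreover have "?L \<in> {0..1} \<times> {0..1} \<rightarrow> S"
    using u(2) v(2) S by (force intro!: convexD)
  ultimately show "continuous_map (top_of_set ({0..1} \<times> {0..1})) M (\<Theta> \<circ> ?L)"
    by (intro continuous_map_compose[OF _ \<Theta>]) (auto simp: continuous_map_in_subtopology)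
qed (use ends in \<open>auto simp flip: scaleR_add_left\<close>)

lemma homotopic_rel_endpoints_refl: "pathin M p \<Longrightarrow> homotopic_rel_endpoints M p p"
  by (simp add: homotopic_rel_endpoints_def pathin_def)

lemma homotopic_rel_endpoints_sym:
  assumes "homotopic_rel_endpoints M p q" shows "homotopic_rel_endpoints M q p"
  using assms homotopic_rel_endpoints_imp(3,4)[OF assms]
  by (simp add: homotopic_rel_endpoints_def homotopic_with_sym)

lemma homotopic_rel_endpoints_trans [trans]:
  assumes "homotopic_rel_endpoints M p q" "homotopic_rel_endpoints M q r"
  shows "homotopic_rel_endpoints M p r"
  using assms homotopic_rel_endpoints_imp(3,4)[OF assms(1)]
  by (auto simp: homotopic_rel_endpoints_def intro: homotopic_with_trans)

lemma homotopic_rel_endpoints_eq: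
  assumes "pathin M p" "\<And>t. t \<in> {0..1} \<Longrightarrow> p t = q t"
  shows "homotopic_rel_endpoints M p q"
proof -
  have "continuous_map (top_of_set ({0..1::real} \<times> {0..1::real})) M (p \<circ> snd)"
    using assms(1) unfolding pathin_def
    by (rule continuous_map_compose[rotated])
       (auto simp: continuous_map_in_subtopology intro!: continuous_intros)
  then show ?thesis
    unfolding homotopic_rel_endpoints_iff using assms(2)
    by (intro exI[of _ "p \<circ> snd"]) auto
qed

section \<open>Concatenation of paths and of homotopies\<close>

definition pjoin :: "(real \<Rightarrow> 'a) \<Rightarrow> (real \<Rightarrow> 'a) \<Rightarrow> real \<Rightarrow> 'a" where
  "pjoin p q = (\<lambda>t. if t \<le> 1/2 then p (2 * t) else q (2 * t - 1))"

lemma pjoin_ends [simp]: "pjoin p q 0 = p 0" "pjoin p q 1 = q 1"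
  by (auto simp: pjoin_def)

definition hjoin :: "('x \<times> real \<Rightarrow> 'm) \<Rightarrow> ('x \<times> real \<Rightarrow> 'm) \<Rightarrow> 'x \<times> real \<Rightarrow> 'm" where
  "hjoin \<Phi> \<Psi> = (\<lambda>(x, t). if t \<le> 1/2 then \<Phi> (x, 2 * t) else \<Psi> (x, 2 * t - 1))"

lemma hjoin_ends [simp]: "hjoin \<Phi> \<Psi> (x, 0) = \<Phi> (x, 0)" "hjoin \<Phi> \<Psi> (x, 1) = \<Psi> (x, 1)"
  by (auto simp: hjoin_def)

lemma continuous_map_hjoin:
  assumes "continuous_map (prod_topology X (top_of_set {0..1})) M \<Phi>"
    and "continuous_map (prod_topology X (top_of_set {0..1})) M \<Psi>"
    and "\<And>x. x \<in> topspace X \<Longrightarrow> \<Phi> (x, 1) = \<Psi> (x, 0)"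
  shows "continuous_map (prod_topology X (top_of_set {0..1})) M (hjoin \<Phi> \<Psi>)"
proof -
  let ?XI = "prod_topology X (top_of_set {0..1::real})"
  have snd: "continuous_map ?XI euclideanreal snd"
    by (metis continuous_map_in_subtopology continuous_map_snd)
  have 1: "continuous_map (subtopology ?XI {z \<in> topspace ?XI. snd z \<le> 1/2}) ?XI (\<lambda>z. (fst z, 2 * snd z))"
    by (auto simp: continuous_map_in_subtopology continuous_map_paired intro!: continuous_map_from_subtopology
          continuous_map_fst snd continuous_map_real_mult)
  have 2: "continuous_map (subtopology ?XI {z \<in> topspace ?XI. 1/2 \<le> snd z}) ?XI (\<lambda>z. (fst z, 2 * snd z - 1))"
    by (auto simp: continuous_map_in_subtopology continuous_map_paired intro!: continuous_map_from_subtopology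
          continuous_map_fst snd continuous_map_real_mult continuous_map_diff)
  have "continuous_map ?XI M (\<lambda>z. if snd z \<le> 1/2 then \<Phi> (fst z, 2 * snd z) else \<Psi> (fst z, 2 * snd z - 1))"
    using continuous_map_compose[OF 1 assms(1)] continuous_map_compose[OF 2 assms(2)]
    by (intro continuous_map_cases_le) (auto simp: o_def assms(3) snd mult.commute)
  then show ?thesis by (simp add: hjoin_def case_prod_beta')
qed

text \<open>A path is a homotopy on a one-point space, so this is a case of
  \<open>continuous_map_hjoin\<close>.\<close>

lemma pathin_pjoin:
  assumes "pathin M p" "pathin M q" "p 1 = q 0"
  shows "pathin M (pjoin p q)"
proof -
  let ?T = "prod_topology (discrete_topology {()}) (top_of_set {0..1::real})"
  have "continuous_map ?T M (hjoin (p \<circ> snd) (q \<circ> snd))"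
    using assms unfolding pathin_def
    by (intro continuous_map_hjoin continuous_map_compose[OF continuous_map_snd]) auto
  then have "continuous_map (top_of_set {0..1}) M (hjoin (p \<circ> snd) (q \<circ> snd) \<circ> (\<lambda>t. ((), t)))"
    by (rule continuous_map_compose[rotated]) (auto simp: continuous_map_paired)
  then show ?thesis
    by (simp add: pathin_def hjoin_def pjoin_def o_def case_prod_beta' cong: if_cong)
qed

text \<open>A family of paths \<open>K (s, t)\<close> is also a homotopy in the time
  \<open>t\<close> on the space of parameters \<open>s\<close>; \<open>hjoin\<close> then
  concatenates the two families for all \<open>s\<close> at once.\<close>

lemma homotopic_rel_endpoints_pjoin:
  assumes p: "homotopic_rel_endpoints M p p'" and q: "homotopic_rel_endpoints M q q'"
    and "p 1 = q 0"
  shows "homotopic_rel_endpoints M (pjoin p q) (pjoin p' q')"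
proof -
  obtain K where K: "continuous_map (top_of_set ({0..1::real} \<times> {0..1::real})) M K"
      "\<forall>t\<in>{0..1}. K (0, t) = p t \<and> K (1, t) = p' t" "\<forall>s\<in>{0..1}. K (s, 0) = p 0 \<and> K (s, 1) = p 1"
    using p by (auto simp: homotopic_rel_endpoints_iff)
  obtain L where L: "continuous_map (top_of_set ({0..1::real} \<times> {0..1::real})) M L"
      "\<forall>t\<in>{0..1}. L (0, t) = q t \<and> L (1, t) = q' t" "\<forall>s\<in>{0..1}. L (s, 0) = q 0 \<and> L (s, 1) = q 1"
    using q by (auto simp: homotopic_rel_endpoints_iff)
  have "continuous_map (prod_topology (top_of_set {0..1::real}) (top_of_set {0..1::real})) M (hjoin K L)"
    using K L assms(3) by (intro continuous_map_hjoin) auto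
  then show ?thesis
    unfolding homotopic_rel_endpoints_iff using K(2,3) L(2,3)
    by (intro exI[of _ "hjoin K L"]) (auto simp: hjoin_def pjoin_def)
qed

lemma pjoin_assoc:
  assumes "pathin M p" "pathin M q" "pathin M r" "p 1 = q 0" "q 1 = r 0"
  shows "homotopic_rel_endpoints M (pjoin (pjoin p q) r) (pjoin p (pjoin q r))"
proof -
  \<comment> \<open>The piecewise linear change of time for which the left concatenation at time
    \<open>v t\<close> is the right concatenation at time \<open>t\<close>; the break points 1/2 and
    3/4 are where \<open>pjoin p (pjoin q r)\<close> changes from \<open>p\<close> to
    \<open>q\<close> and from \<open>q\<close> to \<open>r\<close>.\<close>
  define v where "v = (\<lambda>t::real. if t \<le> 1/2 then t/2 else if t \<le> 3/4 then t - 1/4 else 2 * t - 1)"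
  have v: "continuous_on {0..1} v" 
    unfolding v_def
    by (rule continuous_on_cases_le continuous_intros | auto)+
  have "homotopic_rel_endpoints M (\<lambda>t. pjoin (pjoin p q) r t) (\<lambda>t. pjoin (pjoin p q) r (v t))"
    using pathin_pjoin[OF pathin_pjoin[OF assms(1,2,4)] assms(3)] assms(5) v
    by (intro homotopic_rel_endpoints_factor[where S = "{0..1}" and u = "\<lambda>t. t"])
       (auto simp: pathin_def v_def)
  moreover have "pathin M (pjoin p (pjoin q r))"
    by (intro pathin_pjoin assms) (auto simp: assms)
  then have "homotopic_rel_endpoints M (pjoin p (pjoin q r)) (\<lambda>t. pjoin (pjoin p q) r (v t))"
    by (rule homotopic_rel_endpoints_eq) (auto simp: pjoin_def v_def assms algebra_simps)
  ultimately show ?thesis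
    by (blast intro: homotopic_rel_endpoints_trans homotopic_rel_endpoints_sym)
qed

lemma pjoin_const_right:
  assumes "pathin M p" "p 1 = c"
  shows "homotopic_rel_endpoints M (pjoin p (\<lambda>_. c)) p"
proof -
  define v where "v = (\<lambda>t::real. min (2 * t) 1)"
  have "homotopic_rel_endpoints M (\<lambda>t. p (v t)) (\<lambda>t. p t)"
    using assms(1)
    by (intro homotopic_rel_endpoints_factor[where S = "{0..1}" and v = "\<lambda>t. t"])
       (auto simp: pathin_def v_def intro!: continuous_intros)
  moreover have "pjoin p (\<lambda>_. c) = (\<lambda>t. p (v t))"
    using assms(2) by (auto simp: pjoin_def v_def)
  ultimately show ?thesis by simp
qed

lemma pjoin_const_left:
  assumes "pathin M p" "p 0 = c"
  shows "homotopic_rel_endpoints M (pjoin (\<lambda>_. c) p) p"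
proof -
  define v where "v = (\<lambda>t::real. max (2 * t - 1) 0)"
  have "homotopic_rel_endpoints M (\<lambda>t. p (v t)) (\<lambda>t. p t)"
    using assms(1)
    by (intro homotopic_rel_endpoints_factor[where S = "{0..1}" and v = "\<lambda>t. t"])
       (auto simp: pathin_def v_def intro!: continuous_intros)
  moreover have "pjoin (\<lambda>_. c) p = (\<lambda>t. p (v t))"
    using assms(2) by (auto simp: pjoin_def v_def)
  ultimately show ?thesis by simp
qed

lemma continuous_on_pjoin:
  fixes u v :: "real \<Rightarrow> 'a::topological_space"
  assumes "continuous_on {0..1} u" "continuous_on {0..1} v" "u 1 = v 0"
  shows "continuous_on {0..1} (pjoin u v)"
  using pathin_pjoin[of euclidean u v] assms by (simp add: pathin_def)

lemma pjoin_Pi: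
  assumes "u \<in> {0..1} \<rightarrow> S" "v \<in> {0..1} \<rightarrow> S"
  shows "pjoin u v \<in> {0..1} \<rightarrow> S"
  using assms by (auto simp: pjoin_def Pi_iff)

text \<open>An edge on which \<open>\<Theta>\<close> is constant may be traversed for free.\<close>

lemma homotopic_rel_endpoints_factor_edge:
  fixes S :: "'b::real_normed_vector set"
  assumes \<Theta>: "continuous_map (top_of_set S) M \<Theta>" and S: "convex S"
    and u: "continuous_on {0..1} u" "u \<in> {0..1} \<rightarrow> S"
    and v: "continuous_on {0..1} v" "v \<in> {0..1} \<rightarrow> S"
    and edge: "\<And>s. s \<in> {0..1} \<Longrightarrow> \<Theta> ((1 - s) *\<^sub>R u 0 + s *\<^sub>R v 0) = \<Theta> (v 0)"
    and ends: "u 1 = v 1"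
  shows "homotopic_rel_endpoints M (\<lambda>t. \<Theta> (u t)) (\<lambda>t. \<Theta> (v t))"
proof -
  let ?e = "\<lambda>s. (1 - s) *\<^sub>R u 0 + s *\<^sub>R v 0"
  have v': "pathin M (\<lambda>t. \<Theta> (v t))"
    using continuous_map_compose[OF _ \<Theta>, of "top_of_set {0..1}" v] v
    by (auto simp: pathin_def continuous_map_in_subtopology o_def)
  have e: "continuous_on {0..1} ?e" by (intro continuous_intros)
  have "?e s \<in> S" if "s \<in> {0..1}" for s
    using u(2) v(2) S that by (intro convexD) auto
  then have e': "?e \<in> {0..1} \<rightarrow> S" by blast
  have "homotopic_rel_endpoints M (\<lambda>t. \<Theta> (u t)) (\<lambda>t. \<Theta> (pjoin ?e v t))"
    by (intro homotopic_rel_endpoints_factor[OF \<Theta> S] u continuous_on_pjoin e v pjoin_Pi e')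
       (auto simp: ends)
  also have "homotopic_rel_endpoints M (\<lambda>t. \<Theta> (pjoin ?e v t)) (pjoin (\<lambda>_. \<Theta> (v 0)) (\<lambda>t. \<Theta> (v t)))"
    apply (rule homotopic_rel_endpoints_sym, rule homotopic_rel_endpoints_eq)
    subgoal by (intro pathin_pjoin v') (use v' in \<open>auto simp: pathin_def continuous_map_def Pi_iff\<close>)
    subgoal using edge by (auto simp: pjoin_def)
    done
  also have "homotopic_rel_endpoints M (pjoin (\<lambda>_. \<Theta> (v 0)) (\<lambda>t. \<Theta> (v t))) (\<lambda>t. \<Theta> (v t))"
    by (rule pjoin_const_left[OF v']) simp
  finally show ?thesis .
qed

section \<open>Paths traced along a homotopy\<close>

lemma continuous_map_along_path:
  assumes "continuous_map (prod_topology X (top_of_set S)) M \<Phi>" "pathin X l"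
  shows "continuous_map (top_of_set ({0..1} \<times> S)) M (\<lambda>(s, y). \<Phi> (l s, y))"
proof -
  have "continuous_map (prod_topology (top_of_set {0..1}) (top_of_set S)) (prod_topology X (top_of_set S))
          (\<lambda>(s, y). (l s, y))"
    using assms(2) by (auto simp: pathin_def case_prod_unfold continuous_map_paired
        intro!: continuous_map_compose[OF continuous_map_fst, unfolded o_def] continuous_map_snd
        simp del: prod_topology_subtopology_eu)
  from continuous_map_compose[OF this assms(1)] show ?thesis
    by (simp add: o_def case_prod_unfold)
qed

lemma pathin_diag:
  assumes "continuous_map (prod_topology X (top_of_set {0..1})) M \<Phi>" "pathin X l"
  shows "pathin M (\<lambda>t. \<Phi> (l t, t))"
proof -
  have "continuous_map (top_of_set {0..1::real}) (prod_topology X (top_of_set {0..1})) (\<lambda>t. (l t, t))"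
    using assms(2) by (auto simp: pathin_def continuous_map_paired)
  from continuous_map_compose[OF this assms(1)] show ?thesis
    by (simp add: pathin_def o_def)
qed

text \<open>In the square with coordinates position along \<open>l\<close> and time, the diagonal is
  deformed to a broken line: \<open>l\<close> is run to its end during the first half of the time,
  then the end point alone is moved by \<open>\<Psi>\<close>.\<close>

lemma diag_hjoin:
  assumes \<Phi>: "continuous_map (prod_topology X (top_of_set {0..1})) M \<Phi>"
    and \<Psi>: "continuous_map (prod_topology X (top_of_set {0..1})) M \<Psi>"
    and match: "\<And>x. x \<in> topspace X \<Longrightarrow> \<Phi> (x, 1) = \<Psi> (x, 0)" and l: "pathin X l"
  shows "homotopic_rel_endpoints M (\<lambda>t. hjoin \<Phi> \<Psi> (l t, t))
           (pjoin (\<lambda>t. \<Phi> (l t, t)) (\<lambda>s. \<Psi> (l 1, s)))"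
proof -
  define \<Theta> where "\<Theta> = (\<lambda>(s, t). hjoin \<Phi> \<Psi> (l s, t))"
  have \<Theta>: "continuous_map (top_of_set ({0..1} \<times> {0..1})) M \<Theta>"
    unfolding \<Theta>_def using continuous_map_along_path[OF continuous_map_hjoin[OF assms(1-3)] assms(4)] .
  define v where "v = pjoin (\<lambda>t::real. (t, t/2)) (\<lambda>s. (1, (1 + s)/2))"
  have vc: "continuous_on {0..1} v"
    unfolding v_def by (intro continuous_on_pjoin continuous_intros) auto
  have vm: "v \<in> {0..1} \<rightarrow> {0..1} \<times> {0..1}"
    unfolding v_def by (intro pjoin_Pi) auto
  have "homotopic_rel_endpoints M (\<lambda>t. \<Theta> (t, t)) (\<lambda>t. \<Theta> (v t))"
    by (rule homotopic_rel_endpoints_factor[OF \<Theta>])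
       (use vc vm in \<open>auto simp: v_def convex_Times intro!: continuous_intros\<close>)
  also have "homotopic_rel_endpoints M (\<lambda>t. \<Theta> (v t)) (pjoin (\<lambda>t. \<Phi> (l t, t)) (\<lambda>s. \<Psi> (l 1, s)))"
  proof (rule homotopic_rel_endpoints_eq)
    show "pathin M (\<lambda>t. \<Theta> (v t))"
      using continuous_map_compose[OF _ \<Theta>, of "top_of_set {0..1}" v] vc vm
      by (auto simp: pathin_def continuous_map_in_subtopology o_def)
  qed (auto simp: \<Theta>_def v_def pjoin_def hjoin_def)
  finally show ?thesis by (simp add: \<Theta>_def)
qed

text \<open>The second leg of \<open>diag_hjoin\<close> is constant as soon as the end point rests.
  So a push keeps every label at the points that it does not move, whatever it does to the other
  points of the paths.\<close>

lemma diag_hjoin_stationary: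
  assumes \<Phi>: "continuous_map (prod_topology X (top_of_set {0..1})) M \<Phi>"
    and \<Psi>: "continuous_map (prod_topology X (top_of_set {0..1})) M \<Psi>"
    and match: "\<And>x. x \<in> topspace X \<Longrightarrow> \<Phi> (x, 1) = \<Psi> (x, 0)" and l: "pathin X l"
    and stat: "\<And>s. s \<in> {0..1} \<Longrightarrow> \<Psi> (l 1, s) = \<Phi> (l 1, 1)"
  shows "homotopic_rel_endpoints M (\<lambda>t. hjoin \<Phi> \<Psi> (l t, t)) (\<lambda>t. \<Phi> (l t, t))"
proof -
  note dh = diag_hjoin[OF assms(1-4)]
  note p = homotopic_rel_endpoints_imp(2)[OF dh]
  note dh
  also have "homotopic_rel_endpoints M (pjoin (\<lambda>t. \<Phi> (l t, t)) (\<lambda>s. \<Psi> (l 1, s)))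
      (pjoin (\<lambda>t. \<Phi> (l t, t)) (\<lambda>s. \<Phi> (l 1, 1)))"
    by (rule homotopic_rel_endpoints_eq[OF p]) (auto simp: pjoin_def stat)
  also have "homotopic_rel_endpoints M \<dots> (\<lambda>t. \<Phi> (l t, t))"
    by (rule pjoin_const_right) (auto intro: pathin_diag[OF \<Phi> l])
  finally show ?thesis .
qed

text \<open>The other broken line in the same square: all the time is spent on \<open>l\<close>, and
  \<open>u\<close> is run at time 1.\<close>

lemma diag_pjoin:
  assumes \<Phi>: "continuous_map (prod_topology X (top_of_set {0..1})) M \<Phi>"
    and l: "pathin X l" "pathin X u" "l 1 = u 0"
  shows "homotopic_rel_endpoints M (\<lambda>t. \<Phi> (pjoin l u t, t))
           (pjoin (\<lambda>t. \<Phi> (l t, t)) (\<lambda>s. \<Phi> (u s, 1)))"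
proof -
  define \<Theta> where "\<Theta> = (\<lambda>(s, t). \<Phi> (pjoin l u s, t))"
  have \<Theta>: "continuous_map (top_of_set ({0..1} \<times> {0..1})) M \<Theta>"
    unfolding \<Theta>_def using continuous_map_along_path[OF \<Phi> pathin_pjoin[OF l]] .
  define v where "v = pjoin (\<lambda>t::real. (t/2, t)) (\<lambda>s. ((1 + s)/2, 1))"
  have vc: "continuous_on {0..1} v"
    unfolding v_def by (intro continuous_on_pjoin continuous_intros) auto
  have vm: "v \<in> {0..1} \<rightarrow> {0..1} \<times> {0..1}"
    unfolding v_def by (intro pjoin_Pi) auto
  have "homotopic_rel_endpoints M (\<lambda>t. \<Theta> (t, t)) (\<lambda>t. \<Theta> (v t))"
    by (rule homotopic_rel_endpoints_factor[OF \<Theta>])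
       (use vc vm in \<open>auto simp: v_def convex_Times intro!: continuous_intros\<close>)
  also have "homotopic_rel_endpoints M (\<lambda>t. \<Theta> (v t)) (pjoin (\<lambda>t. \<Phi> (l t, t)) (\<lambda>s. \<Phi> (u s, 1)))"
  proof (rule homotopic_rel_endpoints_eq)
    show "pathin M (\<lambda>t. \<Theta> (v t))"
      using continuous_map_compose[OF _ \<Theta>, of "top_of_set {0..1}" v] vc vm
      by (auto simp: pathin_def continuous_map_in_subtopology o_def)
  qed (auto simp: \<Theta>_def v_def pjoin_def)
  finally show ?thesis by (simp add: \<Theta>_def)
qed

text \<open>In the cube whose third coordinate is the stage, the diagonal at stage \<open>r'\<close>
  is slid to stage \<open>r\<close>, and the stage is restored at the end point only. At the
  starting point the change of stage costs nothing, because \<open>base\<close> makes that edge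
  constant.\<close>

lemma diag_family_param:
  assumes \<Gamma>: "continuous_map (prod_topology X (top_of_set ({0..1} \<times> {0..1::real}))) M \<Gamma>"
    and l: "pathin X l" and base: "\<And>r. r \<in> {0..1} \<Longrightarrow> \<Gamma> (l 0, 0, r) = a"
    and r: "r \<in> {0..1}" "r' \<in> {0..1}"
  shows "homotopic_rel_endpoints M (\<lambda>t. \<Gamma> (l t, t, r'))
           (pjoin (\<lambda>t. \<Gamma> (l t, t, r)) (\<lambda>s. \<Gamma> (l 1, 1, r + s * (r' - r))))"
proof -
  define \<Theta> where "\<Theta> = (\<lambda>(s, t, r). \<Gamma> (l s, t, r))"
  have "continuous_map (top_of_set ({0..1} \<times> {0..1} \<times> {0..1})) M (\<lambda>(s, y). \<Gamma> (l s, y))"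
    using continuous_map_along_path[OF \<Gamma> l] .
  then have \<Theta>: "continuous_map (top_of_set ({0..1} \<times> {0..1} \<times> {0..1})) M \<Theta>"
    by (simp add: \<Theta>_def case_prod_unfold)
  define v where "v = pjoin (\<lambda>t::real. (t, t, r)) (\<lambda>s. (1, 1, (1 - s) *\<^sub>R r + s *\<^sub>R r'))"
  have seg: "(1 - s) *\<^sub>R r + s *\<^sub>R r' \<in> {0..1}" if "s \<in> {0..1}" for s
    using that r convex_box(2)[of 0 "1::real"] by (intro convexD) auto
  have seg': "(1 - s) *\<^sub>R r' + s *\<^sub>R r \<in> {0..1}" if "s \<in> {0..1}" for s
    using that r convex_box(2)[of 0 "1::real"] by (intro convexD) auto
  have vc: "continuous_on {0..1} v"
    unfolding v_def by (intro continuous_on_pjoin continuous_intros) auto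
  have vm: "v \<in> {0..1} \<rightarrow> {0..1} \<times> {0..1} \<times> {0..1}"
    unfolding v_def using r(1) seg by (intro pjoin_Pi) auto
  have "homotopic_rel_endpoints M (\<lambda>t. \<Theta> (t, t, r')) (\<lambda>t. \<Theta> (v t))"
    by (rule homotopic_rel_endpoints_factor_edge[OF \<Theta>])
       (use vc vm r base seg' in \<open>auto simp: v_def \<Theta>_def convex_Times intro!: continuous_intros\<close>)
  also have "homotopic_rel_endpoints M (\<lambda>t. \<Theta> (v t))
     (pjoin (\<lambda>t. \<Gamma> (l t, t, r)) (\<lambda>s. \<Gamma> (l 1, 1, r + s * (r' - r))))"
  proof (rule homotopic_rel_endpoints_eq)
    show "pathin M (\<lambda>t. \<Theta> (v t))"
      using continuous_map_compose[OF _ \<Theta>, of "top_of_set {0..1}" v] vc vm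
      by (auto simp: pathin_def continuous_map_in_subtopology o_def)
  qed (auto simp: \<Theta>_def v_def pjoin_def algebra_simps)
  finally show ?thesis by (simp add: \<Theta>_def)
qed

text \<open>The analogue of \<open>diag_pjoin\<close> for a stage that depends on the end point: the
  diagonal sits at stage \<open>\<theta> (u 1)\<close>, the broken line runs \<open>l\<close> at
  stage \<open>\<theta> (u 0)\<close> and lets the stage follow \<open>\<theta>\<close> along
  \<open>u\<close>. The two start at different stages, which \<open>base\<close> makes
  harmless.\<close>

lemma diag_family_pjoin:
  assumes \<Gamma>: "continuous_map (prod_topology X (top_of_set ({0..1} \<times> {0..1::real}))) M \<Gamma>"
    and l: "pathin X l" "pathin X u" "l 1 = u 0"
    and base: "\<And>r. r \<in> {0..1} \<Longrightarrow> \<Gamma> (l 0, 0, r) = a"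
    and \<theta>: "continuous_map X (top_of_set {0..1}) \<theta>"
  shows "homotopic_rel_endpoints M (\<lambda>t. \<Gamma> (pjoin l u t, t, \<theta> (u 1)))
           (pjoin (\<lambda>t. \<Gamma> (l t, t, \<theta> (l 1))) (\<lambda>s. \<Gamma> (u s, 1, \<theta> (u s))))"
proof -
  define \<Theta> where "\<Theta> = (\<lambda>(s, t, r). \<Gamma> (pjoin l u s, t, r))"
  have "continuous_map (top_of_set ({0..1} \<times> {0..1} \<times> {0..1})) M (\<lambda>(s, y). \<Gamma> (pjoin l u s, y))"
    using continuous_map_along_path[OF \<Gamma> pathin_pjoin[OF l]] .
  then have \<Theta>: "continuous_map (top_of_set ({0..1} \<times> {0..1} \<times> {0..1})) M \<Theta>"
    by (simp add: \<Theta>_def case_prod_unfold)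
  have "continuous_map (top_of_set {0..1}) (top_of_set {0..1}) (\<theta> \<circ> u)"
    using \<theta> l(2) continuous_map_compose pathin_def by blast
  then have \<theta>u: "continuous_on {0..1} (\<lambda>s. \<theta> (u s))" and \<theta>I: "\<And>s. s \<in> {0..1} \<Longrightarrow> \<theta> (u s) \<in> {0..1}"
    by (auto simp: continuous_map_in_subtopology o_def)
  define v where "v = pjoin (\<lambda>t::real. (t/2, t, \<theta> (u 0))) (\<lambda>s. ((1 + s)/2, 1, \<theta> (u s)))"
  have \<theta>01: "\<theta> (u 0) \<in> {0..1}" "\<theta> (u 1) \<in> {0..1}" using \<theta>I[of 0] \<theta>I[of 1] by auto
  have seg': "(1 - s) *\<^sub>R \<theta> (u 1) + s *\<^sub>R \<theta> (u 0) \<in> {0..1}" if "s \<in> {0..1}" for s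
    using that \<theta>01 convex_box(2)[of 0 "1::real"] by (intro convexD) auto
  have vc: "continuous_on {0..1} v"
    unfolding v_def by (intro continuous_on_pjoin continuous_intros \<theta>u) auto
  have vm: "v \<in> {0..1} \<rightarrow> {0..1} \<times> {0..1} \<times> {0..1}"
    unfolding v_def using \<theta>I \<theta>01 by (intro pjoin_Pi) auto
  have "homotopic_rel_endpoints M (\<lambda>t. \<Theta> (t, t, \<theta> (u 1))) (\<lambda>t. \<Theta> (v t))"
    by (rule homotopic_rel_endpoints_factor_edge[OF \<Theta>])
       (use vc vm \<theta>01 base seg' in \<open>auto simp: v_def \<Theta>_def convex_Times intro!: continuous_intros\<close>)
  also have "homotopic_rel_endpoints M (\<lambda>t. \<Theta> (v t))
     (pjoin (\<lambda>t. \<Gamma> (l t, t, \<theta> (l 1))) (\<lambda>s. \<Gamma> (u s, 1, \<theta> (u s))))"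
  proof (rule homotopic_rel_endpoints_eq)
    show "pathin M (\<lambda>t. \<Theta> (v t))"
      using continuous_map_compose[OF _ \<Theta>, of "top_of_set {0..1}" v] vc vm
      by (auto simp: pathin_def continuous_map_in_subtopology o_def)
  qed (auto simp: \<Theta>_def v_def pjoin_def l(3))
  finally show ?thesis by (simp add: \<Theta>_def)
qed

section \<open>Coordinate balls and radial pushes\<close>

text \<open>The l1 norm of the first \<open>n\<close> coordinates: its triangle inequalities hold
  term by term.\<close>

definition nrm :: "nat \<Rightarrow> (nat \<Rightarrow> real) \<Rightarrow> real" where
  "nrm n x = (\<Sum>i<n. \<bar>x i\<bar>)"

lemma nrm_nonneg [simp]: "0 \<le> nrm n x"
  by (simp add: nrm_def sum_nonneg)

lemma nrm_zero [simp]: "nrm n (\<lambda>_. 0) = 0"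
  by (simp add: nrm_def)

lemma nrm_scale: "nrm n (\<lambda>i. c * x i) = \<bar>c\<bar> * nrm n x"
  by (simp add: nrm_def abs_mult sum_distrib_left)

lemma nrm_add_le: "nrm n (\<lambda>i. x i + y i) \<le> nrm n x + nrm n y"
  unfolding nrm_def sum.distrib[symmetric] by (intro sum_mono) auto

lemma nrm_diff_le: "nrm n (\<lambda>i. x i - y i) \<le> nrm n x + nrm n y"
  unfolding nrm_def sum.distrib[symmetric] by (intro sum_mono) auto

lemma nrm_le_diff_add: "nrm n x \<le> nrm n (\<lambda>i. x i - y i) + nrm n y"
  unfolding nrm_def sum.distrib[symmetric] by (intro sum_mono) auto

lemma nrm_eq_0: "nrm n x = 0 \<longleftrightarrow> (\<forall>i<n. x i = 0)"
  by (auto simp: nrm_def sum_nonneg_eq_0_iff)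

lemma continuous_map_nrm:
  assumes "\<And>i. i < n \<Longrightarrow> continuous_map Z euclideanreal (\<lambda>z. g z i)"
  shows "continuous_map Z euclideanreal (\<lambda>z. nrm n (g z))"
  unfolding nrm_def by (intro continuous_map_sum continuous_map_real_abs assms) auto

lemma continuous_on_nrm: "continuous_on S (nrm n)"
  unfolding nrm_def by (intro continuous_intros continuous_on_subset[OF continuous_on_product_coordinates]) auto

definition coord_ball :: "nat \<Rightarrow> real \<Rightarrow> (nat \<Rightarrow> real) set" where
  "coord_ball n r = {x. (\<forall>i\<ge>n. x i = 0) \<and> nrm n x < r}"

lemma coord_ball_diff_eq_0:
  assumes "x \<in> coord_ball n r" "y \<in> coord_ball n r'" "nrm n (\<lambda>i. x i - y i) = 0"
  shows "x = y"
proof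
  fix i show "x i = y i"
    using assms by (cases "i < n") (auto simp: coord_ball_def nrm_eq_0)
qed

lemma coord_ball_convex:
  assumes x: "x \<in> coord_ball n r" and y: "y \<in> coord_ball n r" and s: "s \<in> {0..1}"
  shows "(\<lambda>i. (1 - s) * x i + s * y i) \<in> coord_ball n r"
proof -
  have "nrm n (\<lambda>i. (1 - s) * x i + s * y i) \<le> (1 - s) * nrm n x + s * nrm n y"
    using nrm_add_le[of n "\<lambda>i. (1 - s) * x i" "\<lambda>i. s * y i"] s by (simp add: nrm_scale)
  also have "\<dots> < r"
    using x y s convex_bound_lt[of "nrm n x" r "nrm n y" "1 - s" s] by (auto simp: coord_ball_def)
  finally show ?thesis using x y by (auto simp: coord_ball_def)
qed

text \<open>The radius 9 leaves room for the pushes. Targets keep norm below 1 and push radii are at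
  most 4, so all points that get moved have norm below 5 before, during and after the push.\<close>

locale chart_ball =
  fixes M :: "'m topology" and n :: nat and Q :: "'m set"
    and e :: "(nat \<Rightarrow> real) \<Rightarrow> 'm" and \<kappa> :: "'m \<Rightarrow> nat \<Rightarrow> real"
  assumes Hausdorff: "Hausdorff_space M" and openQ: "openin M Q"
    and homeo: "homeomorphic_maps (top_of_set (coord_ball n 9)) (subtopology M Q) e \<kappa>"
begin

lemma Q_subset: "Q \<subseteq> topspace M"
  using openQ openin_subset by auto

lemma e_chi: "z \<in> Q \<Longrightarrow> e (\<kappa> z) = z"
  and chi_e: "x \<in> coord_ball n 9 \<Longrightarrow> \<kappa> (e x) = x"
  and chi_in: "z \<in> Q \<Longrightarrow> \<kappa> z \<in> coord_ball n 9"
  and e_in: "x \<in> coord_ball n 9 \<Longrightarrow> e x \<in> Q"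
  using homeo Q_subset by (auto simp: homeomorphic_maps_def continuous_map_def Pi_iff)

lemma continuous_chi: "continuous_map (subtopology M Q) euclidean \<kappa>"
  using homeo by (auto simp: homeomorphic_maps_def continuous_map_in_subtopology)

lemma continuous_chi_coord: "continuous_map (subtopology M Q) euclideanreal (\<lambda>z. \<kappa> z i)"
  using continuous_chi by (simp add: continuous_map_componentwise_UNIV flip: euclidean_product_topology)

lemma continuous_e:
  assumes "\<And>i. continuous_map Z euclideanreal (\<lambda>z. g z i)" "\<And>z. z \<in> topspace Z \<Longrightarrow> g z \<in> coord_ball n 9"
  shows "continuous_map Z (subtopology M Q) (\<lambda>z. e (g z))"
proof -
  have "continuous_map Z (top_of_set (coord_ball n 9)) g"
    using assms by (auto simp: continuous_map_in_subtopology continuous_map_componentwise_UNIV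
        simp flip: euclidean_product_topology)
  moreover have "continuous_map (top_of_set (coord_ball n 9)) (subtopology M Q) e"
    using homeo by (simp add: homeomorphic_maps_def)
  ultimately have "continuous_map Z (subtopology M Q) (e \<circ> g)"
    by (rule continuous_map_compose)
  then show ?thesis by (simp only: o_def)
qed

lemma continuous_e':
  assumes "\<And>i. continuous_map Z euclideanreal (\<lambda>z. g z i)" "\<And>z. z \<in> topspace Z \<Longrightarrow> g z \<in> coord_ball n 9"
  shows "continuous_map Z M (\<lambda>z. e (g z))"
  using continuous_e[OF assms] by (simp add: continuous_map_in_subtopology)

lemma continuous_nrm_chi: "continuous_map (subtopology M Q) euclideanreal (\<lambda>z. nrm n (\<kappa> z))"
  by (intro continuous_map_nrm continuous_chi_coord)

lemma openin_ball: "openin M {z \<in> Q. nrm n (\<kappa> z) < r}"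
proof -
  have "openin (subtopology M Q) {z \<in> topspace (subtopology M Q). nrm n (\<kappa> z) \<in> {..<r}}"
    by (rule openin_continuous_map_preimage[OF continuous_nrm_chi]) auto
  moreover have "{z \<in> topspace (subtopology M Q). nrm n (\<kappa> z) \<in> {..<r}} = {z \<in> Q. nrm n (\<kappa> z) < r}"
    using Q_subset by auto
  ultimately show ?thesis using openQ by (simp add: openin_open_subtopology)
qed

text \<open>The ball is compact, hence closed in the Hausdorff space \<open>M\<close> and not merely
  in \<open>Q\<close>. This is what allows a push to be continued by the identity outside the
  chart.\<close>

lemma closedin_ball: "closedin M {z \<in> Q. nrm n (\<kappa> z) \<le> 5}"
proof -
  let ?C = "{x. (\<forall>i\<ge>n. x i = 0) \<and> nrm n x \<le> 5}"
  \<comment> \<open>A box around the coordinate ball. It is an infinite product, but its factors are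
    single points from index \<open>n\<close> on, and Tychonoff's theorem makes it compact.\<close>
  define K where "K = (\<lambda>i. if i < n then {-5..5} else {0::real})"
  have "compactin euclideanreal (K i)" for i
    by (simp add: K_def)
  then have "compactin (powertop_real UNIV) (PiE UNIV K)"
    unfolding compactin_PiE by blast
  then have "compact (PiE UNIV K)"
    unfolding euclidean_product_topology compactin_euclidean_iff .
  moreover have "closed ?C"
  proof -
    have "closed (\<Inter>i\<in>{n..}. {x::nat\<Rightarrow>real. x i = 0})"
      by (rule closed_INT, rule ballI, rule closed_Collect_eq[OF continuous_on_product_coordinates continuous_on_const])
    moreover have "closed {x. nrm n x \<le> 5}"
      by (rule closed_Collect_le[OF continuous_on_nrm continuous_on_const])
    moreover have "?C = (\<Inter>i\<in>{n..}. {x::nat\<Rightarrow>real. x i = 0}) \<inter> {x. nrm n x \<le> 5}" by auto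
    ultimately show ?thesis by (simp only: closed_Int)
  qed
  ultimately have "compact (PiE UNIV K \<inter> ?C)" by (rule compact_Int_closed)
  moreover have "?C \<subseteq> PiE UNIV K"
  proof
    fix x assume x: "x \<in> ?C"
    have "\<bar>x i\<bar> \<le> 5" if "i < n" for i
      using x member_le_sum[of i "{..<n}" "\<lambda>i. \<bar>x i\<bar>"] that by (auto simp: nrm_def)
    then show "x \<in> PiE UNIV K" using x by (force simp: K_def abs_le_iff)
  qed
  ultimately have "compact ?C" by (simp add: Int_absorb1)
  then have "compactin (top_of_set (coord_ball n 9)) ?C"
    by (auto simp: compactin_subtopology coord_ball_def)
  moreover have "continuous_map (top_of_set (coord_ball n 9)) M e"
    using homeo by (auto simp: homeomorphic_maps_def continuous_map_in_subtopology)
  ultimately have "compactin M (e ` ?C)" by (rule image_compactin)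
  then have "closedin M (e ` ?C)" by (rule compactin_imp_closedin[OF Hausdorff])
  moreover have "e ` ?C = {z \<in> Q. nrm n (\<kappa> z) \<le> 5}"
  proof
    show "e ` ?C \<subseteq> {z \<in> Q. nrm n (\<kappa> z) \<le> 5}"
    proof
      fix z assume "z \<in> e ` ?C"
      then obtain x where x: "x \<in> ?C" "z = e x" by blast
      then have "x \<in> coord_ball n 9" by (auto simp: coord_ball_def)
      then show "z \<in> {z \<in> Q. nrm n (\<kappa> z) \<le> 5}" using x e_in chi_e by simp
    qed
    show "{z \<in> Q. nrm n (\<kappa> z) \<le> 5} \<subseteq> e ` ?C"
    proof
      fix z assume z: "z \<in> {z \<in> Q. nrm n (\<kappa> z) \<le> 5}"
      then have 1: "\<kappa> z \<in> ?C" and 2: "z = e (\<kappa> z)" using chi_in e_chi by (auto simp: coord_ball_def)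
      show "z \<in> e ` ?C" by (rule image_eqI[where x = "\<kappa> z"], rule 2, rule 1)
    qed
  qed
  ultimately show ?thesis by (simp only:)
qed

text \<open>Straight lines in coordinates. A detour inside \<open>Q\<close> is thus determined by
  its end points, which is the reason why labels are locally constant.\<close>

lemma paths_homotopic:
  assumes w: "pathin (subtopology M Q) w" and w': "pathin (subtopology M Q) w'"
    and "w 0 = w' 0" "w 1 = w' 1"
  shows "homotopic_rel_endpoints M w w'"
  unfolding homotopic_rel_endpoints_iff
proof (intro exI conjI ballI)
  let ?g = "\<lambda>(s, t). (\<lambda>i. (1 - s) * \<kappa> (w t) i + s * \<kappa> (w' t) i)"
  have wQ: "w t \<in> Q" "w' t \<in> Q" if "t \<in> {0..1}" for t
    using w w' that by (auto simp: pathin_def continuous_map_in_subtopology Pi_iff)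
  have c: "continuous_map (top_of_set {0..1}) euclideanreal (\<lambda>t. \<kappa> (p t) i)"
    if "pathin (subtopology M Q) p" for p i
    using continuous_map_compose[OF that[unfolded pathin_def] continuous_chi_coord] by (simp add: o_def)
  have c2: "continuous_on (S \<times> {0..1}) (\<lambda>z. \<kappa> (p (snd z)) i)"
    if "pathin (subtopology M Q) p" for p i and S :: "real set"
    using c[OF that, of i] by (intro continuous_on_compose2[of "{0..1}" "\<lambda>t. \<kappa> (p t) i" _ snd] continuous_intros) auto
  have "continuous_map (top_of_set ({0..1} \<times> {0..1})) M (\<lambda>z. e (?g z))"
    using wQ by (intro continuous_e')
      (auto simp: case_prod_unfold w w' intro!: continuous_intros c2 coord_ball_convex chi_in)
  then show "continuous_map (top_of_set ({0..1} \<times> {0..1})) M (\<lambda>z. e (?g z))" .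
  have wQ01: "w 0 \<in> Q" "w' 0 \<in> Q" "w 1 \<in> Q" "w' 1 \<in> Q"
    using wQ[of 0] wQ[of 1] by auto
  show "e (?g (0, t)) = w t" "e (?g (1, t)) = w' t" if "t \<in> {0..1}" for t
    using that by (auto simp: e_chi wQ)
  show "e (?g (s, 0)) = w 0" "e (?g (s, 1)) = w 1" if "s \<in> {0..1}" for s
    using assms(3,4) wQ01 by (auto simp: e_chi algebra_simps simp flip: distrib_left)
qed

lemma path_exists:
  assumes "z \<in> Q" "z' \<in> Q"
  obtains w where "pathin (subtopology M Q) w" "w 0 = z" "w 1 = z'"
proof
  let ?g = "\<lambda>s. (\<lambda>i. (1 - s) * \<kappa> z i + s * \<kappa> z' i)"
  show "pathin (subtopology M Q) (\<lambda>s. e (?g s))"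
    unfolding pathin_def using assms
    by (intro continuous_e) (auto intro!: continuous_intros coord_ball_convex chi_in)
qed (use assms in \<open>auto simp: e_chi\<close>)

section \<open>Radial pushes inside a coordinate ball\<close>

abbreviation dst :: "'m \<Rightarrow> (nat \<Rightarrow> real) \<Rightarrow> real" where
  "dst z b \<equiv> nrm n (\<lambda>i. \<kappa> z i - b i)"

text \<open>The factor \<open>max 1\<close> makes the push the identity outside the ball of radius \<open>\<rho>\<close> about \<open>b\<close>;
  the point with coordinates \<open>b\<close> itself is where it breaks down.\<close>

definition push_coord :: "(nat \<Rightarrow> real) \<Rightarrow> real \<Rightarrow> real \<Rightarrow> 'm \<Rightarrow> nat \<Rightarrow> real" where
  "push_coord b \<rho> s z = (\<lambda>i. b i + max 1 ((1 - s) + s * (\<rho> / dst z b)) * (\<kappa> z i - b i))"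

definition push :: "(nat \<Rightarrow> real) \<Rightarrow> real \<Rightarrow> real \<Rightarrow> 'm \<Rightarrow> 'm" where
  "push b \<rho> s z = e (push_coord b \<rho> s z)"

text \<open>Where the factor exceeds 1, \<open>z\<close> lies within \<open>\<rho>\<close> of
  \<open>b\<close>, and its new distance from \<open>b\<close> is the average
  \<open>(1 - s) * dst z b + s * \<rho>\<close>, at most \<open>\<rho>\<close>. The norm then stays
  below 1 + 4.\<close>

lemma push_coord_in:
  assumes z: "z \<in> Q" "\<kappa> z \<noteq> b" and b: "b \<in> coord_ball n 1" and \<rho>: "0 \<le> \<rho>" "\<rho> \<le> 4" and s: "s \<in> {0..1}"
  shows "push_coord b \<rho> s z \<in> coord_ball n 9"
proof -
  let ?\<mu> = "max 1 ((1 - s) + s * (\<rho> / dst z b))"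
  have d: "dst z b \<noteq> 0"
    using coord_ball_diff_eq_0[OF chi_in[OF z(1)] b] z(2) by auto
  then have d: "dst z b > 0" by (simp add: less_le)
  have supp: "push_coord b \<rho> s z i = 0" if "i \<ge> n" for i
    using chi_in[OF z(1)] b that by (auto simp: push_coord_def coord_ball_def)
  have "nrm n (push_coord b \<rho> s z) < 9"
  proof (cases "?\<mu> = 1")
    case True
    then show ?thesis using chi_in[OF z(1)] by (auto simp: push_coord_def coord_ball_def)
  next
    case False
    then have "?\<mu> * dst z b = ((1 - s) + s * (\<rho> / dst z b)) * dst z b" by (auto simp: max_def split: if_splits)
    also have "\<dots> = (1 - s) * dst z b + s * \<rho>" using d by (simp add: field_simps)
    finally have *: "?\<mu> * dst z b = (1 - s) * dst z b + s * \<rho>" .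
    have "dst z b \<le> \<rho>"
    proof (rule ccontr)
      assume "\<not> dst z b \<le> \<rho>"
      then have "\<rho> / dst z b \<le> 1" using d by (simp add: field_simps)
      then have "s * (\<rho> / dst z b) \<le> s" using s mult_left_le[of "\<rho> / dst z b" s] by (metis atLeastAtMost_iff)
      then show False using False by (auto simp: max_def split: if_splits)
    qed
    then have "?\<mu> * dst z b \<le> \<rho>"
      using * mult_left_mono[of "dst z b" \<rho> "1 - s"] s by (simp add: algebra_simps)
    moreover have "nrm n (push_coord b \<rho> s z) \<le> nrm n b + ?\<mu> * dst z b"
      unfolding push_coord_def by (rule order_trans[OF nrm_add_le]) (simp add: nrm_scale)
    ultimately show ?thesis using b \<rho> by (auto simp: coord_ball_def)
  qed
  with supp show ?thesis by (auto simp: coord_ball_def)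
qed

lemma push_0: "z \<in> Q \<Longrightarrow> push b \<rho> 0 z = z"
  by (simp add: push_def push_coord_def e_chi)

lemma push_far:
  assumes z: "z \<in> Q" and "\<rho> \<le> dst z b" and s: "s \<in> {0..1}"
  shows "push b \<rho> s z = z"
proof -
  \<comment> \<open>For \<open>dst z b = 0\<close> the quotient is 0 by the convention for division
    by zero.\<close>
  have "\<rho> / dst z b \<le> 1"
    using assms(2) nrm_nonneg[of n "\<lambda>i. \<kappa> z i - b i"] by (cases "dst z b = 0") (simp_all add: divide_le_eq_1 less_le)
  then have "s * (\<rho> / dst z b) \<le> s" using s mult_left_le[of "\<rho> / dst z b" s] by (metis atLeastAtMost_iff)
  then have "max 1 ((1 - s) + s * (\<rho> / dst z b)) = 1" by auto
  then show ?thesis using z by (simp add: push_def push_coord_def e_chi)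
qed

text \<open>At time 1 the factor is \<open>\<rho> / dst z b\<close>, which is at least 1 here and so
  survives the maximum: the punctured ball has been pushed onto its sphere.\<close>

lemma push_near:
  assumes z: "z \<in> Q" "\<kappa> z \<noteq> b" and b: "b \<in> coord_ball n 1" and \<rho>: "\<rho> \<le> 4" and "dst z b \<le> \<rho>"
  shows "push b \<rho> 1 z \<in> Q" "dst (push b \<rho> 1 z) b = \<rho>"
proof -
  have d: "dst z b \<noteq> 0"
    using coord_ball_diff_eq_0[OF chi_in[OF z(1)] b] z(2) by auto
  then have d: "dst z b > 0" by (simp add: less_le)
  then have \<mu>: "max 1 ((1 - 1) + 1 * (\<rho> / dst z b)) = \<rho> / dst z b"
    using assms(5) by (simp add: max_def)
  have \<rho>0: "0 \<le> \<rho>" using d assms(5) by linarith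
  have mem: "push_coord b \<rho> 1 z \<in> coord_ball n 9"
    using push_coord_in[OF z b \<rho>0 \<rho>] by simp
  then show "push b \<rho> 1 z \<in> Q" by (simp add: push_def e_in)
  have "dst (push b \<rho> 1 z) b = nrm n (\<lambda>i. (\<rho> / dst z b) * (\<kappa> z i - b i))"
    using mem \<mu> by (simp add: push_def chi_e) (simp add: push_coord_def)
  also have "\<dots> = \<rho>"
    unfolding nrm_scale using d \<rho>0 by simp
  finally show "dst (push b \<rho> 1 z) b = \<rho>" .
qed

end

text \<open>A basic open set of the product topology contains a box around the image of
  \<open>m\<close>, the box contains an l1 ball of radius \<open>R\<close>, and rescaling by
  \<open>k = R / 9\<close> turns that ball into \<open>coord_ball n 9\<close>.\<close>

lemma chart_ball_exists:
  assumes M: "topological_manifold n M" and m: "m \<in> topspace M"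
  obtains Q e \<kappa> where "chart_ball M n Q e \<kappa>" "m \<in> Q" "\<kappa> m = (\<lambda>_. 0)"
proof -
  obtain U V where U: "openin M U" "m \<in> U" and V: "openin (Euclidean_space n) V"
      and "subtopology M U homeomorphic_space subtopology (Euclidean_space n) V"
    using M m unfolding topological_manifold_def by blast
  then obtain \<phi> \<psi> where fg: "homeomorphic_maps (subtopology M U) (subtopology (Euclidean_space n) V) \<phi> \<psi>"
    by (auto simp: homeomorphic_space_def)
  have UM: "U \<subseteq> topspace M" and VE: "V \<subseteq> topspace (Euclidean_space n)"
    using U V openin_subset by auto
  have E: "Euclidean_space n = top_of_set {x. \<forall>i\<ge>n. x i = 0}"
    by (simp add: Euclidean_space_def euclidean_product_topology)
  have cphi: "continuous_map (subtopology M U) (top_of_set V) \<phi>"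
    and cpsi: "continuous_map (top_of_set V) (subtopology M U) \<psi>"
    and inv: "\<And>x. x \<in> U \<Longrightarrow> \<psi> (\<phi> x) = x" "\<And>y. y \<in> V \<Longrightarrow> \<phi> (\<psi> y) = y"
    using fg UM VE by (auto simp: homeomorphic_maps_def E subtopology_subtopology Int_absorb1)
  have inU: "\<And>y. y \<in> V \<Longrightarrow> \<psi> y \<in> U" and inV: "\<And>x. x \<in> U \<Longrightarrow> \<phi> x \<in> V"
    using cphi cpsi UM by (auto simp: continuous_map_in_subtopology Pi_iff)
  define c where "c = \<phi> m"
  have cV: "c \<in> V" using U inV c_def by auto
  then have csupp: "\<forall>i\<ge>n. c i = 0" using VE by (auto simp: topspace_Euclidean_space)
  obtain W where W: "open W" "V = {x. \<forall>i\<ge>n. x i = 0} \<inter> W"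
    using iffD1[OF openin_open, OF V[unfolded E]] by blast
  have "openin (powertop_real UNIV) W" using W(1) by (simp add: euclidean_product_topology)
  moreover have "c \<in> W" using cV W(2) by auto
  ultimately obtain B where B: "c \<in> PiE UNIV B" "PiE UNIV B \<subseteq> W" and oB: "\<forall>i. openin euclideanreal (B i)"
    by (blast dest: product_topology_open_contains_basis)
  have openB: "open (B i)" for i
    by (rule iffD2[OF open_openin]) (rule oB[rule_format])
  have "\<exists>r>0. \<forall>y. \<bar>y - c i\<bar> < r \<longrightarrow> y \<in> B i" for i
    using openB[of i] PiE_mem[OF B(1), of i] by (auto simp: open_dist dist_real_def)
  then obtain r where r: "\<And>i. r i > 0" "\<And>i y. \<bar>y - c i\<bar> < r i \<Longrightarrow> y \<in> B i" by metis
  \<comment> \<open>The element 1 keeps the minimum meaningful in dimension 0.\<close>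
  define R where "R = Min (insert 1 (r ` {..<n}))"
  have R: "R > 0" "\<And>i. i < n \<Longrightarrow> R \<le> r i" using r(1) by (auto simp: R_def)
  have ballV: "x \<in> V" if "\<forall>i\<ge>n. x i = 0" "nrm n (\<lambda>i. x i - c i) < R" for x
  proof -
    have "x i \<in> B i" for i
    proof (cases "i < n")
      case True
      then have "\<bar>x i - c i\<bar> \<le> nrm n (\<lambda>i. x i - c i)"
        using member_le_sum[of i "{..<n}" "\<lambda>i. \<bar>x i - c i\<bar>"] by (auto simp: nrm_def)
      then show ?thesis using that(2) R(2)[OF True] by (intro r(2)) auto
    next
      case False
      then have "x i = c i" using that(1) csupp by simp
      then show ?thesis using PiE_mem[OF B(1), of i] by simp
    qed
    then have "x \<in> W" using B(2) by auto
    then show ?thesis using W that by auto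
  qed
  define k where "k = R / 9"
  have k: "k > 0" and kR: "R = k * 9" using R by (simp_all add: k_def)
  define e where "e = (\<lambda>x. \<psi> (\<lambda>i. c i + k * x i))"
  define \<kappa> where "\<kappa> = (\<lambda>z i. (\<phi> z i - c i) / k)"
  define Q where "Q = {z \<in> U. nrm n (\<kappa> z) < 9}"
  have coordV: "(\<lambda>i. c i + k * x i) \<in> V" if "x \<in> coord_ball n 9" for x
    using that csupp k by (intro ballV) (auto simp: coord_ball_def nrm_scale abs_of_pos kR)
  have cphi_i: "continuous_map (subtopology M U) euclideanreal (\<lambda>z. \<phi> z i)" for i
    using cphi by (simp add: continuous_map_in_subtopology continuous_map_componentwise_UNIV flip: euclidean_product_topology)
  have cchi_i: "continuous_map (subtopology M U) euclideanreal (\<lambda>z. \<kappa> z i)" for i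
    unfolding \<kappa>_def by (intro continuous_intros cphi_i) (use k in auto)
  have "openin (subtopology M U) {z \<in> topspace (subtopology M U). nrm n (\<kappa> z) \<in> {..<9}}"
    by (rule openin_continuous_map_preimage[OF continuous_map_nrm[OF cchi_i]]) auto
  moreover have "{z \<in> topspace (subtopology M U). nrm n (\<kappa> z) \<in> {..<9}} = Q"
    using UM by (auto simp: Q_def)
  ultimately have Qo: "openin M Q" using U openin_trans_full by metis
  have chie: "\<kappa> (e x) = x" if "x \<in> coord_ball n 9" for x
    using coordV[OF that] k by (auto simp: \<kappa>_def e_def inv)
  have echi: "e (\<kappa> z) = z" if "z \<in> U" for z
    using that k by (simp add: \<kappa>_def e_def inv)
  have ein: "e x \<in> Q" if "x \<in> coord_ball n 9" for x
    using coordV[OF that] chie[OF that] that inU by (auto simp: Q_def e_def coord_ball_def)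
  have chiin: "\<kappa> z \<in> coord_ball n 9" if "z \<in> Q" for z
    using that inV[of z] VE csupp by (auto simp: Q_def coord_ball_def \<kappa>_def topspace_Euclidean_space)
  have ce: "continuous_map (top_of_set (coord_ball n 9)) (subtopology M Q) e"
  proof -
    have "continuous_map (top_of_set (coord_ball n 9)) (top_of_set V) (\<lambda>x i. c i + k * x i)"
      using coordV
      by (auto simp: continuous_map_in_subtopology continuous_on_coordinatewise_iff
        intro!: continuous_intros continuous_on_subset[OF continuous_on_product_coordinates])
    from continuous_map_compose[OF this cpsi] show ?thesis
      using ein by (auto simp: e_def o_def continuous_map_in_subtopology)
  qed
  have cchi: "continuous_map (subtopology M Q) (top_of_set (coord_ball n 9)) \<kappa>"
  proof -
    have "subtopology M Q = subtopology (subtopology M U) Q"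
      by (auto simp: subtopology_subtopology Q_def intro: arg_cong[where f = "subtopology M"])
    then have "continuous_map (subtopology M Q) euclidean \<kappa>"
      using continuous_map_from_subtopology[OF cchi_i]
      by (simp add: continuous_map_componentwise_UNIV flip: euclidean_product_topology)
    then show ?thesis using chiin by (auto simp: continuous_map_in_subtopology)
  qed
  have "chart_ball M n Q e \<kappa>"
    using M Qo ce cchi chie echi Q_def
    by unfold_locales (auto simp: topological_manifold_def homeomorphic_maps_def)
  moreover have "\<kappa> m = (\<lambda>_. 0)" by (simp add: \<kappa>_def c_def)
  moreover from this have "m \<in> Q" using U by (auto simp: Q_def)
  ultimately show ?thesis using that by blast
qed

section \<open>The basic push\<close>

context chart_ball
begin

text \<open>\<open>\<theta>\<close> and \<open>\<theta>'\<close> are the old and the new stage of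
  the target; they agree off \<open>Z\<close>. Good points are pushed out of the ball of radius
  \<open>\<rho> x\<close> about the old target. By \<open>\<rho>_big\<close> a new target that
  differs from the old one lies strictly inside this ball, so a pushed point cannot land on it;
  \<open>\<rho>\<close> vanishes off \<open>Z\<close> so that the push fades out. The last
  conclusion serves the control of roots: a point either rests and keeps all its labels, or it ends
  on the sphere of radius \<open>\<rho> x\<close>.\<close>

lemma push_step:
  fixes X :: "'x topology" and \<Gamma> :: "'x \<times> real \<times> real \<Rightarrow> 'm" and \<Phi> :: "'x \<times> real \<Rightarrow> 'm"
  assumes lpc: "locally_path_connected_space X"
    and \<Gamma>: "continuous_map (prod_topology X (top_of_set ({0..1} \<times> {0..1}))) M \<Gamma>"
    and \<Phi>: "continuous_map (prod_topology X (top_of_set {0..1})) M \<Phi>"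
    and base: "\<And>r. r \<in> {0..1} \<Longrightarrow> \<Gamma> (x0, 0, r) = a"
    and \<theta>: "continuous_map X (top_of_set {0..1}) \<theta>" and \<theta>': "continuous_map X (top_of_set {0..1}) \<theta>'"
    and U: "openin X U" and Z: "closedin X Z" "Z \<subseteq> U"
    and off: "\<And>x. x \<in> topspace X - Z \<Longrightarrow> \<theta>' x = \<theta> x"
    and small: "\<And>x s. x \<in> U \<Longrightarrow> s \<in> {0..1} \<Longrightarrow>
           \<Gamma> (x, 1, \<theta> x + s * (\<theta>' x - \<theta> x)) \<in> Q \<and> nrm n (\<kappa> (\<Gamma> (x, 1, \<theta> x + s * (\<theta>' x - \<theta> x)))) < 1"
    and \<rho>c: "continuous_map (subtopology X U) euclideanreal \<rho>"
    and \<rho>: "\<And>x. x \<in> U \<Longrightarrow> 0 \<le> \<rho> x \<and> \<rho> x \<le> 4" "\<And>x. x \<in> U - Z \<Longrightarrow> \<rho> x = 0"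
    and \<rho>_big: "\<And>x. x \<in> U \<Longrightarrow> dst (\<Gamma> (x, 1, \<theta>' x)) (\<kappa> (\<Gamma> (x, 1, \<theta> x))) < \<rho> x \<or>
           dst (\<Gamma> (x, 1, \<theta>' x)) (\<kappa> (\<Gamma> (x, 1, \<theta> x))) = 0 \<and> \<rho> x = 0"
    and none: "\<And>l. pathin X l \<Longrightarrow> l 0 = x0 \<Longrightarrow>
           \<not> homotopic_rel_endpoints M (\<lambda>t. \<Gamma> (l t, t, \<theta> (l 1))) (\<lambda>t. \<Phi> (l t, t))"
  obtains \<Phi>' where "continuous_map (prod_topology X (top_of_set {0..1})) M \<Phi>'"
    "\<And>x. \<Phi>' (x, 0) = \<Phi> (x, 0)"
    "\<And>l. pathin X l \<Longrightarrow> l 0 = x0 \<Longrightarrow>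
       \<not> homotopic_rel_endpoints M (\<lambda>t. \<Gamma> (l t, t, \<theta>' (l 1))) (\<lambda>t. \<Phi>' (l t, t))"
    "\<And>x. x \<in> topspace X \<Longrightarrow>
       \<Phi>' (x, 1) = \<Phi> (x, 1) \<and>
         (\<forall>l. pathin X l \<and> l 1 = x \<longrightarrow> homotopic_rel_endpoints M (\<lambda>t. \<Phi>' (l t, t)) (\<lambda>t. \<Phi> (l t, t))) \<or>
       x \<in> Z \<and> \<Phi>' (x, 1) \<in> Q \<and> dst (\<Phi>' (x, 1)) (\<kappa> (\<Gamma> (x, 1, \<theta> x))) = \<rho> x"
proof -
  define \<psi> where "\<psi> = (\<lambda>x. \<Phi> (x, 1))"
  define c where "c = (\<lambda>x. \<Gamma> (x, 1, \<theta> x))"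
  define b where "b = (\<lambda>x. \<kappa> (c x))"
  have UX: "U \<subseteq> topspace X" using U openin_subset by auto
  have \<theta>I: "\<theta> x \<in> {0..1}" "\<theta>' x \<in> {0..1}" if "x \<in> topspace X" for x
    using \<theta> \<theta>' that by (auto simp: continuous_map_in_subtopology)
  have \<psi>c: "continuous_map X M \<psi>"
  proof -
    have "continuous_map X (prod_topology X (top_of_set {0..1})) (\<lambda>x. (x, 1::real))"
      by (auto simp: continuous_map_paired)
    from continuous_map_compose[OF this \<Phi>] show ?thesis by (simp add: \<psi>_def o_def)
  qed
  have cc: "continuous_map X M c"
  proof -
    have "continuous_map X (prod_topology X (prod_topology (top_of_set {0..1}) (top_of_set {0..1}))) (\<lambda>x. (x, 1::real, \<theta> x))"
      using \<theta> by (auto simp: continuous_map_paired simp del: prod_topology_subtopology_eu)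
    then have "continuous_map X (prod_topology X (top_of_set ({0..1} \<times> {0..1}))) (\<lambda>x. (x, 1::real, \<theta> x))"
      by simp
    from continuous_map_compose[OF this \<Gamma>] show ?thesis by (simp add: c_def o_def)
  qed
  have cU: "c x \<in> Q" "nrm n (\<kappa> (c x)) < 1" if "x \<in> U" for x
    using small[OF that, of 0] by (auto simp: c_def)
  have b1: "b x \<in> coord_ball n 1" if "x \<in> U" for x
    using cU[OF that] chi_in by (auto simp: b_def coord_ball_def)
  define V where "V = {x \<in> U. \<psi> x \<in> Q}"
  have V: "openin X V"
  proof -
    have "V = U \<inter> {x \<in> topspace X. \<psi> x \<in> Q}" using UX by (auto simp: V_def)
    then show ?thesis
      using openin_Int[OF U openin_continuous_map_preimage[OF \<psi>c openQ]] by simp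
  qed
  \<comment> \<open>For a good point, some label along \<open>\<Phi>\<close> is the label along the
    target followed by a detour inside \<open>Q\<close>. If moreover \<open>\<psi> x = c x\<close>,
    the detour is a null-homotopic loop and \<open>x\<close> is related to \<open>x0\<close>,
    against \<open>none\<close>.\<close>
  define good where "good = (\<lambda>x. \<exists>l w. pathin X l \<and> l 0 = x0 \<and> l 1 = x \<and>
      pathin (subtopology M Q) w \<and> w 0 = c x \<and> w 1 = \<psi> x \<and>
      homotopic_rel_endpoints M (pjoin (\<lambda>t. \<Gamma> (l t, t, \<theta> (l 1))) w) (\<lambda>t. \<Phi> (l t, t)))"
  have pathQ: "pathin M w" if "pathin (subtopology M Q) w" for w
    using that by (simp add: pathin_def continuous_map_in_subtopology)
  have \<Gamma>l: "pathin M (\<lambda>t. \<Gamma> (l t, t, r))" if "pathin X l" "r \<in> {0..1}" for l r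
  proof -
    have "continuous_map (prod_topology X (top_of_set {0..1})) (prod_topology X (prod_topology (top_of_set {0..1}) (top_of_set {0..1})))
        (\<lambda>(x, t). (x, t, r))"
      using that(2) by (auto simp: case_prod_unfold continuous_map_paired continuous_map_fst continuous_map_snd
          simp del: prod_topology_subtopology_eu)
    then have "continuous_map (prod_topology X (top_of_set {0..1})) (prod_topology X (top_of_set ({0..1} \<times> {0..1})))
        (\<lambda>(x, t). (x, t, r))" by simp
    from continuous_map_compose[OF this \<Gamma>] have "continuous_map (prod_topology X (top_of_set {0..1})) M (\<lambda>(x, t). \<Gamma> (x, t, r))"
      by (simp add: o_def case_prod_unfold)
    from pathin_diag[OF this that(1)] show ?thesis by simp
  qed
  \<comment> \<open>Continuing along \<open>u\<close> inside \<open>V\<close> extends both labels by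
    tracks in \<open>Q\<close>. By \<open>paths_homotopic\<close>, any path \<open>w'\<close> in
    \<open>Q\<close> between the new end points can take the place of the old detour.\<close>
  have spread: "good (u 1)" if u: "pathin (subtopology X V) u" and g: "good (u 0)" for u
  proof -
    have uX: "pathin X u" and uV: "\<And>s. s \<in> {0..1} \<Longrightarrow> u s \<in> V"
      using u by (auto simp: pathin_def continuous_map_in_subtopology)
    obtain l w where lw: "pathin X l" "l 0 = x0" "l 1 = u 0" "pathin (subtopology M Q) w" "w 0 = c (u 0)" "w 1 = \<psi> (u 0)"
      "homotopic_rel_endpoints M (pjoin (\<lambda>t. \<Gamma> (l t, t, \<theta> (l 1))) w) (\<lambda>t. \<Phi> (l t, t))"
      using g unfolding good_def by blast
    define v where "v = (\<lambda>s. c (u s))"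
    define w1 where "w1 = (\<lambda>s. \<psi> (u s))"
    have v: "pathin (subtopology M Q) v" "pathin (subtopology M Q) w1"
      using continuous_map_compose[OF uX[unfolded pathin_def] cc]
        continuous_map_compose[OF uX[unfolded pathin_def] \<psi>c] uV cU
      by (auto simp: v_def w1_def pathin_def continuous_map_in_subtopology o_def V_def Pi_iff)
    have u1: "u 1 \<in> V" and u0: "u 0 \<in> V" using uV[of 1] uV[of 0] by auto
    obtain w' where w': "pathin (subtopology M Q) w'" "w' 0 = c (u 1)" "w' 1 = \<psi> (u 1)"
      using path_exists[of "c (u 1)" "\<psi> (u 1)"] u1 cU by (auto simp: V_def)
    let ?G = "\<lambda>t. \<Gamma> (l t, t, \<theta> (l 1))"
    have G: "pathin M ?G" "?G 1 = c (u 0)"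
      using \<Gamma>l[OF lw(1), of "\<theta> (l 1)"] \<theta>I[of "u 0"] u0 UX lw(3) by (auto simp: V_def c_def)
    note pv = pathQ[OF v(1)] and pw1 = pathQ[OF v(2)] and pw = pathQ[OF lw(4)] and pw' = pathQ[OF w'(1)]
    have ends: "v 0 = c (u 0)" "v 1 = c (u 1)" "w1 0 = \<psi> (u 0)" "w1 1 = \<psi> (u 1)" by (auto simp: v_def w1_def)
    have l': "pathin X (pjoin l u)" by (rule pathin_pjoin[OF lw(1) uX lw(3)])
    have "homotopic_rel_endpoints M (\<lambda>t. \<Gamma> (pjoin l u t, t, \<theta> (u 1))) (pjoin ?G v)"
      unfolding v_def c_def
      by (rule diag_family_pjoin[OF \<Gamma> lw(1) uX lw(3) _ \<theta>]) (use lw(2) base in auto)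
    then have "homotopic_rel_endpoints M (pjoin (\<lambda>t. \<Gamma> (pjoin l u t, t, \<theta> (u 1))) w') (pjoin (pjoin ?G v) w')"
      using w' by (intro homotopic_rel_endpoints_pjoin homotopic_rel_endpoints_refl pw') (auto simp: c_def)
    also have "homotopic_rel_endpoints M \<dots> (pjoin ?G (pjoin v w'))"
      by (rule pjoin_assoc[OF G(1) pv pw']) (use G(2) ends w' in auto)
    also have "homotopic_rel_endpoints M \<dots> (pjoin ?G (pjoin w w1))"
    proof (rule homotopic_rel_endpoints_pjoin[OF homotopic_rel_endpoints_refl[OF G(1)] paths_homotopic])
      show "pathin (subtopology M Q) (pjoin v w')" "pathin (subtopology M Q) (pjoin w w1)"
        by (intro pathin_pjoin v w' lw(4); simp add: ends w' lw)+
    qed (use G(2) ends w' lw in auto)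
    also have "homotopic_rel_endpoints M \<dots> (pjoin (pjoin ?G w) w1)"
      by (rule homotopic_rel_endpoints_sym, rule pjoin_assoc[OF G(1) pw pw1]) (use G(2) ends lw in auto)
    also have "homotopic_rel_endpoints M \<dots> (pjoin (\<lambda>t. \<Phi> (l t, t)) w1)"
      by (rule homotopic_rel_endpoints_pjoin[OF lw(7) homotopic_rel_endpoints_refl[OF pw1]]) (simp add: lw ends)
    also have "homotopic_rel_endpoints M \<dots> (\<lambda>t. \<Phi> (pjoin l u t, t))"
      unfolding w1_def \<psi>_def by (rule homotopic_rel_endpoints_sym, rule diag_pjoin[OF \<Phi> lw(1) uX lw(3)])
    finally show ?thesis
      unfolding good_def using l' lw(2) w'
      by (intro exI[of _ "pjoin l u"] exI[of _ w']) simp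
  qed
  define P where "P = {x \<in> V. good x}"
  \<comment> \<open>Local path connectedness and \<open>spread\<close> make \<open>good\<close>
    locally constant on \<open>V\<close>; hence \<open>P\<close> and \<open>V - P\<close> are both
    open.\<close>
  have nbhd: "\<exists>N. openin X N \<and> x \<in> N \<and> N \<subseteq> V \<and> (\<forall>y\<in>N. good y = good x)" if xV: "x \<in> V" for x
  proof -
    obtain N where N: "openin X N" "path_connectedin X N" "x \<in> N" "N \<subseteq> V"
      using lpc[unfolded locally_path_connected_space, rule_format, OF conjI[OF V xV]] by blast
    have "good y = good z" if yz: "y \<in> N" "z \<in> N" and "good y" for y z
    proof -
      have "path_component_of (subtopology X N) y z"
        using N(2) yz path_connected_space_imp_path_component_of[of "subtopology X N" y z]
        by (auto simp: path_connectedin_def)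
      then obtain u where u: "pathin (subtopology X N) u" "u 0 = y" "u 1 = z"
        unfolding path_component_of_def by blast
      then have "pathin (subtopology X V) u"
        using N(4) by (auto simp: pathin_def continuous_map_in_subtopology)
      from spread[OF this] u \<open>good y\<close> show ?thesis by auto
    qed
    then show ?thesis using N by blast
  qed
  have openV: "openin X {x \<in> V. good x = g}" for g
    unfolding openin_subopen[of X "{x \<in> V. good x = g}"]
  proof
    fix x assume "x \<in> {x \<in> V. good x = g}"
    then obtain N where "openin X N" "x \<in> N" "N \<subseteq> V" "\<forall>y\<in>N. good y = g"
      using nbhd[of x] by auto
    then show "\<exists>N. openin X N \<and> x \<in> N \<and> N \<subseteq> {x \<in> V. good x = g}" by blast
  qed
  have P: "openin X P" and VP: "openin X (V - P)"
    using openV[of True] openV[of False] by (simp_all add: P_def set_diff_eq Collect_conj_eq cong: conj_cong)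
  have PU: "P \<subseteq> U" "P \<subseteq> V" "V \<subseteq> U" by (auto simp: P_def V_def)
  have apart: "\<kappa> (\<psi> x) \<noteq> b x" "dst (\<psi> x) (b x) > 0" if "x \<in> P" for x
  proof -
    have xU: "x \<in> U" "\<psi> x \<in> Q" using that by (auto simp: P_def V_def)
    have "\<psi> x \<noteq> c x"
    proof
      assume eq: "\<psi> x = c x"
      obtain l w where lw: "pathin X l" "l 0 = x0" "l 1 = x" "pathin (subtopology M Q) w" "w 0 = c x" "w 1 = \<psi> x"
        "homotopic_rel_endpoints M (pjoin (\<lambda>t. \<Gamma> (l t, t, \<theta> (l 1))) w) (\<lambda>t. \<Phi> (l t, t))"
        using \<open>x \<in> P\<close> unfolding P_def good_def by blast
      let ?G = "\<lambda>t. \<Gamma> (l t, t, \<theta> (l 1))"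
      have G: "pathin M ?G" "?G 1 = c x"
        using \<Gamma>l[OF lw(1), of "\<theta> (l 1)"] \<theta>I[of x] xU UX lw(3) by (auto simp: c_def)
      have "homotopic_rel_endpoints M ?G (pjoin ?G (\<lambda>_. c x))"
        by (rule homotopic_rel_endpoints_sym, rule pjoin_const_right[OF G])
      also have "homotopic_rel_endpoints M \<dots> (pjoin ?G w)"
      proof (rule homotopic_rel_endpoints_pjoin[OF homotopic_rel_endpoints_refl[OF G(1)] paths_homotopic])
        show "pathin (subtopology M Q) (\<lambda>_. c x)"
          using cU[OF xU(1)] Q_subset by (auto simp: pathin_def)
      qed (use G lw eq in auto)
      also note lw(7)
      finally show False using none[OF lw(1,2)] by simp
    qed
    then show ne: "\<kappa> (\<psi> x) \<noteq> b x"
      using e_chi[OF xU(2)] e_chi[OF cU(1)[OF xU(1)]] by (auto simp: b_def)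
    then have "dst (\<psi> x) (b x) \<noteq> 0"
      using coord_ball_diff_eq_0[OF chi_in[OF xU(2)] b1[OF xU(1)]] by auto
    then show "dst (\<psi> x) (b x) > 0" by (simp add: less_le)
  qed
  have \<kappa>\<psi>c: "continuous_map (subtopology X V) euclideanreal (\<lambda>x. \<kappa> (\<psi> x) i)" for i
  proof -
    have "continuous_map (subtopology X V) (subtopology M Q) \<psi>"
      using \<psi>c by (auto simp: continuous_map_in_subtopology continuous_map_from_subtopology V_def)
    from continuous_map_compose[OF this continuous_chi_coord] show ?thesis by (simp add: o_def)
  qed
  have bc: "continuous_map (subtopology X U) euclideanreal (\<lambda>x. b x i)" for i
  proof -
    have "continuous_map (subtopology X U) (subtopology M Q) c"
      using cc cU by (auto simp: continuous_map_in_subtopology continuous_map_from_subtopology)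
    from continuous_map_compose[OF this continuous_chi_coord] show ?thesis by (simp add: o_def b_def)
  qed
  have UV: "continuous_map (subtopology X V) euclideanreal g" if "continuous_map (subtopology X U) euclideanreal g" for g
    using continuous_map_from_subtopology_mono[OF that PU(3)] .
  have dc: "continuous_map (subtopology X V) euclideanreal (\<lambda>x. dst (\<psi> x) (b x))"
    by (intro continuous_map_nrm continuous_map_diff \<kappa>\<psi>c UV bc)
  \<comment> \<open>Among the points of \<open>P\<close>, only those in \<open>Z'\<close> can be
    moved. \<open>Z'\<close> is closed in \<open>X\<close> although \<open>Q\<close> is merely open:
    \<open>\<psi>\<close> maps it into the closed ball of radius 5, since distances are at most 4
    from centres of norm below 1.\<close>
  define Z' where "Z' = {x \<in> Z. \<psi> x \<in> Q \<and> dst (\<psi> x) (b x) \<le> \<rho> x}"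
  have Z'V: "Z' \<subseteq> V" using Z(2) by (auto simp: Z'_def V_def)
  have Z': "closedin X Z'"
  proof -
    define Z1 where "Z1 = Z \<inter> {x \<in> topspace X. \<psi> x \<in> {z \<in> Q. nrm n (\<kappa> z) \<le> 5}}"
    have Z1: "closedin X Z1" unfolding Z1_def
      by (intro closedin_Int Z(1) closedin_continuous_map_preimage[OF \<psi>c] closedin_ball)
    have Z1V: "Z1 \<subseteq> V" using Z(2) by (auto simp: Z1_def V_def)
    have "continuous_map (subtopology X Z1) euclideanreal (\<lambda>x. dst (\<psi> x) (b x) - \<rho> x)"
      by (rule continuous_map_from_subtopology_mono[OF _ Z1V]) (intro continuous_map_diff dc UV \<rho>c)
    then have "closedin (subtopology X Z1) {x \<in> topspace (subtopology X Z1). dst (\<psi> x) (b x) - \<rho> x \<in> {..0}}"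
      by (rule closedin_continuous_map_preimage) auto
    moreover have "{x \<in> topspace (subtopology X Z1). dst (\<psi> x) (b x) - \<rho> x \<in> {..0}} = Z'"
    proof -
      have "nrm n (\<kappa> (\<psi> x)) \<le> 5" if "x \<in> Z'" for x
      proof -
        have x: "x \<in> U" "dst (\<psi> x) (b x) \<le> \<rho> x" using that Z(2) by (auto simp: Z'_def)
        then show ?thesis
          using nrm_le_diff_add[of n "\<kappa> (\<psi> x)" "b x"] \<rho>(1)[OF x(1)] cU(2)[OF x(1)] by (auto simp: b_def)
      qed
      then show ?thesis
        using closedin_subset[OF Z(1)] by (auto simp: Z1_def Z'_def)
    qed
    ultimately show ?thesis using closedin_trans_full[OF _ Z1] by simp
  qed
  \<comment> \<open>\<open>P\<close> and \<open>T\<close> are open and cover \<open>X\<close>. On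
    their overlap a point is off \<open>Z\<close>, where the radius is 0, or farther than
    \<open>\<rho> x\<close> from the centre. In both cases the push rests, so pushing on
    \<open>P\<close> and staying at \<open>\<psi>\<close> on \<open>T\<close> fit together.\<close>
  define T where "T = (topspace X - Z') \<union> (V - P)"
  have T: "openin X T"
    unfolding T_def using Z' VP by (auto intro: openin_Un)
  have cover: "x \<in> P \<or> x \<in> T" if "x \<in> topspace X" for x
    using that Z'V by (auto simp: T_def)
  have notT: "x \<notin> T \<longleftrightarrow> x \<in> Z' \<and> x \<in> P" if "x \<in> topspace X" for x
    using that Z'V by (auto simp: T_def)
  have far: "push (b x) (\<rho> x) s (\<psi> x) = \<psi> x" if x: "x \<in> P" "x \<in> T" and s: "s \<in> {0..1}" for x s
  proof (rule push_far[OF _ _ s])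
    show "\<psi> x \<in> Q" using x by (auto simp: P_def V_def)
    have xU: "x \<in> U" "x \<in> topspace X" using x PU UX by auto
    have "x \<notin> Z'" using notT[OF xU(2)] x by auto
    then show "\<rho> x \<le> dst (\<psi> x) (b x)"
      using \<open>\<psi> x \<in> Q\<close> \<rho>(2)[of x] xU by (cases "x \<in> Z") (auto simp: Z'_def)
  qed
  define \<Psi> where "\<Psi> = (\<lambda>(x, s). if x \<in> P then push (b x) (\<rho> x) s (\<psi> x) else \<psi> x)"
  let ?XI = "prod_topology X (top_of_set {0..1::real})"
  have \<Psi>: "continuous_map ?XI M \<Psi>"
  proof (rule pasting_lemma[where I = UNIV and T = "\<lambda>i. (if i then P else T) \<times> {0..1}"
        and f = "\<lambda>i (x, s). if i then push (b x) (\<rho> x) s (\<psi> x) else \<psi> x"])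
    show "openin ?XI ((if i then P else T) \<times> {0..1})" for i
      using P T by (auto simp: openin_prod_Times_iff)
    show "continuous_map (subtopology ?XI ((if i then P else T) \<times> {0..1})) M
        (\<lambda>(x, s). if i then push (b x) (\<rho> x) s (\<psi> x) else \<psi> x)" for i
    proof (cases i)
      case False
      then show ?thesis
        using continuous_map_from_subtopology[OF continuous_map_compose[OF continuous_map_fst \<psi>c]]
        by (simp add: case_prod_unfold o_def)
    next
      case True
      let ?PI = "subtopology ?XI (P \<times> {0..1})"
      have fst: "continuous_map ?PI (subtopology X V) fst" "continuous_map ?PI (subtopology X U) fst"
        using PU by (auto simp: continuous_map_in_subtopology continuous_map_from_subtopology continuous_map_fst)
      have snd: "continuous_map ?PI euclideanreal snd"
        using continuous_map_snd[of X "top_of_set {0..1::real}"]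
        by (auto simp: continuous_map_in_subtopology continuous_map_from_subtopology)
      have f1: "continuous_map ?PI euclideanreal (\<lambda>z. g (fst z))"
        if "continuous_map (subtopology X V) euclideanreal g" for g
        using continuous_map_compose[OF fst(1) that] by (simp add: o_def)
      have f2: "continuous_map ?PI euclideanreal (\<lambda>z. g (fst z))"
        if "continuous_map (subtopology X U) euclideanreal g" for g
        using continuous_map_compose[OF fst(2) that] by (simp add: o_def)
      have "continuous_map ?PI M (\<lambda>z. e (push_coord (b (fst z)) (\<rho> (fst z)) (snd z) (\<psi> (fst z))))"
      proof (rule continuous_e')
        show "continuous_map ?PI euclideanreal (\<lambda>z. push_coord (b (fst z)) (\<rho> (fst z)) (snd z) (\<psi> (fst z)) i)" for i
          unfolding push_coord_def
          by (intro continuous_map_add continuous_map_real_mult continuous_map_real_max continuous_map_diff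
              continuous_map_real_divide f1[OF dc] f1[OF \<kappa>\<psi>c] f2[OF bc] f2[OF \<rho>c] snd)
             (use apart(2) in \<open>fastforce+\<close>)
      next
        fix z assume "z \<in> topspace ?PI"
        then have x: "fst z \<in> P" "snd z \<in> {0..1}" by auto
        then have xU: "fst z \<in> U" "\<psi> (fst z) \<in> Q" by (auto simp: P_def V_def)
        show "push_coord (b (fst z)) (\<rho> (fst z)) (snd z) (\<psi> (fst z)) \<in> coord_ball n 9"
          using \<rho>(1)[OF xU(1)] by (intro push_coord_in xU apart x b1) auto
      qed
      then show ?thesis using True by (simp add: case_prod_unfold push_def)
    qed
  next
    fix i j :: bool and z
    assume "z \<in> topspace ?XI \<inter> (if i then P else T) \<times> {0..1} \<inter> (if j then P else T) \<times> {0..1}"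
    then show "(\<lambda>(x, s). if i then push (b x) (\<rho> x) s (\<psi> x) else \<psi> x) z =
        (\<lambda>(x, s). if j then push (b x) (\<rho> x) s (\<psi> x) else \<psi> x) z"
      using far by (auto split: if_splits)
  next
    fix z assume "z \<in> topspace ?XI"
    then show "\<exists>j. j \<in> UNIV \<and> z \<in> (if j then P else T) \<times> {0..1} \<and>
        \<Psi> z = (\<lambda>(x, s). if j then push (b x) (\<rho> x) s (\<psi> x) else \<psi> x) z"
      using cover[of "fst z"] by (intro exI[of _ "fst z \<in> P"]) (auto simp: \<Psi>_def)
  qed
  have \<Psi>0: "\<Phi> (x, 1) = \<Psi> (x, 0)" if "x \<in> topspace X" for x
    using push_0[of "\<psi> x"] by (auto simp: \<Psi>_def \<psi>_def P_def V_def)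
  have stat: "\<Psi> (x, s) = \<Phi> (x, 1)" if "x \<in> T" "s \<in> {0..1}" for x s
    using far that by (auto simp: \<Psi>_def \<psi>_def)
  have moved: "x \<in> Z" "\<Psi> (x, 1) \<in> Q" "dst (\<Psi> (x, 1)) (b x) = \<rho> x" if x: "x \<in> topspace X" "x \<notin> T" for x
  proof -
    have xP: "x \<in> P" "x \<in> Z'" using notT x by auto
    then show "x \<in> Z" by (auto simp: Z'_def)
    have xU: "x \<in> U" "\<psi> x \<in> Q" "dst (\<psi> x) (b x) \<le> \<rho> x" using xP by (auto simp: P_def V_def Z'_def)
    show "\<Psi> (x, 1) \<in> Q" "dst (\<Psi> (x, 1)) (b x) = \<rho> x"
      using push_near[OF xU(2) apart(1)[OF xP(1)] b1[OF xU(1)] _ xU(3)] \<rho>(1)[OF xU(1)] xP(1)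
      by (auto simp: \<Psi>_def)
  qed
  define \<Phi>' where "\<Phi>' = hjoin \<Phi> \<Psi>"
  have \<Phi>'1: "\<Phi>' (x, 1) = \<Psi> (x, 1)" for x by (simp add: \<Phi>'_def)
  have lab: "homotopic_rel_endpoints M (\<lambda>t. \<Phi>' (l t, t)) (\<lambda>t. \<Phi> (l t, t))" if l: "pathin X l" "l 1 \<in> T" for l
    unfolding \<Phi>'_def by (rule diag_hjoin_stationary[OF \<Phi> \<Psi> \<Psi>0 l(1)]) (use stat[OF l(2)] in auto)
  show ?thesis
  proof (rule that[of \<Phi>'])
    show "continuous_map ?XI M \<Phi>'"
      unfolding \<Phi>'_def by (rule continuous_map_hjoin[OF \<Phi> \<Psi> \<Psi>0])
    show "\<Phi>' (x, 0) = \<Phi> (x, 0)" for x by (simp add: \<Phi>'_def)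
    show "\<Phi>' (x, 1) = \<Phi> (x, 1) \<and>
         (\<forall>l. pathin X l \<and> l 1 = x \<longrightarrow> homotopic_rel_endpoints M (\<lambda>t. \<Phi>' (l t, t)) (\<lambda>t. \<Phi> (l t, t))) \<or>
       x \<in> Z \<and> \<Phi>' (x, 1) \<in> Q \<and> dst (\<Phi>' (x, 1)) (\<kappa> (\<Gamma> (x, 1, \<theta> x))) = \<rho> x" if "x \<in> topspace X" for x
    proof (cases "x \<in> T")
      case True then show ?thesis using lab stat[of x 1] by (auto simp: \<Phi>'1)
    next
      case False then show ?thesis using moved[OF that] by (auto simp: \<Phi>'1 b_def c_def)
    qed
    fix l assume l: "pathin X l" "l 0 = x0"
    show "\<not> homotopic_rel_endpoints M (\<lambda>t. \<Gamma> (l t, t, \<theta>' (l 1))) (\<lambda>t. \<Phi>' (l t, t))"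
    proof
      assume h: "homotopic_rel_endpoints M (\<lambda>t. \<Gamma> (l t, t, \<theta>' (l 1))) (\<lambda>t. \<Phi>' (l t, t))"
      define x where "x = l 1"
      have x: "x \<in> topspace X" using l(1) by (auto simp: x_def pathin_def continuous_map_def Pi_iff)
      have e1: "\<Gamma> (x, 1, \<theta>' x) = \<Psi> (x, 1)"
        using homotopic_rel_endpoints_imp(4)[OF h] by (simp add: x_def \<Phi>'1)
      show False
      proof (cases "x \<in> T")
        case False
        then have xP: "x \<in> P" "x \<in> Z'" using notT x by auto
        then have xU: "x \<in> U" "dst (\<psi> x) (b x) \<le> \<rho> x" by (auto simp: P_def V_def Z'_def)
        \<comment> \<open>A moved point sits on the sphere, where the new target can be only if the
          radius is 0. But a moved point has positive distance at most \<open>\<rho> x\<close>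
          before the push.\<close>
        have "dst (\<Gamma> (x, 1, \<theta>' x)) (\<kappa> (\<Gamma> (x, 1, \<theta> x))) = \<rho> x"
          using moved(3)[OF x False] by (simp add: e1 b_def c_def)
        then have "\<rho> x = 0" using \<rho>_big[OF xU(1)] by auto
        then show False using apart(2)[OF xP(1)] xU(2) by simp
      next
        case True
        have hl: "homotopic_rel_endpoints M (\<lambda>t. \<Gamma> (l t, t, \<theta>' x)) (\<lambda>t. \<Phi> (l t, t))"
          using homotopic_rel_endpoints_trans[OF h lab[OF l(1)]] True by (simp add: x_def)
        show False
        proof (cases "x \<in> Z")
          case False
          then have "\<theta>' x = \<theta> x" using off x by simp
          then show False using hl none[OF l] by (simp add: x_def)
        next
          case xZ: True
          then have xU: "x \<in> U" using Z by auto
          \<comment> \<open>Here \<open>x\<close> rests although it lies on the new target. The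
            track \<open>w\<close> of the target from its old to its new position is a detour in
            \<open>Q\<close> that makes \<open>x\<close> good; as \<open>x\<close> is also close
            enough to the old target, it should have been moved.\<close>
          have \<psi>x: "\<psi> x = \<Gamma> (x, 1, \<theta>' x)" using e1 stat[OF True, of 1] by (simp add: \<psi>_def)
          have in01: "\<theta> x + s * (\<theta>' x - \<theta> x) \<in> {0..1}" if "s \<in> {0..1}" for s
            using convexD[of "{0..1::real}" "\<theta> x" "\<theta>' x" "1 - s" s] \<theta>I[OF x] that
            by (simp add: algebra_simps)
          define w where "w = (\<lambda>s. \<Gamma> (x, 1, \<theta> x + s * (\<theta>' x - \<theta> x)))"
          have "continuous_map (top_of_set {0..1::real}) (prod_topology X (prod_topology (top_of_set {0..1}) (top_of_set {0..1})))
             (\<lambda>s. (x, 1::real, \<theta> x + s * (\<theta>' x - \<theta> x)))"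
            using x in01 unfolding continuous_map_paired
            by (auto simp: continuous_map_in_subtopology intro!: continuous_intros simp del: prod_topology_subtopology_eu)
          then have "continuous_map (top_of_set {0..1::real}) (prod_topology X (top_of_set ({0..1} \<times> {0..1})))
             (\<lambda>s. (x, 1::real, \<theta> x + s * (\<theta>' x - \<theta> x)))" by simp
          from continuous_map_compose[OF this \<Gamma>] have w: "pathin (subtopology M Q) w"
            using small[OF xU] by (auto simp: w_def pathin_def o_def continuous_map_in_subtopology)
          have ends: "w 0 = c x" "w 1 = \<psi> x" by (simp_all add: w_def c_def \<psi>x)
          have "homotopic_rel_endpoints M (\<lambda>t. \<Gamma> (l t, t, \<theta>' x)) (pjoin (\<lambda>t. \<Gamma> (l t, t, \<theta> x)) w)"
            unfolding w_def using diag_family_param[OF \<Gamma> l(1), of a "\<theta> x" "\<theta>' x"] base l(2) \<theta>I[OF x]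
            by (simp add: x_def)
          then have "homotopic_rel_endpoints M (pjoin (\<lambda>t. \<Gamma> (l t, t, \<theta> (l 1))) w) (\<lambda>t. \<Phi> (l t, t))"
            using homotopic_rel_endpoints_trans[OF homotopic_rel_endpoints_sym hl] by (simp add: x_def)
          then have "good x"
            unfolding good_def using l w ends x_def by blast
          moreover have "\<psi> x \<in> Q" using small[OF xU, of 1] \<psi>x by simp
          ultimately have xP: "x \<in> P" using xU by (auto simp: P_def V_def)
          have "dst (\<psi> x) (b x) \<le> \<rho> x"
            using \<rho>_big[OF xU] by (auto simp: \<psi>x b_def c_def)
          then have "x \<in> Z'" using xZ \<open>\<psi> x \<in> Q\<close> by (auto simp: Z'_def)
          then show False using notT[OF x] xP True by auto
        qed
      qed
    qed
  qed
qed

end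

section \<open>Moving the target along a family\<close>

text \<open>\<open>\<Gamma> (\<cdot>, \<cdot>, r)\<close> is the target homotopy at stage \<open>r\<close>. The stage \<open>\<theta>\<close> depends on the end point of the path,
  so that the target can be moved over a small part of \<open>X\<close> at a time.\<close>

definition unrelated ::
    "'x topology \<Rightarrow> 'm topology \<Rightarrow> ('x \<times> real \<times> real \<Rightarrow> 'm) \<Rightarrow> 'x \<Rightarrow> ('x \<Rightarrow> real) \<Rightarrow> ('x \<times> real \<Rightarrow> 'm) \<Rightarrow> bool" where
  "unrelated X M \<Gamma> x0 \<theta> \<Phi> \<longleftrightarrow>
     continuous_map (prod_topology X (top_of_set {0..1})) M \<Phi> \<and>
     (\<forall>l. pathin X l \<and> l 0 = x0 \<longrightarrow>
        \<not> homotopic_rel_endpoints M (\<lambda>t. \<Gamma> (l t, t, \<theta> (l 1))) (\<lambda>t. \<Phi> (l t, t)))"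

lemma unrelated_cong:
  assumes "unrelated X M \<Gamma> x0 \<theta> \<Phi>" "\<And>x. x \<in> topspace X \<Longrightarrow> \<theta> x = \<theta>' x"
  shows "unrelated X M \<Gamma> x0 \<theta>' \<Phi>"
proof -
  have "l 1 \<in> topspace X" if "pathin X l" for l
    using that by (auto simp: pathin_def continuous_map_def Pi_iff)
  then show ?thesis using assms by (auto simp: unrelated_def)
qed

lemma continuous_map_family_end:
  assumes "continuous_map (prod_topology X (top_of_set ({0..1} \<times> {0..1::real}))) M \<Gamma>"
    and "continuous_map Z X f" "continuous_map Z (top_of_set {0..1}) \<theta>"
  shows "continuous_map Z M (\<lambda>z. \<Gamma> (f z, 1::real, \<theta> z))"
proof -
  have "continuous_map Z (prod_topology X (prod_topology (top_of_set {0..1}) (top_of_set {0..1}))) (\<lambda>z. (f z, 1::real, \<theta> z))"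
    using assms(2,3) by (auto simp: continuous_map_paired simp del: prod_topology_subtopology_eu)
  then have "continuous_map Z (prod_topology X (top_of_set ({0..1} \<times> {0..1}))) (\<lambda>z. (f z, 1::real, \<theta> z))"
    by simp
  from continuous_map_compose[OF this assms(1)] show ?thesis by (simp add: o_def)
qed

lemma affine_in_unit:
  assumes "\<tau>1 \<in> {0..1::real}" "\<tau>2 \<in> {0..1}" "s \<in> {0..1}"
  shows "\<tau>1 + (\<tau>2 - \<tau>1) * s \<in> {0..1}"
  using convexD[of "{0..1::real}" \<tau>1 \<tau>2 "1 - s" s] assms by (simp add: algebra_simps)

lemma affine_near:
  assumes "\<bar>\<tau>1 - \<tau>0\<bar> < \<epsilon>" "\<bar>\<tau>2 - \<tau>0\<bar> < \<epsilon>" "s \<in> {0..1::real}"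
  shows "\<bar>\<tau>1 + (\<tau>2 - \<tau>1) * s - \<tau>0\<bar> < \<epsilon>"
  using convexD[of "{\<tau>0-\<epsilon><..<\<tau>0+\<epsilon>}" \<tau>1 \<tau>2 "1 - s" s] assms by (auto simp: algebra_simps abs_less_iff)

text \<open>\<open>m y\<close> is the fraction of the way from stage \<open>\<tau>1\<close> to
  \<open>\<tau>2\<close> that has been covered over \<open>y\<close>. A bump function raises it to 1
  on \<open>N\<close>. Since \<open>\<epsilon>\<close> and \<open>N\<close> are chosen before
  \<open>m\<close> and the stages, finitely many applications can complete the move, and
  \<open>m y \<le> m' y\<close> keeps the progress made by earlier ones.\<close>

lemma push_near_point:
  fixes X :: "'x topology" and \<Gamma> :: "'x \<times> real \<times> real \<Rightarrow> 'm"
  assumes M: "topological_manifold n M"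
    and X: "compact_space X" "Hausdorff_space X" "locally_path_connected_space X"
    and \<Gamma>: "continuous_map (prod_topology X (top_of_set ({0..1} \<times> {0..1}))) M \<Gamma>"
    and base: "\<And>r. r \<in> {0..1} \<Longrightarrow> \<Gamma> (x0, 0, r) = a"
    and x: "x \<in> topspace X" and \<tau>0: "\<tau>0 \<in> {0..1}"
  obtains \<epsilon> N where "\<epsilon> > 0" "openin X N" "x \<in> N"
    "\<And>\<tau>1 \<tau>2 m \<Phi>. \<lbrakk>\<tau>1 \<in> {0..1}; \<tau>2 \<in> {0..1}; \<bar>\<tau>1 - \<tau>0\<bar> < \<epsilon>; \<bar>\<tau>2 - \<tau>0\<bar> < \<epsilon>;
        continuous_map X (top_of_set {0..1}) m; unrelated X M \<Gamma> x0 (\<lambda>y. \<tau>1 + (\<tau>2 - \<tau>1) * m y) \<Phi>\<rbrakk>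
      \<Longrightarrow> \<exists>m' \<Phi>'. continuous_map X (top_of_set {0..1}) m' \<and> (\<forall>y\<in>topspace X. m y \<le> m' y) \<and>
           (\<forall>y\<in>N. m' y = 1) \<and> unrelated X M \<Gamma> x0 (\<lambda>y. \<tau>1 + (\<tau>2 - \<tau>1) * m' y) \<Phi>' \<and>
           (\<forall>y. \<Phi>' (y, 0) = \<Phi> (y, 0))"
proof -
  let ?I = "top_of_set {0..1::real}"
  define G where "G = (\<lambda>z. \<Gamma> (fst z, 1, snd z :: real))"
  have Gc: "continuous_map (prod_topology X ?I) M G"
    unfolding G_def by (rule continuous_map_family_end[OF \<Gamma> continuous_map_fst continuous_map_snd])
  have "G (x, \<tau>0) \<in> topspace M"
    by (rule funcset_mem[OF continuous_map_funspace[OF Gc]]) (use x \<tau>0 in simp)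
  then have "\<Gamma> (x, 1, \<tau>0) \<in> topspace M" by (simp add: G_def)
  then obtain Q e \<kappa> where cb: "chart_ball M n Q e \<kappa>" and c0: "\<Gamma> (x, 1, \<tau>0) \<in> Q" "\<kappa> (\<Gamma> (x, 1, \<tau>0)) = (\<lambda>_. 0)"
    using chart_ball_exists[OF M] by blast
  interpret chart_ball M n Q e \<kappa> by (fact cb)
  define W where "W = {z \<in> Q. nrm n (\<kappa> z) < 1}"
  have W: "openin M W" unfolding W_def by (rule openin_ball)
  have UJ1: "openin (prod_topology X ?I) {z \<in> topspace (prod_topology X ?I). G z \<in> W}"
    by (rule openin_continuous_map_preimage[OF Gc W])
  have UJ2: "(x, \<tau>0) \<in> {z \<in> topspace (prod_topology X ?I). G z \<in> W}"
    using x \<tau>0 c0 by (auto simp: W_def G_def)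
  obtain U J where UJ: "openin X U" "openin ?I J" "x \<in> U" "\<tau>0 \<in> J"
      "U \<times> J \<subseteq> {z \<in> topspace (prod_topology X ?I). G z \<in> W}"
    using UJ1[unfolded openin_prod_topology_alt, rule_format, OF UJ2] by (elim exE conjE)
  obtain \<epsilon> where \<epsilon>: "\<epsilon> > 0" "\<And>r. r \<in> {0..1} \<Longrightarrow> \<bar>r - \<tau>0\<bar> < \<epsilon> \<Longrightarrow> r \<in> J"
    using UJ(2,4) unfolding openin_euclidean_subtopology_iff by (auto simp: dist_real_def)
  have inW: "\<Gamma> (y, 1, r) \<in> W" if "y \<in> U" "r \<in> {0..1}" "\<bar>r - \<tau>0\<bar> < \<epsilon>" for y r
    using UJ(5) \<epsilon>(2)[OF that(2,3)] that(1) by (auto simp: G_def)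
  have UX: "U \<subseteq> topspace X" using UJ(1) openin_subset by auto
  have "normal_space X" using X compact_Hausdorff_or_regular_imp_normal_space by blast
  moreover have "closedin X {x}" using X(2) x by (simp add: closedin_Hausdorff_singleton)
  moreover have "closedin X (topspace X - U)" using UJ(1) by blast
  ultimately obtain f where f: "continuous_map X euclideanreal f" "f ` (topspace X - U) \<subseteq> {0}" "f ` {x} \<subseteq> {1}"
    using Urysohn_lemma_alt[of X "topspace X - U" "{x}" 0 1] UJ(3) by (auto simp: disjnt_def)
  \<comment> \<open>Cutting \<open>f\<close> off at 1/3 and 2/3 makes \<open>u\<close> equal to 1 on
    a whole neighbourhood of \<open>x\<close> and confines the change to a closed set inside
    \<open>U\<close>.\<close>
  define u where "u = (\<lambda>y. max 0 (min 1 (3 * f y - 1)))"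
  have uc: "continuous_map X euclideanreal u" unfolding u_def
    by (intro continuous_map_real_max continuous_map_real_min continuous_map_diff continuous_map_real_mult f(1)) auto
  define Z where "Z = {y \<in> topspace X. f y \<in> {1/3..}}"
  have Z: "closedin X Z" unfolding Z_def by (rule closedin_continuous_map_preimage[OF f(1)]) auto
  have ZU: "Z \<subseteq> U" using f(2) by (force simp: Z_def)
  have u0: "u y = 0" if "y \<in> topspace X - Z" for y
    using that by (auto simp: u_def Z_def)
  define N where "N = {y \<in> topspace X. f y \<in> {2/3<..}}"
  have N: "openin X N" unfolding N_def by (rule openin_continuous_map_preimage[OF f(1)]) auto
  have u1: "u y = 1" if "y \<in> N" for y using that by (auto simp: u_def N_def)
  have xN: "x \<in> N" using f(3) x by (auto simp: N_def)
  show ?thesis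
  proof (rule that[OF \<epsilon>(1) N xN])
    fix \<tau>1 \<tau>2 m \<Phi>
    assume \<tau>: "\<tau>1 \<in> {0..1}" "\<tau>2 \<in> {0..1}" "\<bar>\<tau>1 - \<tau>0\<bar> < \<epsilon>" "\<bar>\<tau>2 - \<tau>0\<bar> < \<epsilon>"
      and m: "continuous_map X (top_of_set {0..1}) m"
      and un: "unrelated X M \<Gamma> x0 (\<lambda>y. \<tau>1 + (\<tau>2 - \<tau>1) * m y) \<Phi>"
    define m' where "m' = (\<lambda>y. max (m y) (u y))"
    have mr: "continuous_map X euclideanreal m" and mI: "\<And>y. y \<in> topspace X \<Longrightarrow> m y \<in> {0..1}"
      using m by (auto simp: continuous_map_in_subtopology)
    have m'I: "m' y \<in> {0..1}" if "y \<in> topspace X" for y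
      using mI[OF that] by (auto simp: m'_def u_def)
    have m'r: "continuous_map X euclideanreal m'"
      unfolding m'_def by (intro continuous_map_real_max mr uc)
    have m'c: "continuous_map X (top_of_set {0..1}) m'"
      using m'r m'I by (auto simp: continuous_map_in_subtopology)
    define \<theta> where "\<theta> = (\<lambda>y. \<tau>1 + (\<tau>2 - \<tau>1) * m y)"
    define \<theta>' where "\<theta>' = (\<lambda>y. \<tau>1 + (\<tau>2 - \<tau>1) * m' y)"
    have \<theta>c: "continuous_map X (top_of_set {0..1}) \<theta>"
      using affine_in_unit[OF \<tau>(1,2)] mI unfolding \<theta>_def
      by (auto simp: continuous_map_in_subtopology intro!: continuous_map_add continuous_map_real_mult mr)
    have \<theta>'c: "continuous_map X (top_of_set {0..1}) \<theta>'"
      using affine_in_unit[OF \<tau>(1,2)] m'I unfolding \<theta>'_def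
      by (auto simp: continuous_map_in_subtopology intro!: continuous_map_add continuous_map_real_mult m'r)
    have small: "\<Gamma> (y, 1, \<theta> y + s * (\<theta>' y - \<theta> y)) \<in> W" if y: "y \<in> U" and s: "s \<in> {0..1}" for y s
    proof -
      define k where "k = m y + (m' y - m y) * s"
      have yX: "y \<in> topspace X" using y UX by auto
      have k: "k \<in> {0..1}" unfolding k_def by (rule affine_in_unit[OF mI[OF yX] m'I[OF yX] s])
      have eq: "\<theta> y + s * (\<theta>' y - \<theta> y) = \<tau>1 + (\<tau>2 - \<tau>1) * k"
        by (simp add: \<theta>_def \<theta>'_def k_def algebra_simps)
      show ?thesis unfolding eq
        by (intro inW y affine_in_unit affine_near \<tau> k)
    qed
    have W0: "\<Gamma> (y, 1, \<theta> y) \<in> W" and W1: "\<Gamma> (y, 1, \<theta>' y) \<in> W" if "y \<in> U" for y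
      using small[OF that, of 0] small[OF that, of 1] by auto
    \<comment> \<open>Twice the displacement of the target: larger than the displacement where the
      target moves, 0 where it rests, and at most 4 because both positions have norm below
      1.\<close>
    define \<rho> where "\<rho> = (\<lambda>y. 2 * dst (\<Gamma> (y, 1, \<theta>' y)) (\<kappa> (\<Gamma> (y, 1, \<theta> y))))"
    have coord: "continuous_map (subtopology X U) euclideanreal (\<lambda>y. \<kappa> (\<Gamma> (y, 1, \<theta> y)) i)"
      "continuous_map (subtopology X U) euclideanreal (\<lambda>y. \<kappa> (\<Gamma> (y, 1, \<theta>' y)) i)" for i
    proof -
      have "continuous_map (subtopology X U) (subtopology M Q) (\<lambda>y. \<Gamma> (y, 1, \<theta> y))"
        "continuous_map (subtopology X U) (subtopology M Q) (\<lambda>y. \<Gamma> (y, 1, \<theta>' y))"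
        using continuous_map_from_subtopology[OF continuous_map_family_end[OF \<Gamma> continuous_map_id[unfolded id_def] \<theta>c]]
          continuous_map_from_subtopology[OF continuous_map_family_end[OF \<Gamma> continuous_map_id[unfolded id_def] \<theta>'c]] W0 W1
        by (auto simp: continuous_map_in_subtopology W_def)
      from this[THEN continuous_map_compose[OF _ continuous_chi_coord]]
      show "continuous_map (subtopology X U) euclideanreal (\<lambda>y. \<kappa> (\<Gamma> (y, 1, \<theta> y)) i)"
        "continuous_map (subtopology X U) euclideanreal (\<lambda>y. \<kappa> (\<Gamma> (y, 1, \<theta>' y)) i)"
        by (simp_all add: o_def)
    qed
    have \<rho>c: "continuous_map (subtopology X U) euclideanreal \<rho>"
      unfolding \<rho>_def by (intro continuous_map_real_mult continuous_map_nrm continuous_map_diff coord) auto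
    have off: "\<theta>' y = \<theta> y" if "y \<in> topspace X - Z" for y
      using u0[OF that] mI[of y] that by (auto simp: \<theta>'_def \<theta>_def m'_def)
    have \<rho>4: "0 \<le> \<rho> y \<and> \<rho> y \<le> 4" if "y \<in> U" for y
      using nrm_diff_le[of n "\<kappa> (\<Gamma> (y, 1, \<theta>' y))" "\<kappa> (\<Gamma> (y, 1, \<theta> y))"] W0[OF that] W1[OF that]
      by (auto simp: \<rho>_def W_def)
    have \<rho>0: "\<rho> y = 0" if "y \<in> U - Z" for y
      using off[of y] that UX by (auto simp: \<rho>_def)
    have \<rho>b: "dst (\<Gamma> (y, 1, \<theta>' y)) (\<kappa> (\<Gamma> (y, 1, \<theta> y))) < \<rho> y \<or>
           dst (\<Gamma> (y, 1, \<theta>' y)) (\<kappa> (\<Gamma> (y, 1, \<theta> y))) = 0 \<and> \<rho> y = 0" for y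
      using nrm_nonneg[of n "\<lambda>i. \<kappa> (\<Gamma> (y, 1, \<theta>' y)) i - \<kappa> (\<Gamma> (y, 1, \<theta> y)) i"] unfolding \<rho>_def by linarith
    have un': "continuous_map (prod_topology X ?I) M \<Phi>"
      "\<And>l. pathin X l \<Longrightarrow> l 0 = x0 \<Longrightarrow>
           \<not> homotopic_rel_endpoints M (\<lambda>t. \<Gamma> (l t, t, \<theta> (l 1))) (\<lambda>t. \<Phi> (l t, t))"
      using un by (auto simp: unrelated_def \<theta>_def)
    have sm: "\<Gamma> (y, 1, \<theta> y + s * (\<theta>' y - \<theta> y)) \<in> Q \<and> nrm n (\<kappa> (\<Gamma> (y, 1, \<theta> y + s * (\<theta>' y - \<theta> y)))) < 1"
      if "y \<in> U" "s \<in> {0..1}" for y s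
      using small[OF that] by (auto simp: W_def)
    obtain \<Phi>' where "continuous_map (prod_topology X ?I) M \<Phi>'" "\<And>x. \<Phi>' (x, 0) = \<Phi> (x, 0)"
       "\<And>l. pathin X l \<Longrightarrow> l 0 = x0 \<Longrightarrow>
         \<not> homotopic_rel_endpoints M (\<lambda>t. \<Gamma> (l t, t, \<theta>' (l 1))) (\<lambda>t. \<Phi>' (l t, t))"
    proof (rule push_step[OF X(3) \<Gamma> un'(1) base \<theta>c \<theta>'c UJ(1) Z ZU off sm \<rho>c \<rho>4 \<rho>0 \<rho>b un'(2)])
      fix \<Phi>'
      assume "continuous_map (prod_topology X ?I) M \<Phi>'" "\<And>x. \<Phi>' (x, 0) = \<Phi> (x, 0)"
       "\<And>l. pathin X l \<Longrightarrow> l 0 = x0 \<Longrightarrow>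
         \<not> homotopic_rel_endpoints M (\<lambda>t. \<Gamma> (l t, t, \<theta>' (l 1))) (\<lambda>t. \<Phi>' (l t, t))"
      then show thesis by (rule that)
    qed
    then have "unrelated X M \<Gamma> x0 \<theta>' \<Phi>' \<and> (\<forall>y. \<Phi>' (y, 0) = \<Phi> (y, 0))"
      by (auto simp: unrelated_def)
    moreover have "m' y = 1" if "y \<in> N" for y
      using u1[OF that] mI[of y] that by (auto simp: m'_def N_def)
    ultimately show "\<exists>m' \<Phi>'. continuous_map X (top_of_set {0..1}) m' \<and> (\<forall>y\<in>topspace X. m y \<le> m' y) \<and>
           (\<forall>y\<in>N. m' y = 1) \<and> unrelated X M \<Gamma> x0 (\<lambda>y. \<tau>1 + (\<tau>2 - \<tau>1) * m' y) \<Phi>' \<and>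
           (\<forall>y. \<Phi>' (y, 0) = \<Phi> (y, 0))"
      using m'c unfolding \<theta>'_def by (intro exI[of _ m'] exI[of _ \<Phi>']) (auto simp: m'_def)
  qed
qed

text \<open>Induction over the connected interval of stages; the local step therefore has to connect
  any two stages near \<open>\<tau>0\<close>, in either order. Finitely many of the sets
  \<open>N\<close> cover \<open>X\<close>, and \<open>m\<close> grows from 0 to 1 by treating them
  one after another. Coincidences unrelated to \<open>x0\<close> may arise on the way.\<close>

lemma push_along_family:
  fixes X :: "'x topology" and \<Gamma> :: "'x \<times> real \<times> real \<Rightarrow> 'm"
  assumes M: "topological_manifold n M"
    and X: "compact_space X" "Hausdorff_space X" "locally_path_connected_space X"
    and \<Gamma>: "continuous_map (prod_topology X (top_of_set ({0..1} \<times> {0..1}))) M \<Gamma>"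
    and base: "\<And>r. r \<in> {0..1} \<Longrightarrow> \<Gamma> (x0, 0, r) = a"
    and \<Phi>: "unrelated X M \<Gamma> x0 (\<lambda>_. 0) \<Phi>"
  obtains \<Phi>' where "unrelated X M \<Gamma> x0 (\<lambda>_. 1) \<Phi>'" "\<And>x. \<Phi>' (x, 0) = \<Phi> (x, 0)"
proof -
  define PP where "PP = (\<lambda>\<theta>. \<exists>\<Phi>'. unrelated X M \<Gamma> x0 \<theta> \<Phi>' \<and> (\<forall>x. \<Phi>' (x, 0) = \<Phi> (x, 0)))"
  have "PP (\<lambda>_. 1)"
  proof (rule connected_induction_simple[where S = "{0..1::real}" and a = 0 and P = "\<lambda>\<tau>. PP (\<lambda>_. \<tau>)"])
    show "PP (\<lambda>_. 0)" using \<Phi> by (auto simp: PP_def)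
    fix \<tau>0 :: real assume \<tau>0: "\<tau>0 \<in> {0..1}"
    define R where "R = (\<lambda>x \<epsilon> N. \<epsilon> > 0 \<and> openin X N \<and> x \<in> N \<and>
        (\<forall>\<tau>1 \<tau>2 m. \<tau>1 \<in> {0..1} \<longrightarrow> \<tau>2 \<in> {0..1} \<longrightarrow> \<bar>\<tau>1 - \<tau>0\<bar> < \<epsilon> \<longrightarrow> \<bar>\<tau>2 - \<tau>0\<bar> < \<epsilon> \<longrightarrow>
          continuous_map X (top_of_set {0..1}) m \<longrightarrow> PP (\<lambda>y. \<tau>1 + (\<tau>2 - \<tau>1) * m y) \<longrightarrow>
          (\<exists>m'. continuous_map X (top_of_set {0..1}) m' \<and> (\<forall>y\<in>topspace X. m y \<le> m' y) \<and>
             (\<forall>y\<in>N. m' y = 1) \<and> PP (\<lambda>y. \<tau>1 + (\<tau>2 - \<tau>1) * m' y))))"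
    have "\<exists>\<epsilon> N. R x \<epsilon> N" if x: "x \<in> topspace X" for x
    proof -
      obtain \<epsilon> N where N: "\<epsilon> > 0" "openin X N" "x \<in> N"
        and step: "\<And>\<tau>1 \<tau>2 m \<Phi>. \<lbrakk>\<tau>1 \<in> {0..1}; \<tau>2 \<in> {0..1}; \<bar>\<tau>1 - \<tau>0\<bar> < \<epsilon>; \<bar>\<tau>2 - \<tau>0\<bar> < \<epsilon>;
          continuous_map X (top_of_set {0..1}) m; unrelated X M \<Gamma> x0 (\<lambda>y. \<tau>1 + (\<tau>2 - \<tau>1) * m y) \<Phi>\<rbrakk>
        \<Longrightarrow> \<exists>m' \<Phi>'. continuous_map X (top_of_set {0..1}) m' \<and> (\<forall>y\<in>topspace X. m y \<le> m' y) \<and>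
           (\<forall>y\<in>N. m' y = 1) \<and> unrelated X M \<Gamma> x0 (\<lambda>y. \<tau>1 + (\<tau>2 - \<tau>1) * m' y) \<Phi>' \<and>
           (\<forall>y. \<Phi>' (y, 0) = \<Phi> (y, 0))"
        by (rule push_near_point[OF M X \<Gamma> base x \<tau>0]) auto
      show ?thesis
      unfolding R_def
      proof (rule exI[of _ \<epsilon>], rule exI[of _ N], intro conjI allI impI)
        fix \<tau>1 \<tau>2 m
        assume a: "\<tau>1 \<in> {0..1}" "\<tau>2 \<in> {0..1}" "\<bar>\<tau>1 - \<tau>0\<bar> < \<epsilon>" "\<bar>\<tau>2 - \<tau>0\<bar> < \<epsilon>"
          "continuous_map X (top_of_set {0..1}) m" "PP (\<lambda>y. \<tau>1 + (\<tau>2 - \<tau>1) * m y)"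
        then obtain \<Psi> where \<Psi>: "unrelated X M \<Gamma> x0 (\<lambda>y. \<tau>1 + (\<tau>2 - \<tau>1) * m y) \<Psi>" "\<forall>x. \<Psi> (x, 0) = \<Phi> (x, 0)"
          by (auto simp: PP_def)
        obtain m' \<Phi>' where "continuous_map X (top_of_set {0..1}) m'" "\<forall>y\<in>topspace X. m y \<le> m' y"
             "\<forall>y\<in>N. m' y = 1" "unrelated X M \<Gamma> x0 (\<lambda>y. \<tau>1 + (\<tau>2 - \<tau>1) * m' y) \<Phi>'" "\<forall>y. \<Phi>' (y, 0) = \<Psi> (y, 0)"
          using step[OF a(1-5) \<Psi>(1)] by blast
        with \<Psi>(2) show "\<exists>m'. continuous_map X (top_of_set {0..1}) m' \<and> (\<forall>y\<in>topspace X. m y \<le> m' y) \<and>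
             (\<forall>y\<in>N. m' y = 1) \<and> PP (\<lambda>y. \<tau>1 + (\<tau>2 - \<tau>1) * m' y)"
          unfolding PP_def by auto
      qed (use N in auto)
    qed
    then obtain \<epsilon> N where R: "\<And>x. x \<in> topspace X \<Longrightarrow> R x (\<epsilon> x) (N x)"
      by metis
    have N: "\<epsilon> x > 0" "openin X (N x)" "x \<in> N x" if "x \<in> topspace X" for x
      using R[OF that] by (auto simp: R_def)
    have step: "\<exists>m'. continuous_map X (top_of_set {0..1}) m' \<and> (\<forall>y\<in>topspace X. m y \<le> m' y) \<and>
             (\<forall>y\<in>N x. m' y = 1) \<and> PP (\<lambda>y. \<tau>1 + (\<tau>2 - \<tau>1) * m' y)"
      if "x \<in> topspace X" "\<tau>1 \<in> {0..1}" "\<tau>2 \<in> {0..1}" "\<bar>\<tau>1 - \<tau>0\<bar> < \<epsilon> x" "\<bar>\<tau>2 - \<tau>0\<bar> < \<epsilon> x"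
          "continuous_map X (top_of_set {0..1}) m" "PP (\<lambda>y. \<tau>1 + (\<tau>2 - \<tau>1) * m y)" for x \<tau>1 \<tau>2 m
      using R[OF that(1), unfolded R_def] that by blast
    have "\<exists>\<F>. finite \<F> \<and> \<F> \<subseteq> N ` topspace X \<and> topspace X \<subseteq> \<Union>\<F>"
      using X(1)[unfolded compact_space_alt, rule_format, of "N ` topspace X"] N(2,3) by blast
    then obtain \<F> where \<F>: "finite \<F>" "\<F> \<subseteq> N ` topspace X" "topspace X \<subseteq> \<Union>\<F>" by blast
    obtain S where S: "finite S" "S \<subseteq> topspace X" "topspace X \<subseteq> (\<Union>x\<in>S. N x)"
      using finite_subset_image[OF \<F>(1,2)] \<F>(3) by blast
    \<comment> \<open>The element 1 keeps the minimum meaningful if \<open>S\<close> is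
      empty.\<close>
    define \<epsilon>0 where "\<epsilon>0 = Min (insert 1 (\<epsilon> ` S))"
    have \<epsilon>0: "\<epsilon>0 > 0" "\<And>x. x \<in> S \<Longrightarrow> \<epsilon>0 \<le> \<epsilon> x"
      using S N by (auto simp: \<epsilon>0_def)
    have near: "PP (\<lambda>_. \<tau>2)" if \<tau>: "\<tau>1 \<in> {0..1}" "\<tau>2 \<in> {0..1}" "\<bar>\<tau>1 - \<tau>0\<bar> < \<epsilon>0" "\<bar>\<tau>2 - \<tau>0\<bar> < \<epsilon>0"
      and "PP (\<lambda>_. \<tau>1)" for \<tau>1 \<tau>2
    proof -
      have "\<exists>m. continuous_map X (top_of_set {0..1}) m \<and> (\<forall>y\<in>topspace X. y \<in> (\<Union>x\<in>S'. N x) \<longrightarrow> m y = 1) \<and>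
          PP (\<lambda>y. \<tau>1 + (\<tau>2 - \<tau>1) * m y)" if "finite S'" "S' \<subseteq> S" for S'
        using that
      proof (induction S' rule: finite_induct)
        case empty
        then show ?case using \<open>PP (\<lambda>_. \<tau>1)\<close> by (intro exI[of _ "\<lambda>_. 0"]) auto
      next
        case (insert x S')
        then obtain m where m: "continuous_map X (top_of_set {0..1}) m"
           "\<forall>y\<in>topspace X. y \<in> (\<Union>x\<in>S'. N x) \<longrightarrow> m y = 1" "PP (\<lambda>y. \<tau>1 + (\<tau>2 - \<tau>1) * m y)" by blast
        have xS: "x \<in> topspace X" "\<epsilon>0 \<le> \<epsilon> x" using insert.prems S(2) \<epsilon>0(2) by auto
        obtain m' where m': "continuous_map X (top_of_set {0..1}) m'" "\<forall>y\<in>topspace X. m y \<le> m' y"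
             "\<forall>y\<in>N x. m' y = 1" "PP (\<lambda>y. \<tau>1 + (\<tau>2 - \<tau>1) * m' y)"
          using step[OF xS(1) \<tau>(1,2) _ _ m(1,3)] \<tau>(3,4) xS(2) by force
        have "m' y \<le> 1" if "y \<in> topspace X" for y
          using m'(1) that by (auto simp: continuous_map_in_subtopology Pi_iff)
        then have "m' y = 1" if "y \<in> topspace X" "y \<in> (\<Union>x\<in>insert x S'. N x)" for y
          using that m(2) m'(2,3) by (force intro: antisym)
        then show ?case using m' by blast
      qed
      from this[OF S(1) order_refl] obtain m where m: "\<forall>y\<in>topspace X. m y = 1" "PP (\<lambda>y. \<tau>1 + (\<tau>2 - \<tau>1) * m y)"
        using S(3) by blast
      then obtain \<Phi>' where \<Phi>': "unrelated X M \<Gamma> x0 (\<lambda>y. \<tau>1 + (\<tau>2 - \<tau>1) * m y) \<Phi>'" "\<forall>x. \<Phi>' (x, 0) = \<Phi> (x, 0)"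
        by (auto simp: PP_def)
      have "unrelated X M \<Gamma> x0 (\<lambda>_. \<tau>2) \<Phi>'"
        by (rule unrelated_cong[OF \<Phi>'(1)]) (simp add: m(1))
      then show ?thesis
        using \<Phi>'(2) by (auto simp: PP_def)
    qed
    have *: "PP (\<lambda>_. \<tau>2)" if "\<tau>1 \<in> {0..1} \<inter> {\<tau>0 - \<epsilon>0<..<\<tau>0 + \<epsilon>0}"
        "\<tau>2 \<in> {0..1} \<inter> {\<tau>0 - \<epsilon>0<..<\<tau>0 + \<epsilon>0}" "PP (\<lambda>_. \<tau>1)" for \<tau>1 \<tau>2
      by (rule near[OF _ _ _ _ that(3)]) (use that(1,2) in \<open>auto simp: abs_diff_less_iff\<close>)
    have "openin (top_of_set {0..1}) ({0..1} \<inter> {\<tau>0 - \<epsilon>0<..<\<tau>0 + \<epsilon>0})"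
      by (intro openin_open_Int open_greaterThanLessThan)
    moreover have "\<tau>0 \<in> {0..1} \<inter> {\<tau>0 - \<epsilon>0<..<\<tau>0 + \<epsilon>0}" using \<epsilon>0(1) \<tau>0 by simp
    ultimately show "\<exists>T. openin (top_of_set {0..1}) T \<and> \<tau>0 \<in> T \<and> (\<forall>x\<in>T. \<forall>y\<in>T. PP (\<lambda>_. x) \<longrightarrow> PP (\<lambda>_. y))"
      using * by blast
  qed auto
  then show ?thesis using that by (auto simp: PP_def)
qed

section \<open>Roots\<close>

text \<open>The form of \<open>unrelated\<close> for a target track \<open>\<gamma>\<close> that is
  the same for all paths: the root class with label \<open>\<gamma>\<close>, seen from
  \<open>x0\<close>, is empty.\<close>

definition misses :: "'x topology \<Rightarrow> 'm topology \<Rightarrow> 'x \<Rightarrow> (real \<Rightarrow> 'm) \<Rightarrow> ('x \<times> real \<Rightarrow> 'm) \<Rightarrow> bool" where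
  "misses X M x0 \<gamma> \<Phi> \<longleftrightarrow>
     (\<forall>l. pathin X l \<and> l 0 = x0 \<longrightarrow> \<not> homotopic_rel_endpoints M \<gamma> (\<lambda>t. \<Phi> (l t, t)))"

text \<open>The relation under which deletions accumulate: roots may disappear, none is created, and
  each survivor keeps its labels.\<close>

definition refines :: "'x topology \<Rightarrow> 'm topology \<Rightarrow> 'm \<Rightarrow> ('x \<times> real \<Rightarrow> 'm) \<Rightarrow> ('x \<times> real \<Rightarrow> 'm) \<Rightarrow> bool" where
  "refines X M a \<Phi>' \<Phi> \<longleftrightarrow>
     continuous_map (prod_topology X (top_of_set {0..1})) M \<Phi>' \<and> (\<forall>x. \<Phi>' (x, 0) = \<Phi> (x, 0)) \<and>
     (\<forall>x\<in>topspace X. \<Phi>' (x, 1) = a \<longrightarrow> \<Phi> (x, 1) = a \<and>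
        (\<forall>l. pathin X l \<and> l 1 = x \<longrightarrow> homotopic_rel_endpoints M (\<lambda>t. \<Phi>' (l t, t)) (\<lambda>t. \<Phi> (l t, t))))"

lemma refines_refl:
  "continuous_map (prod_topology X (top_of_set {0..1})) M \<Phi> \<Longrightarrow> refines X M a \<Phi> \<Phi>"
  by (auto simp: refines_def intro: homotopic_rel_endpoints_refl pathin_diag)

lemma refines_trans:
  assumes "refines X M a \<Phi>'' \<Phi>'" "refines X M a \<Phi>' \<Phi>"
  shows "refines X M a \<Phi>'' \<Phi>"
  unfolding refines_def
proof (intro conjI ballI impI allI)
  show "continuous_map (prod_topology X (top_of_set {0..1})) M \<Phi>''" "\<Phi>'' (x, 0) = \<Phi> (x, 0)" for x
    using assms by (auto simp: refines_def)
  fix x assume x: "x \<in> topspace X" "\<Phi>'' (x, 1) = a"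
  have 1: "\<Phi>' (x, 1) = a" using assms(1) x by (simp add: refines_def)
  then show "\<Phi> (x, 1) = a" using assms(2) x by (simp add: refines_def)
  fix l assume l: "pathin X l \<and> l 1 = x"
  have "homotopic_rel_endpoints M (\<lambda>t. \<Phi>'' (l t, t)) (\<lambda>t. \<Phi>' (l t, t))"
    using assms(1) x l by (simp add: refines_def)
  also have "homotopic_rel_endpoints M \<dots> (\<lambda>t. \<Phi> (l t, t))"
    using assms(2) x 1 l by (simp add: refines_def)
  finally show "homotopic_rel_endpoints M (\<lambda>t. \<Phi>'' (l t, t)) (\<lambda>t. \<Phi> (l t, t))" .
qed

lemma pathin_end_in: "pathin X l \<Longrightarrow> l 1 \<in> topspace X"
  by (auto simp: pathin_def continuous_map_def Pi_iff)

text \<open>A path realizing \<open>\<gamma>\<close> along \<open>\<Phi>'\<close> would end at a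
  root, as \<open>\<gamma> 1 = a\<close>, and at surviving roots the labels along
  \<open>\<Phi>'\<close> and \<open>\<Phi>\<close> agree.\<close>

lemma misses_refines:
  assumes "refines X M a \<Phi>' \<Phi>" "misses X M x0 \<gamma> \<Phi>" "\<gamma> 1 = a"
  shows "misses X M x0 \<gamma> \<Phi>'"
  unfolding misses_def
proof (intro allI impI notI)
  fix l assume l: "pathin X l \<and> l 0 = x0" and h: "homotopic_rel_endpoints M \<gamma> (\<lambda>t. \<Phi>' (l t, t))"
  have "\<Phi>' (l 1, 1) = a" using homotopic_rel_endpoints_imp(4)[OF h] assms(3) by simp
  then have "homotopic_rel_endpoints M (\<lambda>t. \<Phi>' (l t, t)) (\<lambda>t. \<Phi> (l t, t))"
    using assms(1) l pathin_end_in[of X l] by (simp add: refines_def)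
  from homotopic_rel_endpoints_trans[OF h this] show False
    using assms(2) l by (auto simp: misses_def)
qed

text \<open>At stage \<open>r\<close> the target runs along \<open>\<gamma>\<close> only up to time
  \<open>r\<close>. Stage 0 is the constant target, whose class is empty by \<open>missing\<close>,
  and stage 1 is \<open>\<gamma>\<close>. This target does not depend on the point of
  \<open>X\<close>, so each step pushes over all of \<open>X\<close> at once with a constant
  radius.\<close>

lemma push_along_loop:
  fixes X :: "'x topology"
  assumes M: "topological_manifold n M" and X: "locally_path_connected_space X"
    and \<Phi>: "continuous_map (prod_topology X (top_of_set {0..1})) M \<Phi>"
    and \<gamma>: "pathin M \<gamma>" "\<gamma> 0 = a" and missing: "misses X M x0 (\<lambda>_. a) \<Phi>"
  obtains \<Phi>' where "refines X M a \<Phi>' \<Phi>" "misses X M x0 \<gamma> \<Phi>'"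
proof -
  let ?I = "top_of_set {0..1::real}"
  define \<Gamma> where "\<Gamma> = (\<lambda>(x :: 'x, t :: real, r). \<gamma> (t * r))"
  have "continuous_map (prod_topology X (top_of_set ({0..1} \<times> {0..1}))) (top_of_set ({0..1} \<times> {0..1::real})) snd"
    by (rule continuous_map_snd)
  moreover have "continuous_map (top_of_set ({0..1} \<times> {0..1::real})) ?I (\<lambda>z. fst z * snd z)"
    by (auto simp: continuous_map_in_subtopology mult_le_one intro!: continuous_intros)
  ultimately have "continuous_map (prod_topology X (top_of_set ({0..1} \<times> {0..1}))) ?I ((\<lambda>z. fst z * snd z) \<circ> snd)"
    by (rule continuous_map_compose)
  from continuous_map_compose[OF this \<gamma>(1)[unfolded pathin_def]]
  have \<Gamma>: "continuous_map (prod_topology X (top_of_set ({0..1} \<times> {0..1}))) M \<Gamma>"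
    by (simp add: \<Gamma>_def o_def case_prod_unfold)
  have base: "\<Gamma> (x0, 0, r) = a" for r by (simp add: \<Gamma>_def \<gamma>)
  define PP where "PP = (\<lambda>\<tau>. \<exists>\<Phi>'. refines X M a \<Phi>' \<Phi> \<and> misses X M x0 (\<lambda>t. \<gamma> (t * \<tau>)) \<Phi>')"
  have "PP 1"
  proof (rule connected_induction_simple[where S = "{0..1::real}" and a = 0 and P = PP])
    show "PP 0" using missing refines_refl[OF \<Phi>] by (auto simp: PP_def \<gamma>(2))
    fix \<tau>0 :: real assume \<tau>0: "\<tau>0 \<in> {0..1}"
    have "\<gamma> \<tau>0 \<in> topspace M"
      using \<gamma>(1) \<tau>0 by (auto simp: pathin_def continuous_map_def Pi_iff)
    then obtain Q e \<kappa> where cb: "chart_ball M n Q e \<kappa>" and c0: "\<gamma> \<tau>0 \<in> Q" "\<kappa> (\<gamma> \<tau>0) = (\<lambda>_. 0)"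
      using chart_ball_exists[OF M] by blast
    interpret chart_ball M n Q e \<kappa> by (fact cb)
    define W where "W = {z \<in> Q. nrm n (\<kappa> z) < 1}"
    have W: "openin M W" unfolding W_def by (rule openin_ball)
    have "openin ?I {r \<in> topspace ?I. \<gamma> r \<in> W}"
      by (rule openin_continuous_map_preimage[OF \<gamma>(1)[unfolded pathin_def] W])
    moreover have "\<tau>0 \<in> {r \<in> topspace ?I. \<gamma> r \<in> W}" using \<tau>0 c0 by (auto simp: W_def)
    ultimately obtain \<epsilon> where \<epsilon>: "\<epsilon> > 0" "\<And>r. r \<in> {0..1} \<Longrightarrow> \<bar>r - \<tau>0\<bar> < \<epsilon> \<Longrightarrow> \<gamma> r \<in> W"
      unfolding openin_euclidean_subtopology_iff by (auto simp: dist_real_def)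
    have near: "PP \<tau>2" if \<tau>: "\<tau>1 \<in> {0..1}" "\<tau>2 \<in> {0..1}" "\<bar>\<tau>1 - \<tau>0\<bar> < \<epsilon>" "\<bar>\<tau>2 - \<tau>0\<bar> < \<epsilon>" and "PP \<tau>1" for \<tau>1 \<tau>2
    proof -
      obtain \<Psi> where \<Psi>: "refines X M a \<Psi> \<Phi>" "misses X M x0 (\<lambda>t. \<gamma> (t * \<tau>1)) \<Psi>"
        using \<open>PP \<tau>1\<close> by (auto simp: PP_def)
      have \<Psi>c: "continuous_map (prod_topology X ?I) M \<Psi>" using \<Psi>(1) by (simp add: refines_def)
      have small: "\<gamma> (\<tau>1 + s * (\<tau>2 - \<tau>1)) \<in> W" if s: "s \<in> {0..1}" for s
      proof (rule \<epsilon>(2))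
        show "\<tau>1 + s * (\<tau>2 - \<tau>1) \<in> {0..1}"
          using convexD[of "{0..1::real}" \<tau>1 \<tau>2 "1 - s" s] \<tau> s by (simp add: algebra_simps)
        show "\<bar>\<tau>1 + s * (\<tau>2 - \<tau>1) - \<tau>0\<bar> < \<epsilon>"
          using convexD[of "{\<tau>0-\<epsilon><..<\<tau>0+\<epsilon>}" \<tau>1 \<tau>2 "1 - s" s] \<tau> s by (auto simp: algebra_simps abs_less_iff)
      qed
      \<comment> \<open>Of two spheres about the old target at least one misses \<open>a\<close>, so
        pushed points never become roots. Both radii exceed the displacement, which is below 2. For
        \<open>a\<close> outside \<open>Q\<close> the coordinates \<open>\<kappa> a\<close> are
        arbitrary, but the choice works for any value.\<close>
      obtain \<rho> :: real where \<rho>: "\<rho> \<in> {3, 4}" "dst a (\<kappa> (\<gamma> \<tau>1)) \<noteq> \<rho>"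
        by (cases "dst a (\<kappa> (\<gamma> \<tau>1)) = 3") auto
      have W12: "\<gamma> \<tau>1 \<in> W" "\<gamma> \<tau>2 \<in> W" using small[of 0] small[of 1] by auto
      have d2: "dst (\<gamma> \<tau>2) (\<kappa> (\<gamma> \<tau>1)) < \<rho>"
        using nrm_diff_le[of n "\<kappa> (\<gamma> \<tau>2)" "\<kappa> (\<gamma> \<tau>1)"] W12 \<rho>(1) by (auto simp: W_def)
      obtain \<Phi>' where \<Phi>': "continuous_map (prod_topology X ?I) M \<Phi>'" "\<And>x. \<Phi>' (x, 0) = \<Psi> (x, 0)"
        "\<And>l. pathin X l \<Longrightarrow> l 0 = x0 \<Longrightarrow> \<not> homotopic_rel_endpoints M (\<lambda>t. \<Gamma> (l t, t, \<tau>2)) (\<lambda>t. \<Phi>' (l t, t))"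
        "\<And>x. x \<in> topspace X \<Longrightarrow>
          \<Phi>' (x, 1) = \<Psi> (x, 1) \<and>
            (\<forall>l. pathin X l \<and> l 1 = x \<longrightarrow> homotopic_rel_endpoints M (\<lambda>t. \<Phi>' (l t, t)) (\<lambda>t. \<Psi> (l t, t))) \<or>
          x \<in> topspace X \<and> \<Phi>' (x, 1) \<in> Q \<and> dst (\<Phi>' (x, 1)) (\<kappa> (\<Gamma> (x, 1, \<tau>1))) = \<rho>"
      proof (rule push_step[OF X \<Gamma> \<Psi>c base, where U = "topspace X" and Z = "topspace X"
            and \<theta> = "\<lambda>_. \<tau>1" and \<theta>' = "\<lambda>_. \<tau>2" and \<rho> = "\<lambda>_. \<rho>"])
        show "\<Gamma> (x, 1, \<tau>1 + s * (\<tau>2 - \<tau>1)) \<in> Q \<and> nrm n (\<kappa> (\<Gamma> (x, 1, \<tau>1 + s * (\<tau>2 - \<tau>1)))) < 1"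
          if "s \<in> {0..1}" for x s
          using small[OF that] by (simp add: \<Gamma>_def W_def)
        show "dst (\<Gamma> (x, 1, \<tau>2)) (\<kappa> (\<Gamma> (x, 1, \<tau>1))) < \<rho> \<or>
           dst (\<Gamma> (x, 1, \<tau>2)) (\<kappa> (\<Gamma> (x, 1, \<tau>1))) = 0 \<and> \<rho> = 0" for x
          using d2 by (simp add: \<Gamma>_def)
        show "\<not> homotopic_rel_endpoints M (\<lambda>t. \<Gamma> (l t, t, \<tau>1)) (\<lambda>t. \<Psi> (l t, t))"
          if "pathin X l" "l 0 = x0" for l
          using \<Psi>(2) that by (simp add: misses_def \<Gamma>_def)
      qed (use \<tau> \<rho> in auto)
      have "refines X M a \<Phi>' \<Psi>"
        unfolding refines_def
      proof (intro conjI ballI impI)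
        fix x assume x: "x \<in> topspace X" "\<Phi>' (x, 1) = a"
        have "\<not> (x \<in> topspace X \<and> \<Phi>' (x, 1) \<in> Q \<and> dst (\<Phi>' (x, 1)) (\<kappa> (\<Gamma> (x, 1, \<tau>1))) = \<rho>)"
          using \<rho>(2) x(2) by (simp add: \<Gamma>_def)
        then show "\<Psi> (x, 1) = a" "\<forall>l. pathin X l \<and> l 1 = x \<longrightarrow>
            homotopic_rel_endpoints M (\<lambda>t. \<Phi>' (l t, t)) (\<lambda>t. \<Psi> (l t, t))"
          using \<Phi>'(4)[OF x(1)] x(2) by auto
      qed (use \<Phi>' in auto)
      then have "refines X M a \<Phi>' \<Phi>" using \<Psi>(1) by (rule refines_trans)
      moreover have "misses X M x0 (\<lambda>t. \<gamma> (t * \<tau>2)) \<Phi>'"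
        using \<Phi>'(3) by (simp add: misses_def \<Gamma>_def)
      ultimately show ?thesis by (auto simp: PP_def)
    qed
    have *: "PP \<tau>2" if "\<tau>1 \<in> {0..1} \<inter> {\<tau>0 - \<epsilon><..<\<tau>0 + \<epsilon>}"
        "\<tau>2 \<in> {0..1} \<inter> {\<tau>0 - \<epsilon><..<\<tau>0 + \<epsilon>}" "PP \<tau>1" for \<tau>1 \<tau>2
      by (rule near[OF _ _ _ _ that(3)]) (use that(1,2) in \<open>auto simp: abs_diff_less_iff\<close>)
    have "openin (top_of_set {0..1}) ({0..1} \<inter> {\<tau>0 - \<epsilon><..<\<tau>0 + \<epsilon>})"
      by (intro openin_open_Int open_greaterThanLessThan)
    moreover have "\<tau>0 \<in> {0..1} \<inter> {\<tau>0 - \<epsilon><..<\<tau>0 + \<epsilon>}" using \<epsilon>(1) \<tau>0 by simp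
    ultimately show "\<exists>T. openin (top_of_set {0..1}) T \<and> \<tau>0 \<in> T \<and> (\<forall>x\<in>T. \<forall>y\<in>T. PP x \<longrightarrow> PP y)"
      using * by blast
  qed auto
  then show ?thesis using that by (auto simp: PP_def)
qed

text \<open>Near a root joined to \<open>x0\<close>, a path-connected neighbourhood mapped into
  \<open>Q\<close> works: going on from \<open>x\<close> to another root adds to the label a loop in
  \<open>Q\<close>, which is null homotopic. Every other point has a neighbourhood without roots of
  the component of \<open>x0\<close>, and there the constant loop is a dummy label.\<close>

lemma root_labels_locally_finite:
  fixes X :: "'x topology"
  assumes M: "topological_manifold n M" and X: "locally_path_connected_space X"
    and \<Phi>: "continuous_map (prod_topology X (top_of_set {0..1})) M \<Phi>"
    and a: "a \<in> topspace M" "\<Phi> (x0, 0) = a" and x: "x \<in> topspace X"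
  obtains N \<gamma> where "openin X N" "x \<in> N" "pathin M \<gamma>" "\<gamma> 0 = a" "\<gamma> 1 = a"
    "\<And>y. y \<in> N \<Longrightarrow> \<Phi> (y, 1) = a \<Longrightarrow> path_component_of X x0 y \<Longrightarrow>
       \<exists>l. pathin X l \<and> l 0 = x0 \<and> l 1 = y \<and> homotopic_rel_endpoints M \<gamma> (\<lambda>t. \<Phi> (l t, t))"
proof -
  define \<psi> where "\<psi> = (\<lambda>x. \<Phi> (x, 1))"
  have \<psi>c: "continuous_map X M \<psi>"
  proof -
    have "continuous_map X (prod_topology X (top_of_set {0..1})) (\<lambda>x. (x, 1::real))"
      by (auto simp: continuous_map_paired)
    from continuous_map_compose[OF this \<Phi>] show ?thesis by (simp add: \<psi>_def o_def)
  qed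
  have const: "pathin M (\<lambda>_. a)" using a(1) by (simp add: pathin_def)
  have lpc: "\<exists>N. openin X N \<and> path_connectedin X N \<and> x \<in> N \<and> N \<subseteq> V" if "openin X V" "x \<in> V" for V
    using X that unfolding locally_path_connected_space by blast
  consider "\<psi> x \<noteq> a" | "\<psi> x = a" "\<not> path_component_of X x0 x" | "\<psi> x = a" "path_component_of X x0 x" by blast
  then show ?thesis
  proof cases
    case 1
    have "Hausdorff_space M" using M by (simp add: topological_manifold_def)
    then have "openin M (topspace M - {a})" using a(1) by (simp add: closedin_Hausdorff_singleton openin_diff)
    from openin_continuous_map_preimage[OF \<psi>c this]
    show ?thesis
      by (rule that[OF _ _ const]) (use 1 x continuous_map_funspace[OF \<psi>c] in \<open>auto simp: \<psi>_def\<close>)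
  next
    case 2
    obtain N where N: "openin X N" "path_connectedin X N" "x \<in> N" using lpc[of "topspace X"] x by auto
    have "\<not> path_component_of X x0 y" if "y \<in> N" for y
    proof -
      have "path_component_of X y x" unfolding path_component_of[of X y x] using N(2,3) that by blast
      then show ?thesis using path_component_of_trans[of X x0 y x] 2(2) by blast
    qed
    then show ?thesis using that[OF N(1,3) const] by simp
  next
    case 3
    obtain l where l: "pathin X l" "l 0 = x0" "l 1 = x" using 3(2) by (auto simp: path_component_of_def)
    obtain Q e \<kappa> where cb: "chart_ball M n Q e \<kappa>" and aQ: "a \<in> Q"
      using chart_ball_exists[OF M a(1)] by blast
    interpret chart_ball M n Q e \<kappa> by (fact cb)
    have "openin X {y \<in> topspace X. \<psi> y \<in> Q}"
      by (rule openin_continuous_map_preimage[OF \<psi>c openQ])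
    then obtain N where N: "openin X N" "path_connectedin X N" "x \<in> N" "N \<subseteq> {y \<in> topspace X. \<psi> y \<in> Q}"
      using lpc[of "{y \<in> topspace X. \<psi> y \<in> Q}"] x 3(1) aQ by auto
    let ?\<gamma> = "\<lambda>t. \<Phi> (l t, t)"
    have \<gamma>: "pathin M ?\<gamma>" by (rule pathin_diag[OF \<Phi> l(1)])
    show ?thesis
    proof (rule that[OF N(1,3) \<gamma>])
      show "?\<gamma> 0 = a" "?\<gamma> 1 = a" using l a 3(1) by (auto simp: \<psi>_def)
      fix y assume y: "y \<in> N" "\<Phi> (y, 1) = a"
      have "path_component_of (subtopology X N) x y"
        using N(2,3) y(1) path_connected_space_imp_path_component_of[of "subtopology X N" x y]
        by (auto simp: path_connectedin_def)
      then obtain u where u: "pathin (subtopology X N) u" "u 0 = x" "u 1 = y"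
        unfolding path_component_of_def by blast
      then have uX: "pathin X u" "\<And>s. s \<in> {0..1} \<Longrightarrow> u s \<in> N"
        by (auto simp: pathin_def continuous_map_in_subtopology)
      have lu: "l 1 = u 0" using l u by simp
      have c1: "pathin (subtopology M Q) (\<lambda>s. \<psi> (u s))"
        using continuous_map_compose[OF uX(1)[unfolded pathin_def] \<psi>c] subsetD[OF N(4) uX(2)]
        by (auto simp: pathin_def continuous_map_in_subtopology o_def)
      have c2: "pathin (subtopology M Q) (\<lambda>_. a)" using aQ a(1) by (simp add: pathin_def)
      have e0: "a = \<psi> (u 0)" using u(2) 3(1) by simp
      have e1: "a = \<psi> (u 1)" using u(3) y(2) by (simp add: \<psi>_def)
      have loop: "homotopic_rel_endpoints M (\<lambda>_. a) (\<lambda>s. \<Phi> (u s, 1))"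
        using paths_homotopic[OF c2 c1 e0 e1] unfolding \<psi>_def .
      have "homotopic_rel_endpoints M ?\<gamma> (pjoin ?\<gamma> (\<lambda>_. a))"
        by (rule homotopic_rel_endpoints_sym, rule pjoin_const_right[OF \<gamma>]) (use l 3(1) in \<open>simp add: \<psi>_def\<close>)
      also have "homotopic_rel_endpoints M \<dots> (pjoin ?\<gamma> (\<lambda>s. \<Phi> (u s, 1)))"
        by (rule homotopic_rel_endpoints_pjoin[OF homotopic_rel_endpoints_refl[OF \<gamma>] loop])
           (use l 3(1) in \<open>simp add: \<psi>_def\<close>)
      also have "homotopic_rel_endpoints M \<dots> (\<lambda>t. \<Phi> (pjoin l u t, t))"
        by (rule homotopic_rel_endpoints_sym, rule diag_pjoin[OF \<Phi> l(1) uX(1) lu])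
      finally show "\<exists>l'. pathin X l' \<and> l' 0 = x0 \<and> l' 1 = y \<and> homotopic_rel_endpoints M ?\<gamma> (\<lambda>t. \<Phi> (l' t, t))"
        using pathin_pjoin[OF l(1) uX(1) lu] l(2) u(3) by (intro exI[of _ "pjoin l u"]) simp
    qed
  qed
qed

text \<open>Each deletion starts from the empty class of the constant label, which
  \<open>misses_refines\<close> keeps empty, so the target can set out from \<open>a\<close> afresh
  for every label of the finite list. A root left at the end would already be a root of
  \<open>\<Phi>\<close>, with a label from the list that has not changed but has been
  deleted.\<close>

lemma remove_roots_of_component:
  fixes X :: "'x topology"
  assumes M: "topological_manifold n M" and X: "compact_space X" "locally_path_connected_space X"
    and \<Phi>: "continuous_map (prod_topology X (top_of_set {0..1})) M \<Phi>"
    and a: "a \<in> topspace M" "\<Phi> (x0, 0) = a" and missing: "misses X M x0 (\<lambda>_. a) \<Phi>"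
  obtains \<Phi>' where "continuous_map (prod_topology X (top_of_set {0..1::real})) M \<Phi>'"
    "\<And>x. \<Phi>' (x, 0) = \<Phi> (x, 0)" "\<And>x. path_component_of X x0 x \<Longrightarrow> \<Phi>' (x, 1) \<noteq> a"
proof -
  define R where "R = (\<lambda>x N \<gamma>. openin X N \<and> x \<in> N \<and> pathin M \<gamma> \<and> \<gamma> 0 = a \<and> \<gamma> 1 = a \<and>
    (\<forall>y. y \<in> N \<longrightarrow> \<Phi> (y, 1) = a \<longrightarrow> path_component_of X x0 y \<longrightarrow>
       (\<exists>l. pathin X l \<and> l 0 = x0 \<and> l 1 = y \<and> homotopic_rel_endpoints M \<gamma> (\<lambda>t. \<Phi> (l t, t)))))"
  have "\<exists>N \<gamma>. R x N \<gamma>" if x: "x \<in> topspace X" for x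
    by (rule root_labels_locally_finite[OF M X(2) \<Phi> a x]) (auto simp: R_def)
  then obtain N \<gamma> where R: "\<And>x. x \<in> topspace X \<Longrightarrow> R x (N x) (\<gamma> x)" by metis
  have N: "openin X (N x)" "x \<in> N x" "pathin M (\<gamma> x)" "\<gamma> x 0 = a" "\<gamma> x 1 = a" if "x \<in> topspace X" for x
    using R[OF that] by (auto simp: R_def)
  have "\<exists>\<F>. finite \<F> \<and> \<F> \<subseteq> N ` topspace X \<and> topspace X \<subseteq> \<Union>\<F>"
    using X(1)[unfolded compact_space_alt, rule_format, of "N ` topspace X"] N by blast
  then obtain \<F> where \<F>: "finite \<F>" "\<F> \<subseteq> N ` topspace X" "topspace X \<subseteq> \<Union>\<F>" by blast
  obtain S where S: "finite S" "S \<subseteq> topspace X" "topspace X \<subseteq> (\<Union>x\<in>S. N x)"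
    using finite_subset_image[OF \<F>(1,2)] \<F>(3) by blast
  have "\<exists>\<Phi>'. refines X M a \<Phi>' \<Phi> \<and> (\<forall>x\<in>S'. misses X M x0 (\<gamma> x) \<Phi>')" if "finite S'" "S' \<subseteq> S" for S'
    using that
  proof (induction S' rule: finite_induct)
    case empty
    then show ?case using refines_refl[OF \<Phi>] by blast
  next
    case (insert x S')
    then obtain \<Psi> where \<Psi>: "refines X M a \<Psi> \<Phi>" "\<forall>x\<in>S'. misses X M x0 (\<gamma> x) \<Psi>" by blast
    have xX: "x \<in> topspace X" "S' \<subseteq> topspace X" using insert.prems S(2) by auto
    have "misses X M x0 (\<lambda>_. a) \<Psi>" by (rule misses_refines[OF \<Psi>(1) missing]) simp
    moreover have "continuous_map (prod_topology X (top_of_set {0..1})) M \<Psi>" using \<Psi>(1) by (simp add: refines_def)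
    ultimately obtain \<Phi>' where \<Phi>': "refines X M a \<Phi>' \<Psi>" "misses X M x0 (\<gamma> x) \<Phi>'"
      using push_along_loop[OF M X(2) _ N(3,4)[OF xX(1)]] by blast
    have "misses X M x0 (\<gamma> y) \<Phi>'" if "y \<in> S'" for y
      using misses_refines[OF \<Phi>'(1)] \<Psi>(2) that N(5) xX(2) by blast
    then show ?case using \<Phi>' refines_trans[OF \<Phi>'(1) \<Psi>(1)] by blast
  qed
  from this[OF S(1) order_refl] obtain \<Phi>' where \<Phi>': "refines X M a \<Phi>' \<Phi>" "\<forall>x\<in>S. misses X M x0 (\<gamma> x) \<Phi>'"
    by blast
  have ne: "\<Phi>' (y, 1) \<noteq> a" if y: "path_component_of X x0 y" for y
  proof
    assume 1: "\<Phi>' (y, 1) = a"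
    have yX: "y \<in> topspace X" using y path_component_in_topspace by metis
    then obtain x where x: "x \<in> S" "y \<in> N x" using S(3) by blast
    have "\<Phi> (y, 1) = a" using \<Phi>'(1) yX 1 by (simp add: refines_def)
    then obtain l where l: "pathin X l" "l 0 = x0" "l 1 = y" "homotopic_rel_endpoints M (\<gamma> x) (\<lambda>t. \<Phi> (l t, t))"
      using R[of x] x S(2) y unfolding R_def by blast
    have "homotopic_rel_endpoints M (\<lambda>t. \<Phi>' (l t, t)) (\<lambda>t. \<Phi> (l t, t))"
      using \<Phi>'(1) yX 1 l by (simp add: refines_def)
    from homotopic_rel_endpoints_trans[OF l(4) homotopic_rel_endpoints_sym[OF this]]
    show False using \<Phi>'(2) x(1) l unfolding misses_def by blast
  qed
  show ?thesis
  proof (rule that[of \<Phi>'])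
    show "\<Phi>' (x, 1) \<noteq> a" if "path_component_of X x0 x" for x
      by (rule ne[OF that])
    show "continuous_map (prod_topology X (top_of_set {0..1})) M \<Phi>'" "\<And>x. \<Phi>' (x, 0) = \<Phi> (x, 0)"
      using \<Phi>'(1) by (simp_all add: refines_def)
  qed
qed

section \<open>Nielsen classes and homogeneous spaces\<close>

lemma locally_path_connected_manifold:
  assumes "topological_manifold n X"
  shows "locally_path_connected_space X"
  unfolding locally_path_connected_space
proof (intro allI impI)
  fix W x assume W: "openin X W \<and> x \<in> W"
  then have "x \<in> topspace X" using openin_subset[of X W] by blast
  then obtain U V where U: "openin X U" "x \<in> U" and V: "openin (Euclidean_space n) V"
    and hom: "subtopology X U homeomorphic_space subtopology (Euclidean_space n) V"
    using assms unfolding topological_manifold_def by blast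
  have "locally_path_connected_space (subtopology (Euclidean_space n) V)"
    using locally_path_connected_space_open_subset[OF locally_path_connected_Euclidean_space V] .
  then have lpc: "locally_path_connected_space (subtopology X U)"
    using homeomorphic_locally_path_connected_space[OF hom] by simp
  have "openin (subtopology X U) (U \<inter> W)"
    unfolding openin_open_subtopology[OF U(1)] using W U(1) by auto
  then have 1: "openin (subtopology X U) (U \<inter> W) \<and> x \<in> U \<inter> W" using W U(2) by blast
  obtain N where N: "openin (subtopology X U) N" "path_connectedin (subtopology X U) N" "x \<in> N" "N \<subseteq> U \<inter> W"
    using lpc[unfolded locally_path_connected_space, rule_format, OF 1] by blast
  have "openin X N" using N(1) unfolding openin_open_subtopology[OF U(1)] by blast
  moreover have "path_connectedin X N" using N(2) by (simp add: path_connectedin_subtopology)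
  ultimately show "\<exists>N. openin X N \<and> path_connectedin X N \<and> x \<in> N \<and> N \<subseteq> W"
    using N(3,4) by blast
qed

text \<open>Passes from classes to paths. A path from \<open>x0\<close> with homotopic labels ends
  at a coincidence of the end maps. By reflexivity of \<open>nielsen_rel\<close> that point lies in
  its own class, to which the class of \<open>x0\<close> would then be related.\<close>

lemma all_classes_inessential:
  assumes N: "geometric_nielsen_number X M f h = 0" and x0: "x0 \<in> Coin X f h"
    and f: "continuous_map X M f"
  obtains F H where "homotopy_from X M f F" "homotopy_from X M h H"
    "\<And>l. pathin X l \<Longrightarrow> l 0 = x0 \<Longrightarrow> \<not> homotopic_rel_endpoints M (\<lambda>t. F (l t, t)) (\<lambda>t. H (l t, t))"
proof -
  have refl: "x \<in> nielsen_rel X M f' h' `` {x}" if "x \<in> Coin X f' h'" "f' x \<in> topspace M" for x f' h'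
  proof -
    have "pathin X (\<lambda>_. x)" using that by (simp add: Coin_def pathin_def)
    moreover have "homotopic_rel_endpoints M (f' \<circ> (\<lambda>_. x)) (h' \<circ> (\<lambda>_::real. x))"
      using that by (simp add: Coin_def o_def homotopic_rel_endpoints_refl pathin_def)
    ultimately have "(x, x) \<in> nielsen_rel X M f' h'"
      unfolding nielsen_rel_def using that(1) by blast
    then show ?thesis by blast
  qed
  define C where "C = nielsen_rel X M f h `` {x0}"
  have "f x0 \<in> topspace M" using f x0 by (auto simp: Coin_def continuous_map_def Pi_iff)
  then have x0C: "x0 \<in> C" unfolding C_def using refl[OF x0] by simp
  have C: "C \<in> coincidence_classes X M f h"
    unfolding coincidence_classes_def C_def by (rule quotientI[OF x0])
  have "essential_classes X M f h = {}"
    using N by (auto simp: geometric_nielsen_number_def zero_enat_def split: if_splits)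
  with C have "geometrically_inessential X M f h C"
    unfolding essential_classes_def by blast
  then obtain F H where FH: "homotopy_from X M f F" "homotopy_from X M h H"
    and nr: "\<And>C'. C' \<in> coincidence_classes X M (\<lambda>x. F (x, 1)) (\<lambda>x. H (x, 1)) \<Longrightarrow> \<not> related_via X M F H C C'"
    unfolding geometrically_inessential_def by blast
  have "\<not> homotopic_rel_endpoints M (\<lambda>t. F (l t, t)) (\<lambda>t. H (l t, t))" if l: "pathin X l" "l 0 = x0" for l
  proof
    assume hre: "homotopic_rel_endpoints M (\<lambda>t. F (l t, t)) (\<lambda>t. H (l t, t))"
    define y where "y = l 1"
    have y: "y \<in> topspace X" unfolding y_def by (rule pathin_end_in[OF l(1)])
    have "F (y, 1) = H (y, 1)" using homotopic_rel_endpoints_imp(4)[OF hre] by (simp add: y_def)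
    then have yC: "y \<in> Coin X (\<lambda>x. F (x, 1)) (\<lambda>x. H (x, 1))" using y by (simp add: Coin_def)
    have "continuous_map (prod_topology X (top_of_set {0..1})) M F" using FH(1) by (simp add: homotopy_from_def)
    then have "F (y, 1) \<in> topspace M" using y by (auto dest!: continuous_map_funspace)
    with refl[OF yC] have yD: "y \<in> nielsen_rel X M (\<lambda>x. F (x, 1)) (\<lambda>x. H (x, 1)) `` {y}" by simp
    have "related_via X M F H C (nielsen_rel X M (\<lambda>x. F (x, 1)) (\<lambda>x. H (x, 1)) `` {y})"
      unfolding related_via_def using l x0C yD hre by (intro exI[of _ l]) (simp add: y_def)
    moreover have "nielsen_rel X M (\<lambda>x. F (x, 1)) (\<lambda>x. H (x, 1)) `` {y} \<in>
        coincidence_classes X M (\<lambda>x. F (x, 1)) (\<lambda>x. H (x, 1))"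
      unfolding coincidence_classes_def by (rule quotientI[OF yC])
    ultimately show False using nr by blast
  qed
  then show ?thesis using that FH by blast
qed

text \<open>The action of \<open>G\<close> on \<open>G/K\<close> is continuous because the projection is open.\<close>

lemma continuous_coset_action:
  fixes G :: "('g, 'r) monoid_scheme" (structure)
  assumes G: "group G" and T: "topspace T = carrier G"
    and mult: "continuous_map (prod_topology T T) T (\<lambda>(x, y). x \<otimes> y)"
    and K: "subgroup K G" and p: "quotient_map T M (\<lambda>g. g <#\<^bsub>G\<^esub> K)"
  shows "continuous_map (prod_topology T M) M (\<lambda>(g, m). g <#\<^bsub>G\<^esub> m)"
proof -
  interpret group G by (fact G)
  have KG: "K \<subseteq> carrier G" using K subgroup.subset by blast
  have M: "topspace M = (\<lambda>g. g <#\<^bsub>G\<^esub> K) ` carrier G" using p T by (auto simp: quotient_map_def)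
  have pc: "continuous_map T M (\<lambda>g. g <#\<^bsub>G\<^esub> K)" using p quotient_imp_continuous_map by blast
  have openp: "openin M ((\<lambda>g. g <#\<^bsub>G\<^esub> K) ` B)" if B: "openin T B" for B
  proof -
    have BG: "B \<subseteq> carrier G" using openin_subset[OF B] T by simp
    have "openin T {g \<in> topspace T. g \<otimes> k \<in> B}" if k: "k \<in> K" for k
    proof -
      have "continuous_map T (prod_topology T T) (\<lambda>g. (g, k))"
        using k KG T by (auto simp: continuous_map_paired)
      from continuous_map_compose[OF this mult] have "continuous_map T T (\<lambda>g. g \<otimes> k)"
        by (simp add: o_def)
      then show ?thesis using B by (rule openin_continuous_map_preimage)
    qed
    then have "openin T (\<Union>k\<in>K. {g \<in> topspace T. g \<otimes> k \<in> B})" by blast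
    \<comment> \<open>The saturation of \<open>B\<close> with respect to the projection is the union
      of its preimages under right translation by the elements of \<open>K\<close>.\<close>
    moreover have "(\<Union>k\<in>K. {g \<in> topspace T. g \<otimes> k \<in> B}) = {g \<in> topspace T. g <#\<^bsub>G\<^esub> K \<in> (\<lambda>g. g <#\<^bsub>G\<^esub> K) ` B}"
    proof (intro equalityI subsetI)
      fix g assume "g \<in> (\<Union>k\<in>K. {g \<in> topspace T. g \<otimes> k \<in> B})"
      then obtain k where k: "k \<in> K" "g \<in> carrier G" "g \<otimes> k \<in> B" using T by auto
      have "(g \<otimes> k) <#\<^bsub>G\<^esub> K = g <#\<^bsub>G\<^esub> (k <#\<^bsub>G\<^esub> K)" using k KG by (subst lcos_m_assoc) auto
      also have "k <#\<^bsub>G\<^esub> K = K" using k KG K by (intro coset_join3) auto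
      finally show "g \<in> {g \<in> topspace T. g <#\<^bsub>G\<^esub> K \<in> (\<lambda>g. g <#\<^bsub>G\<^esub> K) ` B}"
        using k T by (metis (mono_tags, lifting) image_eqI mem_Collect_eq)
    next
      fix g assume "g \<in> {g \<in> topspace T. g <#\<^bsub>G\<^esub> K \<in> (\<lambda>g. g <#\<^bsub>G\<^esub> K) ` B}"
      then obtain u where u: "g \<in> carrier G" "u \<in> B" "g <#\<^bsub>G\<^esub> K = u <#\<^bsub>G\<^esub> K" using T by auto
      have "u \<in> u <#\<^bsub>G\<^esub> K" using u BG subgroup.one_closed[OF K] by (force simp: l_coset_def)
      then have "u \<in> g <#\<^bsub>G\<^esub> K" using u by simp
      then obtain k where "k \<in> K" "u = g \<otimes> k" by (auto simp: l_coset_def)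
      then show "g \<in> (\<Union>k\<in>K. {g \<in> topspace T. g \<otimes> k \<in> B})" using u T by auto
    qed
    ultimately have "openin T {g \<in> topspace T. g <#\<^bsub>G\<^esub> K \<in> (\<lambda>g. g <#\<^bsub>G\<^esub> K) ` B}" by simp
    moreover have "(\<lambda>g. g <#\<^bsub>G\<^esub> K) ` B \<subseteq> topspace M" unfolding M using BG by (rule image_mono)
    ultimately show ?thesis
      using p[unfolded quotient_map_def, THEN conjunct2, rule_format, of "(\<lambda>g. g <#\<^bsub>G\<^esub> K) ` B"] by simp
  qed
  show ?thesis
    unfolding continuous_map_def
  proof (intro conjI allI impI)
    show "(\<lambda>(g, m). g <#\<^bsub>G\<^esub> m) \<in> topspace (prod_topology T M) \<rightarrow> topspace M"
      using KG by (auto simp: T M lcos_m_assoc)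
    fix W assume W: "openin M W"
    let ?S = "{z \<in> topspace (prod_topology T M). (case z of (g, m) \<Rightarrow> g <#\<^bsub>G\<^esub> m) \<in> W}"
    have pm: "continuous_map (prod_topology T T) M (\<lambda>(g, x). (g \<otimes> x) <#\<^bsub>G\<^esub> K)"
      using continuous_map_compose[OF mult pc] by (simp add: o_def case_prod_unfold)
    have P: "openin (prod_topology T T) {z \<in> topspace (prod_topology T T). (case z of (g, x) \<Rightarrow> (g \<otimes> x) <#\<^bsub>G\<^esub> K) \<in> W}"
      (is "openin _ ?P") by (rule openin_continuous_map_preimage[OF pm W])
    show "openin (prod_topology T M) ?S"
      unfolding openin_prod_topology_alt
    proof (intro allI impI)
      fix g m assume gm: "(g, m) \<in> ?S"
      then obtain x where x: "g \<in> carrier G" "x \<in> carrier G" "m = x <#\<^bsub>G\<^esub> K" "g <#\<^bsub>G\<^esub> m \<in> W"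
        by (auto simp: T M)
      then have "(g, x) \<in> ?P" using KG by (simp add: T lcos_m_assoc)
      then obtain A B where AB: "openin T A" "openin T B" "g \<in> A" "x \<in> B" "A \<times> B \<subseteq> ?P"
        using P unfolding openin_prod_topology_alt by meson
      have ABG: "A \<subseteq> carrier G" "B \<subseteq> carrier G" using openin_subset[OF AB(1)] openin_subset[OF AB(2)] T by simp_all
      have "A \<times> (\<lambda>g. g <#\<^bsub>G\<^esub> K) ` B \<subseteq> ?S"
      proof
        fix z assume "z \<in> A \<times> (\<lambda>g. g <#\<^bsub>G\<^esub> K) ` B"
        then obtain g' x' where z: "z = (g', x' <#\<^bsub>G\<^esub> K)" "g' \<in> A" "x' \<in> B" by auto
        then have "(g' \<otimes> x') <#\<^bsub>G\<^esub> K \<in> W" using AB(5) by auto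
        moreover have "g' \<in> carrier G" "x' \<in> carrier G" using z ABG by auto
        ultimately show "z \<in> ?S" using z KG by (auto simp: T M lcos_m_assoc)
      qed
      then show "\<exists>U V. openin T U \<and> openin M V \<and> g \<in> U \<and> m \<in> V \<and> U \<times> V \<subseteq> ?S"
        using AB(1,3,4) openp[OF AB(2)] x(3) by (intro exI[of _ A] exI[of _ "(\<lambda>g. g <#\<^bsub>G\<^esub> K) ` B"]) auto
    qed
  qed
qed

text \<open>Path components are open here, so homotopies chosen independently on them paste
  together. Indexing by a representative \<open>r x\<close> of the component makes all its points
  use the same homotopy.\<close>

lemma homotopy_glue_path_components:
  fixes \<Phi> :: "'x \<Rightarrow> 'x \<times> real \<Rightarrow> 'm"
  assumes X: "locally_path_connected_space X"
    and \<Phi>: "\<And>x. x \<in> topspace X \<Longrightarrow> continuous_map (prod_topology X (top_of_set {0..1})) M (\<Phi> x)"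
  obtains r where "continuous_map (prod_topology X (top_of_set {0..1})) M (\<lambda>(x, t). \<Phi> (r x) (x, t))"
    "\<And>x. x \<in> topspace X \<Longrightarrow> path_component_of X (r x) x"
proof -
  define r where "r = (\<lambda>x. SOME y. path_component_of X x y)"
  have r: "path_component_of X x (r x)" if "x \<in> topspace X" for x
    unfolding r_def by (rule someI[of _ x]) (use that in \<open>simp add: path_component_of_refl\<close>)
  have same: "r x = r y" if "path_component_of X x y" for x y
    using that unfolding r_def path_component_of_equiv[of X x y] by simp
  let ?XI = "prod_topology X (top_of_set {0..1::real})"
  have "continuous_map ?XI M (\<lambda>(x, t). \<Phi> (r x) (x, t))"
  proof (rule pasting_lemma[where I = "topspace X" and T = "\<lambda>i. Collect (path_component_of X i) \<times> {0..1}"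
        and f = "\<lambda>i. \<Phi> (r i)"])
    show "openin ?XI (Collect (path_component_of X i) \<times> {0..1})" for i
      using openin_path_component_of_locally_path_connected_space[OF X, of i]
      by (auto simp: openin_prod_Times_iff)
    show "continuous_map (subtopology ?XI (Collect (path_component_of X i) \<times> {0..1})) M (\<Phi> (r i))"
      if "i \<in> topspace X" for i
      by (rule continuous_map_from_subtopology[OF \<Phi>]) (use r[OF that] path_component_in_topspace in metis)
    show "\<Phi> (r i) z = \<Phi> (r j) z"
      if "z \<in> topspace ?XI \<inter> Collect (path_component_of X i) \<times> {0..1} \<inter> Collect (path_component_of X j) \<times> {0..1}"
      for i j z
      using that same[of i "fst z"] same[of j "fst z"] by auto
    show "\<exists>j. j \<in> topspace X \<and> z \<in> Collect (path_component_of X j) \<times> {0..1} \<and>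
        (case z of (x, t) \<Rightarrow> \<Phi> (r x) (x, t)) = \<Phi> (r j) z" if "z \<in> topspace ?XI" for z
      using that by (intro exI[of _ "fst z"]) (auto simp: path_component_of_refl)
  qed
  moreover have "path_component_of X (r x) x" if "x \<in> topspace X" for x
    using path_component_of_sym[OF r[OF that]] .
  ultimately show ?thesis using that by blast
qed

section \<open>From vanishing Nielsen number to a coincidence-free map\<close>

theorem theorem4p1:
  fixes X :: "'x topology" and M :: "'g set topology"
    and G :: "('g, 'r) monoid_scheme" and T :: "'g topology" and A :: "'g chart set"
    and K :: "'g set" and f h :: "'x \<Rightarrow> 'g set" and dX dM dG :: nat
  assumes "topological_manifold dX X" and "compact_space X"
    and "topological_manifold dM M"
    and "lie_group G dG T A" and "connected_space T"
    and "subgroup K G" and "closedin T K"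
    and "quotient_map T M (\<lambda>g. g <#\<^bsub>G\<^esub> K)"
    and "continuous_map X M f" and "continuous_map X M h"
    and "\<exists>fhat. continuous_map X T fhat \<and> (\<forall>x\<in>topspace X. fhat x <#\<^bsub>G\<^esub> K = f x)"
    and "geometric_nielsen_number X M f h = 0"
  shows "\<exists>h'. homotopic_with (\<lambda>_. True) X M h h' \<and> Coin X f h' = {}"
proof -
  let ?XI = "prod_topology X (top_of_set {0..1::real})"
  note M = assms(3) and K = assms(6) and p = assms(8) and f = assms(9) and h = assms(10)
  have G: "group G" and T: "topspace T = carrier G"
    and mult: "continuous_map (prod_topology T T) T (\<lambda>(x, y). x \<otimes>\<^bsub>G\<^esub> y)"
    and inv: "continuous_map T T (\<lambda>x. inv\<^bsub>G\<^esub> x)"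
    using assms(4) by (auto simp: lie_group_def smooth_map_def)
  interpret group G by (fact G)
  have X: "compact_space X" "Hausdorff_space X" "locally_path_connected_space X"
    using assms(1,2) locally_path_connected_manifold by (auto simp: topological_manifold_def)
  obtain fhat where fhat: "continuous_map X T fhat" "\<And>x. x \<in> topspace X \<Longrightarrow> fhat x <#\<^bsub>G\<^esub> K = f x"
    using assms(11) by blast
  have KG: "K \<subseteq> carrier G" using K by (rule subgroup.subset)
  have TM: "topspace M = (\<lambda>g. g <#\<^bsub>G\<^esub> K) ` carrier G"
    using p T by (auto simp: quotient_map_def)
  have MG: "m \<subseteq> carrier G" if "m \<in> topspace M" for m
    using that KG by (auto simp: TM l_coset_def)
  have fG: "fhat x \<in> carrier G" if "x \<in> topspace X" for x
    using continuous_map_funspace[OF fhat(1)] that T by auto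
  have KM: "K \<in> topspace M"
    unfolding TM by (rule image_eqI[where x = "\<one>\<^bsub>G\<^esub>"]) (simp_all add: lcos_mult_one[OF KG])
  note act = continuous_coset_action[OF G T mult K p]
  have act_cont: "continuous_map Z M (\<lambda>z. g z <#\<^bsub>G\<^esub> m z)"
    if "continuous_map Z T g" "continuous_map Z M m" for Z :: "'c topology" and g m
  proof -
    have "continuous_map Z (prod_topology T M) (\<lambda>z. (g z, m z))"
      using that by (simp add: continuous_map_paired)
    from continuous_map_compose[OF this act] show ?thesis by (simp add: o_def)
  qed
  have cancel: "inv\<^bsub>G\<^esub> g <#\<^bsub>G\<^esub> (g <#\<^bsub>G\<^esub> m) = m" "g <#\<^bsub>G\<^esub> (inv\<^bsub>G\<^esub> g <#\<^bsub>G\<^esub> m) = m"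
    if "g \<in> carrier G" "m \<in> topspace M" for g m
    using that MG by (simp_all add: lcos_m_assoc lcos_mult_one)
  have inv_fhat: "continuous_map X T (\<lambda>x. inv\<^bsub>G\<^esub> fhat x)"
    using continuous_map_compose[OF fhat(1) inv] by (simp add: o_def)
  have on_XI: "continuous_map ?XI T (\<lambda>z. g (fst z))" if "continuous_map X T g" for g
    using continuous_map_compose[OF continuous_map_fst that] by (simp add: o_def)
  have component: "\<exists>\<Psi>. continuous_map ?XI M \<Psi> \<and> (\<forall>y\<in>topspace X. \<Psi> (y, 0) = h y) \<and>
      (\<forall>y. path_component_of X x y \<longrightarrow> \<Psi> (y, 1) \<noteq> f y)" for x
  proof (cases "\<exists>x0\<in>Coin X f h. path_component_of X x x0")
    case False
    have "continuous_map ?XI M (\<lambda>z. h (fst z))"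
      using continuous_map_compose[OF continuous_map_fst h] by (simp add: o_def)
    moreover have "h y \<noteq> f y" if y: "path_component_of X x y" for y
      using False y path_component_in_topspace[OF y] by (auto simp: Coin_def)
    ultimately show ?thesis by (intro exI[of _ "\<lambda>z. h (fst z)"]) auto
  next
    case True
    then obtain x0 where x0: "x0 \<in> Coin X f h" "path_component_of X x x0" by blast
    obtain F H where F: "homotopy_from X M f F" and H: "homotopy_from X M h H"
      and FH: "\<And>l. pathin X l \<Longrightarrow> l 0 = x0 \<Longrightarrow> \<not> homotopic_rel_endpoints M (\<lambda>t. F (l t, t)) (\<lambda>t. H (l t, t))"
      by (rule all_classes_inessential[OF assms(12) x0(1) f]) blast
    have Fc: "continuous_map ?XI M F" and F0: "\<And>x. x \<in> topspace X \<Longrightarrow> F (x, 0) = f x"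
      and Hc: "continuous_map ?XI M H" and H0: "\<And>x. x \<in> topspace X \<Longrightarrow> H (x, 0) = h x"
      using F H by (auto simp: homotopy_from_def)
    \<comment> \<open>At stage \<open>r\<close> the homotopy \<open>F\<close> is run only up to time
      \<open>1 - r\<close>: stage 0 is \<open>F\<close> itself, stage 1 rests at \<open>f\<close>,
      and the value at \<open>x0\<close> and time 0 never changes, as
      \<open>push_along_family\<close> requires.\<close>
    define \<Gamma> where "\<Gamma> = (\<lambda>(x, t, r). F (x, (1 - r) * t))"
    have \<Gamma>: "continuous_map (prod_topology X (top_of_set ({0..1} \<times> {0..1}))) M \<Gamma>"
    proof -
      have 1: "continuous_map (top_of_set ({0..1} \<times> {0..1::real})) (top_of_set {0..1}) (\<lambda>z. (1 - snd z) * fst z)"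
        by (auto simp: continuous_map_in_subtopology mult_le_one intro!: continuous_intros)
      have "continuous_map (prod_topology X (top_of_set ({0..1} \<times> {0..1}))) ?XI (\<lambda>z. (fst z, (1 - snd (snd z)) * fst (snd z)))"
        unfolding continuous_map_paired
        using continuous_map_compose[OF continuous_map_snd 1] by (simp add: continuous_map_fst o_def)
      from continuous_map_compose[OF this Fc] show ?thesis by (simp add: \<Gamma>_def o_def case_prod_unfold)
    qed
    have "unrelated X M \<Gamma> x0 (\<lambda>_. 0) H" using Hc FH by (simp add: unrelated_def \<Gamma>_def)
    moreover have "\<Gamma> (x0, 0, r) = F (x0, 0)" for r by (simp add: \<Gamma>_def)
    ultimately obtain H' where H': "unrelated X M \<Gamma> x0 (\<lambda>_. 1) H'" "\<And>x. H' (x, 0) = H (x, 0)"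
      using push_along_family[OF M X \<Gamma>, of x0 "F (x0, 0)" H] by metis
    have H'c: "continuous_map ?XI M H'" using H'(1) by (simp add: unrelated_def)
    have H'M: "H' z \<in> topspace M" if "z \<in> topspace ?XI" for z
      using continuous_map_funspace[OF H'c] that by auto
    define \<Phi> where "\<Phi> = (\<lambda>z. inv\<^bsub>G\<^esub> (fhat (fst z)) <#\<^bsub>G\<^esub> H' z)"
    have \<Phi>c: "continuous_map ?XI M \<Phi>"
      unfolding \<Phi>_def by (intro act_cont on_XI inv_fhat H'c)
    have x0X: "x0 \<in> topspace X" "f x0 = h x0" using x0(1) by (auto simp: Coin_def)
    have "\<Phi> (x0, 0) = inv\<^bsub>G\<^esub> (fhat x0) <#\<^bsub>G\<^esub> (fhat x0 <#\<^bsub>G\<^esub> K)"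
      using x0X fhat(2)[of x0] by (simp add: \<Phi>_def H'(2) H0)
    also have "\<dots> = K" by (rule cancel(1)[OF fG[OF x0X(1)] KM])
    finally have \<Phi>0: "\<Phi> (x0, 0) = K" .
    have "misses X M x0 (\<lambda>_. K) \<Phi>"
      unfolding misses_def
    proof (intro allI impI notI)
      fix l assume l: "pathin X l \<and> l 0 = x0" and hre: "homotopic_rel_endpoints M (\<lambda>_. K) (\<lambda>t. \<Phi> (l t, t))"
      have lX: "l t \<in> topspace X" if "t \<in> {0..1}" for t
        using l that by (auto simp: pathin_def continuous_map_def Pi_iff)
      obtain k where k: "continuous_map (top_of_set ({0..1::real} \<times> {0..1::real})) M k"
        "\<forall>t\<in>{0..1}. k (0, t) = K \<and> k (1, t) = \<Phi> (l t, t)" "\<forall>s\<in>{0..1}. k (s, 0) = K \<and> k (s, 1) = K"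
        using hre by (auto simp: homotopic_rel_endpoints_iff)
      have "continuous_map (top_of_set ({0..1::real} \<times> {0..1::real})) (top_of_set {0..1}) snd"
        by (auto simp: continuous_map_in_subtopology intro!: continuous_intros)
      then have "continuous_map (top_of_set ({0..1::real} \<times> {0..1::real})) X (l \<circ> snd)"
        using l by (intro continuous_map_compose) (auto simp: pathin_def)
      from continuous_map_compose[OF this fhat(1)]
      have fl: "continuous_map (top_of_set ({0..1::real} \<times> {0..1::real})) T (\<lambda>z. fhat (l (snd z)))"
        by (simp add: o_def)
      have \<Phi>l: "fhat (l t) <#\<^bsub>G\<^esub> \<Phi> (l t, t) = H' (l t, t)" if "t \<in> {0..1}" for t
        using lX[OF that] that cancel(2)[OF fG H'M] by (simp add: \<Phi>_def)
      have e1: "H' (l 1, 1) = f (l 1)"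
        using \<Phi>l[of 1] homotopic_rel_endpoints_imp(4)[OF hre] fhat(2)[OF lX, of 1] by simp
      \<comment> \<open>Acting by \<open>fhat (l t)\<close> at time \<open>t\<close> turns a
        homotopy between the constant label \<open>K\<close> and the label along
        \<open>\<Phi>\<close> into one between the label along the resting target \<open>f\<close>
        and the label along \<open>H'\<close>, which \<open>H'\<close> excludes.\<close>
      have "homotopic_rel_endpoints M (\<lambda>t. \<Gamma> (l t, t, 1)) (\<lambda>t. H' (l t, t))"
        unfolding homotopic_rel_endpoints_iff
      proof (intro exI[of _ "\<lambda>z. fhat (l (snd z)) <#\<^bsub>G\<^esub> k z"] conjI ballI)
        show "continuous_map (top_of_set ({0..1} \<times> {0..1})) M (\<lambda>z. fhat (l (snd z)) <#\<^bsub>G\<^esub> k z)"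
          by (intro act_cont fl k(1))
        show "fhat (l (snd (0::real, t))) <#\<^bsub>G\<^esub> k (0, t) = \<Gamma> (l t, t, 1)" if "t \<in> {0..1}" for t
          using k(2) that fhat(2)[OF lX[OF that]] F0[OF lX[OF that]] by (simp add: \<Gamma>_def)
        show "fhat (l (snd (1::real, t))) <#\<^bsub>G\<^esub> k (1, t) = H' (l t, t)" if "t \<in> {0..1}" for t
          using k(2) that \<Phi>l[OF that] by simp
        show "fhat (l (snd (s, 0::real))) <#\<^bsub>G\<^esub> k (s, 0) = \<Gamma> (l 0, 0, 1)" if "s \<in> {0..1}" for s
          using k(3) that fhat(2)[OF lX, of 0] F0[OF lX, of 0] by (simp add: \<Gamma>_def)
        show "fhat (l (snd (s, 1::real))) <#\<^bsub>G\<^esub> k (s, 1) = \<Gamma> (l 1, 1, 1)" if "s \<in> {0..1}" for s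
          using k(3) that fhat(2)[OF lX, of 1] F0[OF lX, of 1] by (simp add: \<Gamma>_def)
      qed
      then show False using H'(1) l by (auto simp: unrelated_def)
    qed
    from remove_roots_of_component[OF M X(1,3) \<Phi>c KM \<Phi>0 this]
    obtain \<Phi>' where \<Phi>': "continuous_map ?XI M \<Phi>'" "\<And>x. \<Phi>' (x, 0) = \<Phi> (x, 0)"
      "\<And>x. path_component_of X x0 x \<Longrightarrow> \<Phi>' (x, 1) \<noteq> K"
      by blast
    have \<Phi>'M: "\<Phi>' z \<in> topspace M" if "z \<in> topspace ?XI" for z
      using continuous_map_funspace[OF \<Phi>'(1)] that by auto
    \<comment> \<open>Acting by the lift again undoes the normalization: roots at \<open>K\<close>
      become coincidences with \<open>f\<close>, and at time 0 the two actions cancel to give back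
      \<open>h\<close>.\<close>
    define \<Psi> where "\<Psi> = (\<lambda>z. fhat (fst z) <#\<^bsub>G\<^esub> \<Phi>' z)"
    have "continuous_map ?XI M \<Psi>"
      unfolding \<Psi>_def by (intro act_cont on_XI fhat(1) \<Phi>'(1))
    moreover have "\<Psi> (y, 0) = h y" if "y \<in> topspace X" for y
      using that cancel(2)[OF fG[OF that] funcset_mem[OF continuous_map_funspace[OF h] that]]
      by (simp add: \<Psi>_def \<Phi>'(2) \<Phi>_def H'(2) H0)
    moreover have "\<Psi> (y, 1) \<noteq> f y" if y: "path_component_of X x y" for y
    proof
      assume eq: "\<Psi> (y, 1) = f y"
      have yX: "y \<in> topspace X" using path_component_in_topspace[OF y] by simp
      have "\<Phi>' (y, 1) = inv\<^bsub>G\<^esub> (fhat y) <#\<^bsub>G\<^esub> \<Psi> (y, 1)"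
        using cancel(1)[OF fG \<Phi>'M] yX by (simp add: \<Psi>_def)
      also have "\<dots> = K"
        using eq fhat(2)[OF yX] cancel(1)[OF fG[OF yX] KM] by simp
      finally have "\<Phi>' (y, 1) = K" .
      moreover have "path_component_of X x0 y"
        by (rule path_component_of_trans[OF path_component_of_sym[OF x0(2)] y])
      ultimately show False using \<Phi>'(3) by blast
    qed
    ultimately show ?thesis by blast
  qed
  then obtain \<Psi> where \<Psi>: "\<And>x. continuous_map ?XI M (\<Psi> x)" "\<And>x y. y \<in> topspace X \<Longrightarrow> \<Psi> x (y, 0) = h y"
    "\<And>x y. path_component_of X x y \<Longrightarrow> \<Psi> x (y, 1) \<noteq> f y"
    by metis
  obtain r where r: "continuous_map ?XI M (\<lambda>(x, t). \<Psi> (r x) (x, t))"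
    "\<And>x. x \<in> topspace X \<Longrightarrow> path_component_of X (r x) x"
    by (rule homotopy_glue_path_components[of X M \<Psi>, OF X(3) \<Psi>(1)]) blast
  define h' where "h' = (\<lambda>x. \<Psi> (r x) (x, 1))"
  have "homotopic_with (\<lambda>_. True) X M h h'"
  proof (subst homotopic_with, simp, intro exI[of _ "\<lambda>(t, x). \<Psi> (r x) (x, t)"] conjI ballI)
    have "continuous_map (prod_topology (top_of_set {0..1}) X) ?XI (\<lambda>z. (snd z, fst z))"
      by (simp add: continuous_map_paired continuous_map_fst continuous_map_snd)
    from continuous_map_compose[OF this r(1)]
    show "continuous_map (prod_topology (top_of_set {0..1}) X) M (\<lambda>(t, x). \<Psi> (r x) (x, t))"
      by (simp add: o_def case_prod_unfold)
  qed (auto simp: \<Psi>(2) h'_def)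
  moreover have "Coin X f h' = {}"
    using \<Psi>(3) r(2) by (fastforce simp: Coin_def h'_def)
  ultimately show ?thesis by blast
qed

end
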